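(* Let $p_{\tau,h}\in\widetilde{\mathcal W}^{r,s}_{\tau,h}$, $\boldsymbol q_{\tau,h}\in\widetilde{\boldsymbol{\mathcal V}}^{r,s}_{\tau,h}$ and $\boldsymbol u_{\tau,h}\in\widetilde{\boldsymbol{\mathcal Z}}^{r,s+1}_{\tau,h}$ denote the fully discrete (discontinuous in time) space-time finite element approximation of the Biot system, represented on $I_n$ by $p_{\tau,h}|_{I_n}=\sum_{j=0}^rP^j_{n,h}\varphi_{n,j}$, $\boldsymbol q_{\tau,h}|_{I_n}=\sum_{j=0}^r\boldsymbol Q^j_{n,h}\varphi_{n,j}$, $\boldsymbol u_{\tau,h}|_{I_n}=\sum_{j=0}^r\boldsymbol U^j_{n,h}\varphi_{n,j}$. Let $p^k_{\tau,h}|_{I_n}=\sum_{j=0}^rP^{j,k}_{n,h}\varphi_{n,j}$, $\boldsymbol q^k_{\tau,h}|_{I_n}=\sum_{j=0}^r\boldsymbol Q^{j,k}_{n,h}\varphi_{n,j}$, $\boldsymbol u^k_{\tau,h}|_{I_n}=\sum_{j=0}^r\boldsymbol U^{j,k}_{n,h}\varphi_{n,j}$ be the iterates whose coefficient functions are given by the fixed-stress iterative scheme (dG($r$)–MFEM($s$)cG($s+1$)) described in the context. Then, for any $L\ge b^2/(2\lambda)$, the sequence $\{S_p^{i,k}\}_k$, where $S_p^{i,k}=\sum_{j=0}^r\widetilde\alpha_{ij}(P^{j,k}_{n,h}-P^j_{n,h})$, converges geometrically in $W_h$ for $i=0,\dots,r$. This implies, for $k\to\infty$, the convergence of $\{p^k_{\tau,h}(t_n^\pm),\boldsymbol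 q^k_{\tau,h}(t_n^\pm),\boldsymbol u^k_{\tau,h}(t_n^\pm)\}$ to $\{p_{\tau,h}(t_n^\pm),\boldsymbol q_{\tau,h}(t_n^\pm),\boldsymbol u_{\tau,h}(t_n^\pm)\}$ in $W_h\times\boldsymbol V_h\times\boldsymbol H_h$ for $n=1,\dots,N$ (where for $n=N$ only the one-sided limit $t_N^-$ is meant).
   Context: Setting. $\Omega\subset\mathbb R^d$, $d\in\{2,3\}$, is a bounded polyhedral Lipschitz domain, $I=(0,T]$; $M,b,\mu,\lambda$ are positive constants; $\boldsymbol K\in\boldsymbol L^\infty(\Omega)$ is symmetric and uniformly positive definite; $f$ is a given source whose nodal values in time $f(t_{n,i})\in L^2(\Omega)$ are used below. $\langle\cdot,\cdot\rangle$ is the $L^2(\Omega)$ inner product and $\boldsymbol\varepsilon(\boldsymbol u)=(\nabla\boldsymbol u+(\nabla\boldsymbol u)^\top)/2$. The Biot system is $-\nabla\cdot(2\mu\boldsymbol\varepsilon(\boldsymbol u)+\lambda(\nabla\cdot\boldsymbol u)\boldsymbol I-b\,p\,\boldsymbol I)=\rho_b\boldsymbol g$, $\partial_t(\frac1Mp+\nabla\cdot(b\boldsymbol u))+\nabla\cdot\boldsymbol q=f$, $\boldsymbol q=-\boldsymbol K\nabla p$ with zero initial values for $p,\boldsymbol u$ and homogeneous Dirichlet conditions for $p,\boldsymbol u$ (the body force term does not appear in the discrete equations below). Discrete spaces. $\mathcal T_h$ is a decomposition of $\overline\Omega$ into quadrilaterals ($d=2$) or hexahedra ($d=3$) $K$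 with reference maps $T_K:\widehat K\to K$. For $s\ge0$: $W_h=W_h^s=\{w_h\in L^2(\Omega)\mid w_h|_K\circ T_K\in\mathbb Q_s\}$, $\boldsymbol V_h=\boldsymbol V_h^s\subset\boldsymbol H(\mathrm{div};\Omega)$ is the corresponding Raviart–Thomas ($d=2$) or Raviart–Thomas–Nédélec ($d=3$) space, so that $(W_h,\boldsymbol V_h)$ is an inf-sup stable pair, and $\boldsymbol H_h=\boldsymbol H_h^{s+1}=\{\boldsymbol z_h\in C(\overline\Omega)^d\mid\boldsymbol z_h|_K\circ T_K\in\mathbb Q_{s+1}^d,\ \boldsymbol z_h|_{\partial\Omega}=\boldsymbol 0\}$; $\mathbb Q_m$ denotes polynomials of degree at most $m$ in each variable. $0=t_0<\dots<t_N=T$, $I_n=(t_{n-1},t_n]$, $\tau_n=t_n-t_{n-1}$. For $r\ge0$, $\widetilde{\mathcal W}^{r,s}_{\tau,h}$, $\widetilde{\boldsymbol{\mathcal V}}^{r,s}_{\tau,h}$, $\widetilde{\boldsymbol{\mathcal Z}}^{r,s+1}_{\tau,h}$ are the spaces of functions of time (not necessarily continuous) whose restriction to each $I_n$ is a polynomial in time of degree at most $r$ with values in $W_h$, $\boldsymbol V_h$, $\boldsymbol H_h$, respectively, and whose value at $t=0$ lies in the same space. Notation: $v(t_n^\pm)=\lim_{t\to t_n\pm0}v(t)$. Time basis. $t_{n,0},\dots,t_{n,r}\in I_n$ are the points of the $(r+1)$-point Gauss quadrature formula on $I_n$; $\varphi_{n,0},\dots,\varphi_{n,r}$ are the Lagrange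 basis polynomials of degree $r$ for these points. For $i,j=0,\dots,r$: $\gamma_i=\varphi_{n,i}(t_{n-1}^+)$, $\alpha_{ij}=\int_{I_n}\varphi_{n,j}'\varphi_{n,i}\,dt$, $\widetilde\alpha_{ij}=\alpha_{ij}+\gamma_i\gamma_j$, and $\widetilde\beta_{ii}=\beta_{ii}=\frac1{\tau_n}\int_{I_n}\varphi_{n,i}\varphi_{n,i}\,dt>0$. Discrete coupled solution. $(p_{\tau,h},\boldsymbol q_{\tau,h},\boldsymbol u_{\tau,h})$ is the solution (assumed to exist uniquely) of the coupled discretized Biot system (time integrals evaluated by the Gauss formula): for all $n=1,\dots,N$, $i=0,\dots,r$, $w_h\in W_h$, $\boldsymbol v_h\in\boldsymbol V_h$, $\boldsymbol z_h\in\boldsymbol H_h$ $$\tfrac1M\sum_{j=0}^r\widetilde\alpha_{ij}\langle P^j_{n,h},w_h\rangle+\tau_n\widetilde\beta_{ii}\langle\nabla\cdot\boldsymbol Q^i_{n,h},w_h\rangle=\tau_n\widetilde\beta_{ii}\langle f(t_{n,i}),w_h\rangle-b\sum_{j=0}^r\widetilde\alpha_{ij}\langle\nabla\cdot\boldsymbol U^j_{n,h},w_h\rangle+\gamma_i\tfrac1M\langle p_{\tau,h}(t_{n-1}^-),w_h\rangle+\gamma_i\langle b\nabla\cdot\boldsymbol u_{\tau,h}(t_{n-1}^-),w_h\rangle,$$ $$\langle\boldsymbol K^{-1}\boldsymbol Q^i_{n,h},\boldsymbol v_h\rangle-\langle P^i_{n,h},\nabla\cdot\boldsymbol v_h\rangle=0,$$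 $$2\mu\langle\boldsymbol\varepsilon(\boldsymbol U^i_{n,h}),\boldsymbol\varepsilon(\boldsymbol z_h)\rangle+\lambda\langle\nabla\cdot\boldsymbol U^i_{n,h},\nabla\cdot\boldsymbol z_h\rangle-b\langle P^i_{n,h},\nabla\cdot\boldsymbol z_h\rangle=0,$$ with $p_{\tau,h}(t_0^-)=0$, $\boldsymbol u_{\tau,h}(t_0^-)=\boldsymbol 0$. Iterative scheme (parameter $L>0$). On each $I_n$, successively for $n=1,\dots,N$, iterate over $k$ (to the limit before proceeding to $I_{n+1}$): given the $k$-th iterate, find $P^{i,k+1}_{n,h}\in W_h$, $\boldsymbol Q^{i,k+1}_{n,h}\in\boldsymbol V_h$, $\boldsymbol U^{i,k+1}_{n,h}\in\boldsymbol H_h$, $i=0,\dots,r$, such that for all $w_h,\boldsymbol v_h,\boldsymbol z_h$ and $i=0,\dots,r$ $$\tfrac1M\sum_{j=0}^r\widetilde\alpha_{ij}\langle P^{j,k+1}_{n,h},w_h\rangle+L\sum_{j=0}^r\widetilde\alpha_{ij}\langle P^{j,k+1}_{n,h}-P^{j,k}_{n,h},w_h\rangle+\tau_n\widetilde\beta_{ii}\langle\nabla\cdot\boldsymbol Q^{i,k+1}_{n,h},w_h\rangle$$ $$=\tau_n\widetilde\beta_{ii}\langle f(t_{n,i}),w_h\rangle-b\sum_{j=0}^r\widetilde\alpha_{ij}\langle\nabla\cdot\boldsymbol U^{j,k}_{n,h},w_h\rangle+\gamma_i\tfrac1M\langle p^\infty_{\tau,h}(t_{n-1}^-),w_h\rangle+\gamma_i\langle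 b\nabla\cdot\boldsymbol u^\infty_{\tau,h}(t_{n-1}^-),w_h\rangle,$$ $$\langle\boldsymbol K^{-1}\boldsymbol Q^{i,k+1}_{n,h},\boldsymbol v_h\rangle-\langle P^{i,k+1}_{n,h},\nabla\cdot\boldsymbol v_h\rangle=0,$$ $$2\mu\langle\boldsymbol\varepsilon(\boldsymbol U^{i,k+1}_{n,h}),\boldsymbol\varepsilon(\boldsymbol z_h)\rangle+\lambda\langle\nabla\cdot\boldsymbol U^{i,k+1}_{n,h},\nabla\cdot\boldsymbol z_h\rangle-b\langle P^{i,k+1}_{n,h},\nabla\cdot\boldsymbol z_h\rangle=0,$$ where $p^\infty_{\tau,h}(t_{n-1}^-)=\lim_{l\to\infty}p^l_{\tau,h}(t_{n-1}^-)$, $\boldsymbol u^\infty_{\tau,h}(t_{n-1}^-)=\lim_{l\to\infty}\boldsymbol u^l_{\tau,h}(t_{n-1}^-)$ for $n>1$, and both are zero for $n=1$. Geometric convergence of a sequence $x_k\to x$ in a normed space means $\|x_k-x\|\le Cq^k$ for some $C\ge0$, $q\in(0,1)$. *)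

theory Defs
  imports "HOL-Analysis.Analysis" "HOL-Computational_Algebra.Polynomial"
begin

section \<open>Domain and function spaces\<close>

text \<open>Near each boundary point the domain is the region above the graph of a Lipschitz function
  over the hyperplane orthogonal to a unit vector \<open>e\<close>. The function is given on the whole space and
  is invariant in direction \<open>e\<close>.\<close>

definition lipschitz_boundary :: "(real^'d::finite) set \<Rightarrow> bool" where
  "lipschitz_boundary \<Omega> \<longleftrightarrow>
     (\<forall>x\<in>frontier \<Omega>. \<exists>\<rho>>0. \<exists>e g C. norm e = 1 \<and> C-lipschitz_on UNIV g \<and>
        (\<forall>y a. g (y + a *\<^sub>R e) = (g y :: real)) \<and>
        \<Omega> \<inter> ball x \<rho> = {y \<in> ball x \<rho>. g y < y \<bullet> e})"

text \<open>\<open>polytope\<close> is convex in the library; polyhedral domains need not be.\<close>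

definition polyhedral_lipschitz_domain :: "(real^'d::finite) set \<Rightarrow> bool" where
  "polyhedral_lipschitz_domain \<Omega> \<longleftrightarrow>
     open \<Omega> \<and> connected \<Omega> \<and> \<Omega> \<noteq> {} \<and> bounded \<Omega> \<and>
     (\<exists>F. finite F \<and> (\<forall>S\<in>F. polytope S) \<and> closure \<Omega> = \<Union>F) \<and>
     lipschitz_boundary \<Omega>"

text \<open>Elements of \<open>L\<^sup>2(\<Omega>)\<close> are represented by functions on the whole space, of which only the values
  on \<open>\<Omega>\<close> up to null sets matter. The value type may be scalars, vectors or matrices; on matrices
  \<open>\<bullet>\<close> is the Frobenius product.\<close>

definition L2 :: "(real^'d::finite) set \<Rightarrow> (real^'d \<Rightarrow> 'b::euclidean_space) set" where
  "L2 \<Omega> = {f. f \<in> borel_measurable (lebesgue_on \<Omega>) \<and>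
               integrable (lebesgue_on \<Omega>) (\<lambda>x. (norm (f x))\<^sup>2)}"

definition L2_inner ::
  "(real^'d::finite) set \<Rightarrow> (real^'d \<Rightarrow> 'b::euclidean_space) \<Rightarrow> (real^'d \<Rightarrow> 'b) \<Rightarrow> real" where
  "L2_inner \<Omega> f g = (\<integral>x. f x \<bullet> g x \<partial>(lebesgue_on \<Omega>))"

definition L2_norm :: "(real^'d::finite) set \<Rightarrow> (real^'d \<Rightarrow> 'b::euclidean_space) \<Rightarrow> real" where
  "L2_norm \<Omega> f = sqrt (L2_inner \<Omega> f f)"

text \<open>Differential operators are the classical ones, pointwise. The finite element functions below
  are smooth in the interior of every cell, so the operators are defined outside the null set formed
  by the cell boundaries; for functions that are in \<open>H(div)\<close>, or continuous on the closed domain,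
  they coincide almost everywhere with the distributional ones.\<close>

definition grad :: "(real^'d::finite \<Rightarrow> real) \<Rightarrow> real^'d \<Rightarrow> real^'d" where
  "grad \<phi> x = (\<chi> i. frechet_derivative \<phi> (at x) (axis i 1))"

definition vgrad :: "(real^'d::finite \<Rightarrow> real^'d) \<Rightarrow> real^'d \<Rightarrow> real^'d^'d" where
  "vgrad v x = jacobian v (at x)"

definition divergence :: "(real^'d::finite \<Rightarrow> real^'d) \<Rightarrow> real^'d \<Rightarrow> real" where
  "divergence v x = trace (vgrad v x)"

definition strain :: "(real^'d::finite \<Rightarrow> real^'d) \<Rightarrow> real^'d \<Rightarrow> real^'d^'d" where
  "strain v x = (1/2) *\<^sub>R (vgrad v x + transpose (vgrad v x))"

primrec C_k :: "nat \<Rightarrow> (real^'d::finite \<Rightarrow> real) \<Rightarrow> bool" where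
  "C_k 0 \<phi> \<longleftrightarrow> continuous_on UNIV \<phi>"
| "C_k (Suc m) \<phi> \<longleftrightarrow>
     \<phi> differentiable_on UNIV \<and> (\<forall>i. C_k m (\<lambda>x. frechet_derivative \<phi> (at x) (axis i 1)))"

definition test_functions :: "(real^'d::finite) set \<Rightarrow> (real^'d \<Rightarrow> real) set" where
  "test_functions \<Omega> =
     {\<phi>. (\<forall>m. C_k m \<phi>) \<and> (\<exists>S. compact S \<and> S \<subseteq> \<Omega> \<and> (\<forall>x. x \<notin> S \<longrightarrow> \<phi> x = 0))}"

definition has_weak_divergence ::
  "(real^'d::finite) set \<Rightarrow> (real^'d \<Rightarrow> real^'d) \<Rightarrow> (real^'d \<Rightarrow> real) \<Rightarrow> bool" where
  "has_weak_divergence \<Omega> v g \<longleftrightarrow>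
     (\<forall>\<phi>\<in>test_functions \<Omega>. L2_inner \<Omega> v (grad \<phi>) = - L2_inner \<Omega> g \<phi>)"

definition Hdiv :: "(real^'d::finite) set \<Rightarrow> (real^'d \<Rightarrow> real^'d) set" where
  "Hdiv \<Omega> = {v \<in> L2 \<Omega>. \<exists>g\<in>L2 \<Omega>. has_weak_divergence \<Omega> v g}"

definition Hdiv_norm :: "(real^'d::finite) set \<Rightarrow> (real^'d \<Rightarrow> real^'d) \<Rightarrow> real" where
  "Hdiv_norm \<Omega> v = sqrt ((L2_norm \<Omega> v)\<^sup>2 + (L2_norm \<Omega> (divergence v))\<^sup>2)"

definition H1_norm :: "(real^'d::finite) set \<Rightarrow> (real^'d \<Rightarrow> real^'d) \<Rightarrow> real" where
  "H1_norm \<Omega> z = sqrt ((L2_norm \<Omega> z)\<^sup>2 + (L2_norm \<Omega> (vgrad z))\<^sup>2)"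

definition permeability :: "(real^'d::finite) set \<Rightarrow> (real^'d \<Rightarrow> real^'d^'d) \<Rightarrow> bool" where
  "permeability \<Omega> K \<longleftrightarrow>
     K \<in> borel_measurable (lebesgue_on \<Omega>) \<and>
     (\<exists>C. AE x in lebesgue_on \<Omega>. norm (K x) \<le> C) \<and>
     (AE x in lebesgue_on \<Omega>. transpose (K x) = K x) \<and>
     (\<exists>\<kappa>>0. AE x in lebesgue_on \<Omega>. \<forall>\<xi>. \<kappa> * (\<xi> \<bullet> \<xi>) \<le> \<xi> \<bullet> (K x *v \<xi>))"


section \<open>Finite element spaces\<close>

text \<open>Polynomials whose degree in the \<open>i\<close>-th variable is at most \<open>m i\<close>; constant \<open>m\<close> gives the usual
  \<open>Q\<^sub>m\<close>.\<close>

definition tensor_poly :: "('d::finite \<Rightarrow> nat) \<Rightarrow> (real^'d \<Rightarrow> real) set" where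
  "tensor_poly m =
     {g. \<exists>c. \<forall>x. g x = (\<Sum>\<alpha> | \<forall>i. \<alpha> i \<le> m i. c \<alpha> * (\<Prod>i\<in>UNIV. vec_nth x i ^ \<alpha> i))}"

abbreviation Q_poly :: "nat \<Rightarrow> (real^'d::finite \<Rightarrow> real) set" where
  "Q_poly m \<equiv> tensor_poly (\<lambda>_. m)"

text \<open>\<open>RT\<^sub>s\<close> on the reference cube: the \<open>i\<close>-th component has degree \<open>s + 1\<close> in the \<open>i\<close>-th variable and
  degree \<open>s\<close> in the others.\<close>

definition RT_ref :: "nat \<Rightarrow> (real^'d::finite \<Rightarrow> real^'d) set" where
  "RT_ref s = {v. \<forall>i. (\<lambda>x. vec_nth (v x) i) \<in> tensor_poly ((\<lambda>_. s)(i := s + 1))}"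

text \<open>\<open>Th\<close> is the set of (closed) cells and \<open>TK E\<close> the multilinear reference map of the cell \<open>E\<close>; the
  reference cell is the closed unit cube \<open>cbox 0 1\<close>.\<close>

definition mesh ::
  "(real^'d::finite) set \<Rightarrow> (real^'d) set set \<Rightarrow> ((real^'d) set \<Rightarrow> real^'d \<Rightarrow> real^'d) \<Rightarrow> bool" where
  "mesh \<Omega> Th TK \<longleftrightarrow>
     finite Th \<and> \<Union>Th = closure \<Omega> \<and>
     (\<forall>E\<in>Th. \<forall>E'\<in>Th. E \<noteq> E' \<longrightarrow> interior E \<inter> interior E' = {}) \<and>
     (\<forall>E\<in>Th. (\<forall>i. (\<lambda>x. vec_nth (TK E x) i) \<in> Q_poly 1) \<and>
             TK E ` cbox 0 1 = E \<and> inj_on (TK E) (cbox 0 1) \<and>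
             (\<forall>x\<in>cbox 0 1. det (jacobian (TK E) (at x)) \<noteq> 0))"

text \<open>Discontinuous functions are prescribed on the open cells only; their values on the cell
  boundaries, a null set, are irrelevant.\<close>

definition W_space ::
  "(real^'d::finite) set \<Rightarrow> (real^'d) set set \<Rightarrow> ((real^'d) set \<Rightarrow> real^'d \<Rightarrow> real^'d) \<Rightarrow> nat
    \<Rightarrow> (real^'d \<Rightarrow> real) set" where
  "W_space \<Omega> Th TK s =
     {w \<in> L2 \<Omega>. \<forall>E\<in>Th. \<exists>g\<in>Q_poly s. \<forall>x\<in>box 0 1. w (TK E x) = g x}"

text \<open>Raviart-Thomas functions are transported to the cells by the Piola transform.\<close>

definition V_space ::
  "(real^'d::finite) set \<Rightarrow> (real^'d) set set \<Rightarrow> ((real^'d) set \<Rightarrow> real^'d \<Rightarrow> real^'d) \<Rightarrow> nat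
    \<Rightarrow> (real^'d \<Rightarrow> real^'d) set" where
  "V_space \<Omega> Th TK s =
     {v \<in> Hdiv \<Omega>. \<forall>E\<in>Th. \<exists>g\<in>RT_ref s. \<forall>x\<in>box 0 1.
        v (TK E x) = inverse (det (jacobian (TK E) (at x))) *\<^sub>R (jacobian (TK E) (at x) *v g x)}"

definition H_space ::
  "(real^'d::finite) set \<Rightarrow> (real^'d) set set \<Rightarrow> ((real^'d) set \<Rightarrow> real^'d \<Rightarrow> real^'d) \<Rightarrow> nat
    \<Rightarrow> (real^'d \<Rightarrow> real^'d) set" where
  "H_space \<Omega> Th TK m =
     {z. continuous_on (closure \<Omega>) z \<and> (\<forall>x\<in>frontier \<Omega>. z x = 0) \<and>
         (\<forall>E\<in>Th. \<exists>g. (\<forall>i. (\<lambda>x. vec_nth (g x) i) \<in> Q_poly m) \<and>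
                      (\<forall>x\<in>cbox 0 1. z (TK E x) = g x))}"

definition inf_sup_stable ::
  "(real^'d::finite) set \<Rightarrow> (real^'d \<Rightarrow> real) set \<Rightarrow> (real^'d \<Rightarrow> real^'d) set \<Rightarrow> bool" where
  "inf_sup_stable \<Omega> W V \<longleftrightarrow>
     (\<exists>\<beta>>0. \<forall>w\<in>W. \<exists>v\<in>V. Hdiv_norm \<Omega> v \<le> 1 \<and> \<beta> * L2_norm \<Omega> w \<le> L2_inner \<Omega> (divergence v) w)"


section \<open>Time discretization\<close>

definition time_grid :: "nat \<Rightarrow> real \<Rightarrow> (nat \<Rightarrow> real) \<Rightarrow> bool" where
  "time_grid N T t \<longleftrightarrow> t 0 = 0 \<and> t N = T \<and> (\<forall>n<N. t n < t (Suc n))"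

abbreviation time_interval :: "(nat \<Rightarrow> real) \<Rightarrow> nat \<Rightarrow> real set" where
  "time_interval t n \<equiv> {t (n - 1)<..t n}"

text \<open>The Gauss points are characterized by exactness of degree \<open>2 r + 1\<close>.\<close>

definition gauss_points :: "nat \<Rightarrow> real \<Rightarrow> real \<Rightarrow> (nat \<Rightarrow> real) \<Rightarrow> bool" where
  "gauss_points r a c x \<longleftrightarrow>
     inj_on x {..r} \<and> x ` {..r} \<subseteq> {a<..c} \<and>
     (\<exists>\<omega>. \<forall>g::real poly. degree g \<le> 2 * r + 1 \<longrightarrow>
            integral {a..c} (poly g) = (\<Sum>j\<le>r. \<omega> j * poly g (x j)))"

definition lagrange :: "nat \<Rightarrow> (nat \<Rightarrow> real) \<Rightarrow> nat \<Rightarrow> real poly" where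
  "lagrange r x j = smult (inverse (\<Prod>k\<in>{..r} - {j}. x j - x k)) (\<Prod>k\<in>{..r} - {j}. [:- x k, 1:])"

text \<open>In the following, \<open>t\<close> is the time grid and \<open>tq n 0, \<dots>, tq n r\<close> are the points in the \<open>n\<close>-th
  interval, \<open>1 \<le> n\<close>.\<close>

definition basis_fun :: "nat \<Rightarrow> (nat \<Rightarrow> nat \<Rightarrow> real) \<Rightarrow> nat \<Rightarrow> nat \<Rightarrow> real poly" where
  "basis_fun r tq n j = lagrange r (tq n) j"

definition gam :: "nat \<Rightarrow> (nat \<Rightarrow> real) \<Rightarrow> (nat \<Rightarrow> nat \<Rightarrow> real) \<Rightarrow> nat \<Rightarrow> nat \<Rightarrow> real" where
  "gam r t tq n i = poly (basis_fun r tq n i) (t (n - 1))"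

definition alpha :: "nat \<Rightarrow> (nat \<Rightarrow> real) \<Rightarrow> (nat \<Rightarrow> nat \<Rightarrow> real) \<Rightarrow> nat \<Rightarrow> nat \<Rightarrow> nat \<Rightarrow> real" where
  "alpha r t tq n i j =
     integral {t (n - 1)..t n}
       (\<lambda>\<sigma>. poly (pderiv (basis_fun r tq n j)) \<sigma> * poly (basis_fun r tq n i) \<sigma>)"

definition alpha' :: "nat \<Rightarrow> (nat \<Rightarrow> real) \<Rightarrow> (nat \<Rightarrow> nat \<Rightarrow> real) \<Rightarrow> nat \<Rightarrow> nat \<Rightarrow> nat \<Rightarrow> real" where
  "alpha' r t tq n i j = alpha r t tq n i j + gam r t tq n i * gam r t tq n j"

definition tau :: "(nat \<Rightarrow> real) \<Rightarrow> nat \<Rightarrow> real" where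
  "tau t n = t n - t (n - 1)"

definition beta :: "nat \<Rightarrow> (nat \<Rightarrow> real) \<Rightarrow> (nat \<Rightarrow> nat \<Rightarrow> real) \<Rightarrow> nat \<Rightarrow> nat \<Rightarrow> real" where
  "beta r t tq n i =
     (1 / tau t n) *
     integral {t (n - 1)..t n} (\<lambda>\<sigma>. poly (basis_fun r tq n i) \<sigma> * poly (basis_fun r tq n i) \<sigma>)"

text \<open>Functions of time on \<open>[0,T]\<close>, piecewise polynomial of degree at most \<open>r\<close> with values in \<open>X\<close>.\<close>

definition dG_space ::
  "nat \<Rightarrow> nat \<Rightarrow> (nat \<Rightarrow> real) \<Rightarrow> ('a \<Rightarrow> 'b::real_vector) set \<Rightarrow> (real \<Rightarrow> 'a \<Rightarrow> 'b) set" where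
  "dG_space r N t X =
     {v. v 0 \<in> X \<and> (\<forall>n\<in>{1..N}. \<exists>c. (\<forall>j\<le>r. c j \<in> X) \<and>
           (\<forall>\<sigma>\<in>time_interval t n. v \<sigma> = (\<lambda>x. \<Sum>j\<le>r. \<sigma> ^ j *\<^sub>R c j x)))}"

definition represented_by ::
  "nat \<Rightarrow> nat \<Rightarrow> (nat \<Rightarrow> real) \<Rightarrow> (nat \<Rightarrow> nat \<Rightarrow> real) \<Rightarrow> (real \<Rightarrow> 'a \<Rightarrow> 'b::real_vector)
    \<Rightarrow> (nat \<Rightarrow> nat \<Rightarrow> 'a \<Rightarrow> 'b) \<Rightarrow> bool" where
  "represented_by r N t tq v V \<longleftrightarrow>
     (\<forall>n\<in>{1..N}. \<forall>\<sigma>\<in>time_interval t n.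
        v \<sigma> = (\<lambda>x. \<Sum>j\<le>r. poly (basis_fun r tq n j) \<sigma> *\<^sub>R V n j x))"

text \<open>The one-sided limits in time are taken pointwise in space. For functions that are piecewise
  polynomial in time these are the limits in the (finite-dimensional) value space.\<close>

definition left_trace ::
  "(real \<Rightarrow> 'a \<Rightarrow> 'b::t2_space) \<Rightarrow> real \<Rightarrow> 'a \<Rightarrow> 'b" where
  "left_trace v \<sigma> = (\<lambda>x. Lim (at_left \<sigma>) (\<lambda>\<theta>. v \<theta> x))"

definition right_trace ::
  "(real \<Rightarrow> 'a \<Rightarrow> 'b::t2_space) \<Rightarrow> real \<Rightarrow> 'a \<Rightarrow> 'b" where
  "right_trace v \<sigma> = (\<lambda>x. Lim (at_right \<sigma>) (\<lambda>\<theta>. v \<theta> x))"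

definition converges_in ::
  "('a \<Rightarrow> 'b::real_vector) set \<Rightarrow> (('a \<Rightarrow> 'b) \<Rightarrow> real) \<Rightarrow> (nat \<Rightarrow> 'a \<Rightarrow> 'b) \<Rightarrow> ('a \<Rightarrow> 'b) \<Rightarrow> bool" where
  "converges_in X nrm v w \<longleftrightarrow>
     (\<forall>k. v k \<in> X) \<and> w \<in> X \<and> (\<lambda>k. nrm (\<lambda>x. v k x - w x)) \<longlonglongrightarrow> 0"

definition converges_geometrically_in ::
  "('a \<Rightarrow> 'b::real_vector) set \<Rightarrow> (('a \<Rightarrow> 'b) \<Rightarrow> real) \<Rightarrow> (nat \<Rightarrow> 'a \<Rightarrow> 'b) \<Rightarrow> ('a \<Rightarrow> 'b) \<Rightarrow> bool" where
  "converges_geometrically_in X nrm v w \<longleftrightarrow>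
     (\<forall>k. v k \<in> X) \<and> w \<in> X \<and>
     (\<exists>C\<ge>0. \<exists>\<theta>. 0 < \<theta> \<and> \<theta> < 1 \<and> (\<forall>k. nrm (\<lambda>x. v k x - w x) \<le> C * \<theta> ^ k))"

text \<open>Like \<^const>\<open>lim\<close>, this is meaningful only if the limit exists. The limit is unique up to null sets.\<close>

definition lim_in ::
  "('a \<Rightarrow> 'b::real_vector) set \<Rightarrow> (('a \<Rightarrow> 'b) \<Rightarrow> real) \<Rightarrow> (nat \<Rightarrow> 'a \<Rightarrow> 'b) \<Rightarrow> 'a \<Rightarrow> 'b" where
  "lim_in X nrm v = (SOME w. converges_in X nrm v w)"


section \<open>Coupled discrete system and fixed-stress iteration\<close>

definition darcy_eq ::
  "(real^'d::finite) set \<Rightarrow> (real^'d \<Rightarrow> real^'d) set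
    \<Rightarrow> (real^'d \<Rightarrow> real^'d^'d) \<Rightarrow> (real^'d \<Rightarrow> real) \<Rightarrow> (real^'d \<Rightarrow> real^'d) \<Rightarrow> bool" where
  "darcy_eq \<Omega> V K P Q \<longleftrightarrow>
     (\<forall>v\<in>V. L2_inner \<Omega> (\<lambda>x. matrix_inv (K x) *v Q x) v - L2_inner \<Omega> P (divergence v) = 0)"

definition mechanics_eq ::
  "(real^'d::finite) set \<Rightarrow> (real^'d \<Rightarrow> real^'d) set \<Rightarrow> real \<Rightarrow> real \<Rightarrow> real
    \<Rightarrow> (real^'d \<Rightarrow> real) \<Rightarrow> (real^'d \<Rightarrow> real^'d) \<Rightarrow> bool" where
  "mechanics_eq \<Omega> H b mu lam P U \<longleftrightarrow>
     (\<forall>z\<in>H. 2 * mu * L2_inner \<Omega> (strain U) (strain z)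
             + lam * L2_inner \<Omega> (divergence U) (divergence z)
             - b * L2_inner \<Omega> P (divergence z) = 0)"

definition coupled_solution where
  "coupled_solution \<Omega> (W :: (real^'d::finite \<Rightarrow> real) set) V H M b mu lam K
       (f :: real \<Rightarrow> real^'d \<Rightarrow> real) r N t tq p q u P Q U \<longleftrightarrow>
     p \<in> dG_space r N t W \<and> q \<in> dG_space r N t V \<and> u \<in> dG_space r N t H \<and>
     represented_by r N t tq p P \<and> represented_by r N t tq q Q \<and> represented_by r N t tq u U \<and>
     (\<forall>n\<in>{1..N}. \<forall>i\<le>r. P n i \<in> W \<and> Q n i \<in> V \<and> U n i \<in> H) \<and>
     (\<forall>n\<in>{1..N}. \<forall>i\<le>r.
        (let p_prev = (if n = 1 then (\<lambda>_. 0) else left_trace p (t (n - 1)));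
             u_prev = (if n = 1 then (\<lambda>_. 0) else left_trace u (t (n - 1)))
         in (\<forall>w\<in>W.
              (1 / M) * (\<Sum>j\<le>r. alpha' r t tq n i j * L2_inner \<Omega> (P n j) w)
              + tau t n * beta r t tq n i * L2_inner \<Omega> (divergence (Q n i)) w
              = tau t n * beta r t tq n i * L2_inner \<Omega> (f (tq n i)) w
                - b * (\<Sum>j\<le>r. alpha' r t tq n i j * L2_inner \<Omega> (divergence (U n j)) w)
                + gam r t tq n i * (1 / M) * L2_inner \<Omega> p_prev w
                + gam r t tq n i * L2_inner \<Omega> (\<lambda>x. b * divergence u_prev x) w)) \<and>
        darcy_eq \<Omega> V K (P n i) (Q n i) \<and>
        mechanics_eq \<Omega> H b mu lam (P n i) (U n i))"

text \<open>The first argument of the iterates is the iteration index; the iterates with index \<open>0\<close> are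
  arbitrary elements of the discrete spaces. The values carried over from the previous interval are
  the limits of the iterates there, whose existence is not assumed.\<close>

definition fixed_stress_iterates where
  "fixed_stress_iterates \<Omega> (W :: (real^'d::finite \<Rightarrow> real) set) V H M b mu lam K
       (f :: real \<Rightarrow> real^'d \<Rightarrow> real) r N t tq L pk qk uk Pk Qk Uk \<longleftrightarrow>
     (\<forall>k. represented_by r N t tq (pk k) (Pk k) \<and> represented_by r N t tq (qk k) (Qk k) \<and>
          represented_by r N t tq (uk k) (Uk k)) \<and>
     (\<forall>k. \<forall>n\<in>{1..N}. \<forall>i\<le>r. Pk k n i \<in> W \<and> Qk k n i \<in> V \<and> Uk k n i \<in> H) \<and>
     (\<forall>n\<in>{1..N}. \<forall>k. \<forall>i\<le>r.
        (let p_prev = (if n = 1 then (\<lambda>_. 0)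
                       else lim_in W (L2_norm \<Omega>) (\<lambda>l. left_trace (pk l) (t (n - 1))));
             u_prev = (if n = 1 then (\<lambda>_. 0)
                       else lim_in H (H1_norm \<Omega>) (\<lambda>l. left_trace (uk l) (t (n - 1))))
         in (\<forall>w\<in>W.
              (1 / M) * (\<Sum>j\<le>r. alpha' r t tq n i j * L2_inner \<Omega> (Pk (Suc k) n j) w)
              + L * (\<Sum>j\<le>r. alpha' r t tq n i j * L2_inner \<Omega> (\<lambda>x. Pk (Suc k) n j x - Pk k n j x) w)
              + tau t n * beta r t tq n i * L2_inner \<Omega> (divergence (Qk (Suc k) n i)) w
              = tau t n * beta r t tq n i * L2_inner \<Omega> (f (tq n i)) w
                - b * (\<Sum>j\<le>r. alpha' r t tq n i j * L2_inner \<Omega> (divergence (Uk k n j)) w)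
                + gam r t tq n i * (1 / M) * L2_inner \<Omega> p_prev w
                + gam r t tq n i * L2_inner \<Omega> (\<lambda>x. b * divergence u_prev x) w)) \<and>
        darcy_eq \<Omega> V K (Pk (Suc k) n i) (Qk (Suc k) n i) \<and>
        mechanics_eq \<Omega> H b mu lam (Pk (Suc k) n i) (Uk (Suc k) n i))"

end

theory Submission
  imports Defs
begin

text \<open>The errors satisfy the homogeneous scheme. Test the flow equation for the combination
  \<open>S\<^sub>p\<^sup>i\<close> with \<open>S\<^sub>p\<^sup>i\<close> itself, divide by \<open>\<tau> \<beta>\<^sub>i\<^sub>i\<close> and sum over \<open>i\<close>: by Darcy's law the flux contributes
  \<open>\<Sum>\<^sub>i\<^sub>j \<alpha>'\<^sub>i\<^sub>j \<langle>K\<inverse> q\<^sub>j, q\<^sub>i\<rangle>\<close>, which is nonnegative because the symmetric part of \<open>\<alpha>'\<close> is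
  \<open>(\<phi>\<^sub>i \<phi>\<^sub>j)(t\<^sub>n)/2 + (\<phi>\<^sub>i \<phi>\<^sub>j)(t\<^sub>n\<^sub>-\<^sub>1)/2\<close>. The elastic energy \<open>a(U, U)\<close> of the displacement caused by a
  pressure \<open>Z\<close> is at most \<open>b\<^sup>2/\<lambda> \<cdot> \<bar>Z\<bar>\<^sup>2 \<le> 2 L \<bar>Z\<bar>\<^sup>2\<close>, so by polarization the right-hand side
  \<open>L \<langle>Y, X\<rangle> - a(U\<^sub>Y, U\<^sub>X)\<close> is at most \<open>L/2 (\<bar>X\<bar>\<^sup>2 + \<bar>Y\<bar>\<^sup>2)\<close>. Hence the weighted sum of the
  \<open>\<bar>S\<^sub>p\<^sup>i\<bar>\<^sup>2\<close> contracts with the factor \<open>(L/2) / (1/M + L/2)\<close>.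

  The matrix \<open>\<alpha>'\<close> is invertible, so the pressure errors tend to 0. Fluxes and displacements follow by
  coercivity and finite dimension: an inverse estimate bounds the divergence of the flux, and the
  \<open>H\<^sup>1\<close> norm is bounded by the strain, since a finite element displacement with \<open>\<partial>\<^sub>i z\<^sub>i = 0\<close> for all \<open>i\<close>
  and zero boundary values vanishes. The latter follows from Sard's lemma for the map that replaces the
  \<open>i\<close>-th coordinate by \<open>z\<^sub>i\<close>, and replaces Korn's inequality. Induction over the time intervals transfers
  the limits.\<close>

section \<open>Positive semidefinite forms on function spaces\<close>

text \<open>The threshold for \<open>L\<close> is what makes the coupling no larger than the
  stabilization: \<open>0 <= a(U,U) <= 2 L |Z|^2\<close> confines \<open>L |Z|^2 - a(U,U)\<close> to
  the interval from \<open>- L |Z|^2\<close> to \<open>L |Z|^2\<close>, and the strict gain is then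
  due to \<open>1/M\<close>. The combinations of pressures are tested, not the pressures themselves,
  because time derivative and stabilization see the nodal pressures only through the rows of the
  time matrix. The contraction sets in at the first computed iterate, since iterate 0 is arbitrary
  and need not satisfy Darcy's law or the mechanics equation. Functions are not identified modulo
  null sets. Hence all forms are only semidefinite, differential operators are linear only almost
  everywhere, and limits are determined only up to functions of norm zero; what passes from one
  interval to the next is an equality of functionals. The mesh is fixed, so constants may depend on
  it, and an estimate between two norms becomes a comparison of their kernels.\<close>

locale psd_form =
  fixes X :: "('a \<Rightarrow> 'b::real_vector) set" and B :: "('a \<Rightarrow> 'b) \<Rightarrow> ('a \<Rightarrow> 'b) \<Rightarrow> real"
  assumes zero_mem: "(\<lambda>_. 0) \<in> X"
    and lin_mem: "f \<in> X \<Longrightarrow> g \<in> X \<Longrightarrow> (\<lambda>x. f x + c *\<^sub>R g x) \<in> X"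
    and sym: "f \<in> X \<Longrightarrow> g \<in> X \<Longrightarrow> B f g = B g f"
    and lin: "f \<in> X \<Longrightarrow> g \<in> X \<Longrightarrow> h \<in> X \<Longrightarrow> B (\<lambda>x. f x + c *\<^sub>R g x) h = B f h + c * B g h"
    and nonneg: "f \<in> X \<Longrightarrow> 0 \<le> B f f"
begin

lemma zero_left: "h \<in> X \<Longrightarrow> B (\<lambda>_. 0) h = 0"
  using lin[of "\<lambda>_. 0" "\<lambda>_. 0" h 1] zero_mem by simp

lemma scale_mem: "f \<in> X \<Longrightarrow> (\<lambda>x. c *\<^sub>R f x) \<in> X"
  using lin_mem[of "\<lambda>_. 0" f c] zero_mem by simp

lemma diff_mem: "f \<in> X \<Longrightarrow> g \<in> X \<Longrightarrow> (\<lambda>x. f x - g x) \<in> X"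
  using lin_mem[of f g "-1"] by simp

lemma add_mem: "f \<in> X \<Longrightarrow> g \<in> X \<Longrightarrow> (\<lambda>x. f x + g x) \<in> X"
  using lin_mem[of f g "1"] by simp

lemma sum_mem:
  assumes "finite I" "\<And>i. i \<in> I \<Longrightarrow> f i \<in> X"
  shows "(\<lambda>x. \<Sum>i\<in>I. c i *\<^sub>R f i x) \<in> X"
  using assms
proof (induction I rule: finite_induct)
  case (insert i I)
  have "(\<lambda>x. (\<Sum>i\<in>I. c i *\<^sub>R f i x) + c i *\<^sub>R f i x) \<in> X"
    by (rule lin_mem) (use insert in auto)
  then show ?case using insert by (simp add: add.commute)
qed (simp add: zero_mem)

lemma scale_left: "f \<in> X \<Longrightarrow> h \<in> X \<Longrightarrow> B (\<lambda>x. c *\<^sub>R f x) h = c * B f h"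
  using lin[of "\<lambda>_. 0" f h c] zero_mem zero_left by simp

lemma add_left: "f \<in> X \<Longrightarrow> g \<in> X \<Longrightarrow> h \<in> X \<Longrightarrow> B (\<lambda>x. f x + g x) h = B f h + B g h"
  using lin[of f g h 1] by simp

lemma diff_left: "f \<in> X \<Longrightarrow> g \<in> X \<Longrightarrow> h \<in> X \<Longrightarrow> B (\<lambda>x. f x - g x) h = B f h - B g h"
  using lin[of f g h "-1"] by simp

lemma sum_left:
  assumes "finite I" "\<And>i. i \<in> I \<Longrightarrow> f i \<in> X" "h \<in> X"
  shows "B (\<lambda>x. \<Sum>i\<in>I. c i *\<^sub>R f i x) h = (\<Sum>i\<in>I. c i * B (f i) h)"
  using assms
proof (induction I rule: finite_induct)
  case (insert i I)
  have "B (\<lambda>x. (\<Sum>i\<in>I. c i *\<^sub>R f i x) + c i *\<^sub>R f i x) h = (\<Sum>i\<in>I. c i * B (f i) h) + c i * B (f i) h"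
    using insert by (subst lin) (auto simp: sum_mem)
  then show ?case using insert by (simp add: add.commute)
qed (simp add: zero_left)

lemma diff_right: "f \<in> X \<Longrightarrow> g \<in> X \<Longrightarrow> h \<in> X \<Longrightarrow> B h (\<lambda>x. f x - g x) = B h f - B h g"
  using diff_left[of f g h] sym[of h f] sym[of h g] sym[OF _ diff_mem, of h f g] by simp

lemma add_right: "f \<in> X \<Longrightarrow> g \<in> X \<Longrightarrow> h \<in> X \<Longrightarrow> B h (\<lambda>x. f x + g x) = B h f + B h g"
  using add_left[of f g h] sym[of h f] sym[of h g] sym[OF _ add_mem, of h f g] by simp

lemma scale_right: "f \<in> X \<Longrightarrow> h \<in> X \<Longrightarrow> B h (\<lambda>x. c *\<^sub>R f x) = c * B h f"
  using scale_left[of f h c] sym[of h f] sym[OF _ scale_mem, of h f c] by simp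

lemma sum_right:
  assumes "finite I" "\<And>i. i \<in> I \<Longrightarrow> f i \<in> X" "h \<in> X"
  shows "B h (\<lambda>x. \<Sum>i\<in>I. c i *\<^sub>R f i x) = (\<Sum>i\<in>I. c i * B h (f i))"
proof -
  have "B h (\<lambda>x. \<Sum>i\<in>I. c i *\<^sub>R f i x) = B (\<lambda>x. \<Sum>i\<in>I. c i *\<^sub>R f i x) h"
    by (rule sym[OF assms(3) sum_mem[OF assms(1,2)]])
  also have "\<dots> = (\<Sum>i\<in>I. c i * B (f i) h)"
    by (rule sum_left[OF assms])
  also have "\<dots> = (\<Sum>i\<in>I. c i * B h (f i))"
    by (rule sum.cong) (simp_all only: sym[OF assms(2,3)])
  finally show ?thesis .
qed

lemma cauchy_schwarz:
  assumes "f \<in> X" "g \<in> X"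
  shows "(B f g)\<^sup>2 \<le> B f f * B g g"
proof -
  have q: "0 \<le> B f f - 2 * s * B f g + s\<^sup>2 * B g g" for s
  proof -
    have "0 \<le> B (\<lambda>x. f x - s *\<^sub>R g x) (\<lambda>x. f x - s *\<^sub>R g x)"
      by (rule nonneg, rule diff_mem, rule assms, rule scale_mem, rule assms)
    also have "\<dots> = B f f - 2 * s * B f g + s\<^sup>2 * B g g"
      using assms by (simp add: diff_left diff_right scale_left scale_right diff_mem scale_mem
          sym[of g f] power2_eq_square algebra_simps)
    finally show ?thesis .
  qed
  show ?thesis
  proof (cases "B g g = 0")
    case True
    have "B f g = 0"
    proof (rule ccontr)
      assume "B f g \<noteq> 0"
      \<comment> \<open>With \<open>B g g = 0\<close> the expression in \<open>q\<close> is affine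
        in \<open>s\<close>; this \<open>s\<close> gives it the value -1.\<close>
      then show False using q[of "(B f f + 1) / (2 * B f g)"] True by simp
    qed
    then show ?thesis using True by simp
  next
    case False
    then have "0 < B g g" using nonneg[OF assms(2)] by simp
    then show ?thesis using q[of "B f g / B g g"]
      by (simp add: field_simps power2_eq_square)
  qed
qed

lemma abs_le: "f \<in> X \<Longrightarrow> g \<in> X \<Longrightarrow> \<bar>B f g\<bar> \<le> sqrt (B f f) * sqrt (B g g)"
  using real_sqrt_le_mono[OF cauchy_schwarz, of f g] by (simp add: real_sqrt_mult)

lemma null_left: "f \<in> X \<Longrightarrow> g \<in> X \<Longrightarrow> B f f = 0 \<Longrightarrow> B f g = 0"
  using abs_le[of f g] by simp

lemma norm_triangle:
  assumes "f \<in> X" "g \<in> X"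
  shows "sqrt (B (\<lambda>x. f x + g x) (\<lambda>x. f x + g x)) \<le> sqrt (B f f) + sqrt (B g g)"
proof (rule real_le_lsqrt)
  have "B (\<lambda>x. f x + g x) (\<lambda>x. f x + g x) = B f f + 2 * B f g + B g g"
    using assms by (simp add: add_left add_right add_mem sym[of g f])
  also have "\<dots> \<le> (sqrt (B f f) + sqrt (B g g))\<^sup>2"
    using abs_le[OF assms] nonneg[OF assms(1)] nonneg[OF assms(2)] by (simp add: power2_sum)
  finally show "B (\<lambda>x. f x + g x) (\<lambda>x. f x + g x) \<le> (sqrt (B f f) + sqrt (B g g))\<^sup>2" .
qed (use assms nonneg in auto)

lemma norm_scale: "f \<in> X \<Longrightarrow> sqrt (B (\<lambda>x. c *\<^sub>R f x) (\<lambda>x. c *\<^sub>R f x)) = \<bar>c\<bar> * sqrt (B f f)"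
  by (simp add: scale_left scale_right scale_mem real_sqrt_mult)

lemma norm_sum:
  assumes "finite I" "\<And>i. i \<in> I \<Longrightarrow> f i \<in> X"
  shows "sqrt (B (\<lambda>x. \<Sum>i\<in>I. c i *\<^sub>R f i x) (\<lambda>x. \<Sum>i\<in>I. c i *\<^sub>R f i x))
    \<le> (\<Sum>i\<in>I. \<bar>c i\<bar> * sqrt (B (f i) (f i)))"
  using assms
proof (induction I rule: finite_induct)
  case (insert i I)
  have "sqrt (B (\<lambda>x. c i *\<^sub>R f i x + (\<Sum>i\<in>I. c i *\<^sub>R f i x)) (\<lambda>x. c i *\<^sub>R f i x + (\<Sum>i\<in>I. c i *\<^sub>R f i x)))
    \<le> \<bar>c i\<bar> * sqrt (B (f i) (f i)) + (\<Sum>i\<in>I. \<bar>c i\<bar> * sqrt (B (f i) (f i)))"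
    using insert norm_triangle[of "\<lambda>x. c i *\<^sub>R f i x" "\<lambda>x. \<Sum>i\<in>I. c i *\<^sub>R f i x"]
      norm_scale[of "f i" "c i"]
    by (simp add: sum_mem scale_mem)
  then show ?case using insert by simp
qed (simp add: zero_left zero_mem)

lemma tendsto_sum_zero:
  assumes "finite I" "\<And>i k. i \<in> I \<Longrightarrow> f i k \<in> X"
    and "\<And>i. i \<in> I \<Longrightarrow> (\<lambda>k. sqrt (B (f i k) (f i k))) \<longlonglongrightarrow> 0"
  shows "(\<lambda>k. sqrt (B (\<lambda>x. \<Sum>i\<in>I. c i *\<^sub>R f i k x) (\<lambda>x. \<Sum>i\<in>I. c i *\<^sub>R f i k x))) \<longlonglongrightarrow> 0"
proof (rule tendsto_sandwich[OF _ _ tendsto_const])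
  show "(\<lambda>k. \<Sum>i\<in>I. \<bar>c i\<bar> * sqrt (B (f i k) (f i k))) \<longlonglongrightarrow> 0"
    using assms(3) by (auto intro!: tendsto_null_sum tendsto_mult_right_zero)
  show "\<forall>\<^sub>F k in sequentially. 0 \<le> sqrt (B (\<lambda>x. \<Sum>i\<in>I. c i *\<^sub>R f i k x) (\<lambda>x. \<Sum>i\<in>I. c i *\<^sub>R f i k x))"
    using assms by (intro always_eventually allI real_sqrt_ge_zero nonneg sum_mem) auto
  show "\<forall>\<^sub>F k in sequentially. sqrt (B (\<lambda>x. \<Sum>i\<in>I. c i *\<^sub>R f i k x) (\<lambda>x. \<Sum>i\<in>I. c i *\<^sub>R f i k x))
      \<le> (\<Sum>i\<in>I. \<bar>c i\<bar> * sqrt (B (f i k) (f i k)))"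
    using assms by (intro always_eventually allI norm_sum) auto
qed

definition orthonormal :: "nat \<Rightarrow> (nat \<Rightarrow> 'a \<Rightarrow> 'b) \<Rightarrow> bool" where
  "orthonormal n e \<longleftrightarrow> (\<forall>i<n. e i \<in> X) \<and> (\<forall>i<n. \<forall>j<n. B (e i) (e j) = (if i = j then 1 else 0))"

end

section \<open>Restricting, combining and comparing forms\<close>

lemma psd_form_subset:
  assumes "psd_form X B" "Y \<subseteq> X" "(\<lambda>_. 0) \<in> Y"
    "\<And>f g c. f \<in> Y \<Longrightarrow> g \<in> Y \<Longrightarrow> (\<lambda>x. f x + c *\<^sub>R g x) \<in> Y"
  shows "psd_form Y B"
proof -
  interpret psd_form X B by fact
  show ?thesis using assms by unfold_locales (auto simp: subset_iff intro: sym lin nonneg)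
qed

lemma psd_form_add:
  assumes "psd_form X B1" "psd_form X B2" "0 \<le> c1" "0 \<le> c2"
  shows "psd_form X (\<lambda>f g. c1 * B1 f g + c2 * B2 f g)"
proof -
  interpret B1: psd_form X B1 by fact
  interpret B2: psd_form X B2 by fact
  show ?thesis using assms(3,4)
  proof unfold_locales
    show "c1 * B1 f g + c2 * B2 f g = c1 * B1 g f + c2 * B2 g f" if "f \<in> X" "g \<in> X" for f g
      by (simp only: B1.sym[OF that] B2.sym[OF that])
  qed (simp_all add: B1.zero_mem B1.lin_mem B1.lin B2.lin B1.nonneg B2.nonneg algebra_simps)
qed

text \<open>Elimination, one equation per induction step: an unknown \<open>p\<close> with nonzero
  coefficient in equation \<open>j0\<close> is removed from the other equations, which leaves one
  equation and one unknown fewer.\<close>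

lemma homogeneous_system_nontrivial:
  fixes c :: "'i \<Rightarrow> 'j \<Rightarrow> real"
  assumes "finite J" "finite I" "card J < card I"
  shows "\<exists>a. (\<exists>i\<in>I. a i \<noteq> 0) \<and> (\<forall>j\<in>J. (\<Sum>i\<in>I. a i * c i j) = 0)"
  using assms
proof (induction J arbitrary: I c rule: finite_induct)
  case empty
  then have "I \<noteq> {}" by auto
  then show ?case by (intro exI[of _ "\<lambda>_. 1"]) auto
next
  case (insert j0 J)
  show ?case
  proof (cases "\<forall>i\<in>I. c i j0 = 0")
    case True
    have "card J < card I" using insert.prems insert.hyps by auto
    then obtain a where "\<exists>i\<in>I. a i \<noteq> 0" "\<forall>j\<in>J. (\<Sum>i\<in>I. a i * c i j) = 0"
      using insert.IH[of I c] insert.prems by blast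
    then show ?thesis using True by (intro exI[of _ a]) auto
  next
    case False
    then obtain p where p: "p \<in> I" "c p j0 \<noteq> 0" by auto
    have "card J < card (I - {p})" "finite (I - {p})"
      using insert.prems insert.hyps p by auto
    then obtain a where a: "\<exists>i\<in>I-{p}. a i \<noteq> 0"
      "\<forall>j\<in>J. (\<Sum>i\<in>I-{p}. a i * (c i j - c i j0 / c p j0 * c p j)) = 0"
      using insert.IH[of "I - {p}" "\<lambda>i j. c i j - c i j0 / c p j0 * c p j"]
      by blast
    define \<sigma> where "\<sigma> = (\<Sum>i\<in>I-{p}. a i * c i j0)"
    \<comment> \<open>Equation \<open>j0\<close> forces the value of the removed unknown.\<close>
    define a' where "a' = a(p := - \<sigma> / c p j0)"
    have s: "(\<Sum>i\<in>I. a' i * c i j) = (\<Sum>i\<in>I-{p}. a i * c i j) - \<sigma> / c p j0 * c p j" for j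
      using p insert.prems by (subst sum.remove[of I p]) (auto simp: a'_def intro!: sum.cong)
    have "(\<Sum>i\<in>I. a' i * c i j) = 0" if "j \<in> J" for j
    proof -
      have "0 = (\<Sum>i\<in>I-{p}. a i * c i j - a i * c i j0 * (c p j / c p j0))"
        using a(2) that by (simp add: algebra_simps)
      also have "\<dots> = (\<Sum>i\<in>I-{p}. a i * c i j) - \<sigma> * (c p j / c p j0)"
        by (simp add: sum_subtractf \<sigma>_def sum_distrib_right sum_divide_distrib)
      finally show ?thesis by (simp add: s)
    qed
    moreover have "(\<Sum>i\<in>I. a' i * c i j0) = 0"
      unfolding s using p by (simp add: \<sigma>_def)
    moreover have "\<exists>i\<in>I. a' i \<noteq> 0" using a(1) by (auto simp: a'_def)
    ultimately show ?thesis by (intro exI[of _ a']) auto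
  qed
qed

text \<open>Finite dimension of \<open>X\<close> is expressed through pullbacks \<open>f \<circ> \<pi>\<close>; the coefficients need not be unique.
  It bounds the size of \<open>B\<close>-orthonormal families, and by \<open>le\<close> a maximal one spans \<open>X\<close> up to
  functions on which \<open>M\<close> vanishes.\<close>

lemma psd_form_dominated:
  fixes X :: "('a \<Rightarrow> 'b::real_vector) set" and \<pi> :: "'y \<Rightarrow> 'a" and b :: "'j \<Rightarrow> 'y \<Rightarrow> 'b"
  assumes B: "psd_form X B" and M: "psd_form X M"
    and le: "\<And>f. f \<in> X \<Longrightarrow> B f f = 0 \<Longrightarrow> M f f = 0"
    and J: "finite J"
    and rep: "\<And>f. f \<in> X \<Longrightarrow> \<exists>c. \<forall>y\<in>Y. f (\<pi> y) = (\<Sum>j\<in>J. c j *\<^sub>R b j y)"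
    and null: "\<And>f. f \<in> X \<Longrightarrow> (\<And>y. y \<in> Y \<Longrightarrow> f (\<pi> y) = 0) \<Longrightarrow> B f f = 0"
  shows "\<exists>C\<ge>0. \<forall>f\<in>X. M f f \<le> C * B f f"
proof -
  interpret B: psd_form X B by fact
  interpret M: psd_form X M by fact
  \<comment> \<open>A longer orthonormal family has more members than there are coordinates, so some
    nontrivial combination has a vanishing pullback and hence \<open>B\<close>-norm zero, while
    orthonormality makes its squared norm the sum of the \<open>(a i)^2\<close>.\<close>
  have bound: "n \<le> card J" if e: "B.orthonormal n e" for n e
  proof (rule ccontr)
    assume "\<not> n \<le> card J"
    have eX: "e i \<in> X" if "i < n" for i using e that by (auto simp: B.orthonormal_def)
    then have "\<exists>c. \<forall>y\<in>Y. e i (\<pi> y) = (\<Sum>j\<in>J. c j *\<^sub>R b j y)" if "i < n" for i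
      using rep that by blast
    then obtain c where c: "\<And>i y. i < n \<Longrightarrow> y \<in> Y \<Longrightarrow> e i (\<pi> y) = (\<Sum>j\<in>J. c i j *\<^sub>R b j y)"
      by metis
    obtain a where a: "\<exists>i<n. a i \<noteq> 0" "\<And>j. j \<in> J \<Longrightarrow> (\<Sum>i<n. a i * c i j) = 0"
      using homogeneous_system_nontrivial[OF J, of "{..<n}" c] \<open>\<not> n \<le> card J\<close> by auto
    let ?f = "\<lambda>x. \<Sum>i<n. a i *\<^sub>R e i x"
    have fX: "?f \<in> X" using eX by (intro B.sum_mem) auto
    have "?f (\<pi> y) = 0" if "y \<in> Y" for y
    proof -
      have "?f (\<pi> y) = (\<Sum>i<n. \<Sum>j\<in>J. (a i * c i j) *\<^sub>R b j y)"
        using c that by (simp add: scaleR_sum_right)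
      also have "\<dots> = (\<Sum>j\<in>J. (\<Sum>i<n. a i * c i j) *\<^sub>R b j y)"
        by (subst sum.swap) (simp add: scaleR_sum_left)
      finally show ?thesis using a by simp
    qed
    then have "B ?f ?f = 0" using null fX by blast
    moreover have "B ?f ?f = (\<Sum>i<n. a i * B (e i) ?f)"
      using eX fX by (intro B.sum_left) auto
    moreover have "B (e i) ?f = a i" if "i < n" for i
    proof -
      have "B (e i) ?f = (\<Sum>j<n. a j * B (e i) (e j))"
        using eX that by (intro B.sum_right) auto
      also have "\<dots> = (\<Sum>j<n. if i = j then a j else 0)"
        using e that by (intro sum.cong) (auto simp: B.orthonormal_def)
      finally show ?thesis using that by simp
    qed
    ultimately have "(\<Sum>i<n. (a i)\<^sup>2) = 0" by (simp add: power2_eq_square)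
    then show False using a(1) by (auto simp: sum_nonneg_eq_0_iff)
  qed
  \<comment> \<open>The maximum exists: the empty family is orthonormal, and \<open>bound\<close>
    caps the length.\<close>
  define n where "n = (GREATEST n. \<exists>e. B.orthonormal n e)"
  have ex: "\<exists>n e. B.orthonormal n e" by (rule exI[of _ 0]) (auto simp: B.orthonormal_def)
  then have "\<exists>e. B.orthonormal n e" unfolding n_def
    by (rule GreatestI_ex_nat[where b = "card J"]) (use bound in auto)
  then obtain e where e: "B.orthonormal n e" by auto
  have max: "\<not> B.orthonormal (Suc n) e'" for e'
    using Greatest_le_nat[of "\<lambda>n. \<exists>e. B.orthonormal n e" "Suc n" "card J"] bound
    unfolding n_def by fastforce
  have eX: "e i \<in> X" if "i < n" for i using e that by (auto simp: B.orthonormal_def)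
  \<comment> \<open>The coefficients \<open>B f (e i)\<close> are at most
    \<open>sqrt (B f f)\<close> in absolute value, so \<open>C * sqrt (B f f)\<close> bounds the
    \<open>M\<close>-seminorm of the projection \<open>?g\<close> of \<open>f\<close>; the residual
    \<open>?h\<close> will contribute nothing.\<close>
  define C where "C = (\<Sum>i<n. sqrt (M (e i) (e i)))"
  have C0: "0 \<le> C" using eX M.nonneg by (auto simp: C_def intro!: sum_nonneg)
  have "M f f \<le> C\<^sup>2 * B f f" if f: "f \<in> X" for f
  proof -
    let ?g = "\<lambda>x. \<Sum>i<n. B f (e i) *\<^sub>R e i x"
    let ?h = "\<lambda>x. f x - ?g x"
    have g: "?g \<in> X" using eX by (intro B.sum_mem) auto
    have h: "?h \<in> X" using f g by (rule B.diff_mem)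
    have he: "B ?h (e i) = 0" if "i < n" for i
    proof -
      have "B ?g (e i) = (\<Sum>j<n. B f (e j) * B (e j) (e i))"
        using eX that by (intro B.sum_left) auto
      also have "\<dots> = (\<Sum>j<n. if j = i then B f (e j) else 0)"
        using e that by (intro sum.cong) (auto simp: B.orthonormal_def)
      finally show ?thesis using that f g eX by (simp add: B.diff_left)
    qed
    \<comment> \<open>Otherwise the normalized residual would extend the maximal family by one
      member.\<close>
    have "B ?h ?h = 0"
    proof (rule ccontr)
      assume "B ?h ?h \<noteq> 0"
      then have pos: "0 < B ?h ?h" using B.nonneg[OF h] by simp
      define u where "u = (\<lambda>x. (1 / sqrt (B ?h ?h)) *\<^sub>R ?h x)"
      have u: "u \<in> X" unfolding u_def using h by (rule B.scale_mem)
      have "B u u = 1 / sqrt (B ?h ?h) * (1 / sqrt (B ?h ?h) * B ?h ?h)"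
        unfolding u_def using h by (simp only: B.scale_left B.scale_right B.scale_mem)
      also have "\<dots> = 1" using pos by (simp add: field_simps)
      finally have uu: "B u u = 1" .
      have ue: "B u (e i) = 0" if "i < n" for i
        unfolding u_def using h eX[OF that] he[OF that] by (simp only: B.scale_left)
      have eu: "B (e i) u = 0" if "i < n" for i
        using ue[OF that] B.sym[OF eX[OF that] u] by simp
      have "B.orthonormal (Suc n) (e(n := u))"
        unfolding B.orthonormal_def
        using e uu ue eu u eX by (auto simp: B.orthonormal_def less_Suc_eq)
      then show False using max by blast
    qed
    then have Mh: "M ?h ?h = 0" using le h by blast
    have "sqrt (M f f) = sqrt (M (\<lambda>x. ?h x + ?g x) (\<lambda>x. ?h x + ?g x))" by simp
    also have "\<dots> \<le> sqrt (M ?h ?h) + sqrt (M ?g ?g)"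
      using h g by (rule M.norm_triangle)
    also have "\<dots> \<le> (\<Sum>i<n. \<bar>B f (e i)\<bar> * sqrt (M (e i) (e i)))"
      using Mh M.norm_sum[of "{..<n}" e "\<lambda>i. B f (e i)"] eX by simp
    also have "\<dots> \<le> (\<Sum>i<n. sqrt (B f f) * sqrt (M (e i) (e i)))"
    proof (intro sum_mono mult_right_mono)
      fix i assume "i \<in> {..<n}"
      then show "\<bar>B f (e i)\<bar> \<le> sqrt (B f f)"
        using B.abs_le[OF f eX, of i] e by (auto simp: B.orthonormal_def)
      show "0 \<le> sqrt (M (e i) (e i))" using M.nonneg eX \<open>i \<in> {..<n}\<close> by auto
    qed
    also have "\<dots> = C * sqrt (B f f)" by (simp add: C_def sum_distrib_left mult.commute)
    finally have "(sqrt (M f f))\<^sup>2 \<le> (C * sqrt (B f f))\<^sup>2"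
      using M.nonneg[OF f] by (intro power_mono) auto
    then show ?thesis using M.nonneg[OF f] B.nonneg[OF f] by (simp add: power_mult_distrib)
  qed
  then show ?thesis by (intro exI[of _ "C\<^sup>2"]) auto
qed

section \<open>The matrix of the time basis\<close>

lemma poly_lagrange:
  assumes "inj_on x {..r}" "i \<le> r" "j \<le> r"
  shows "poly (lagrange r x j) (x i) = (if i = j then 1 else 0)"
proof (cases "i = j")
  case True
  have "(\<Prod>k\<in>{..r} - {j}. x j - x k) \<noteq> 0"
    using assms by (auto simp: inj_on_def)
  then show ?thesis using True by (simp add: lagrange_def poly_prod)
next
  case False
  then have "(\<Prod>k\<in>{..r} - {j}. x i - x k) = 0" using assms by auto
  then show ?thesis using False by (simp add: lagrange_def poly_prod)
qed

lemma degree_lagrange: "degree (lagrange r x j) \<le> r" if "j \<le> r"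
proof -
  have "degree (lagrange r x j) \<le> degree (\<Prod>k\<in>{..r} - {j}. [:- x k, 1:])"
    unfolding lagrange_def by (rule degree_smult_le)
  also have "\<dots> \<le> (\<Sum>k\<in>{..r} - {j}. degree [:- x k, 1:])"
    using degree_prod_sum_le[of "{..r} - {j}" "\<lambda>k. [:- x k, 1:]"] by (simp add: o_def)
  also have "\<dots> = r" using that by simp
  finally show ?thesis .
qed

lemma lagrange_interpolation:
  assumes "inj_on x {..r}" "degree g \<le> r"
  shows "g = (\<Sum>j\<le>r. smult (poly g (x j)) (lagrange r x j))"
proof (rule poly_eqI_degree)
  show "poly g y = poly (\<Sum>j\<le>r. smult (poly g (x j)) (lagrange r x j)) y" if "y \<in> x ` {..r}" for y
  proof -
    obtain i where i: "y = x i" "i \<le> r" using \<open>y \<in> x ` {..r}\<close> by auto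
    have "(\<Sum>j\<le>r. poly g (x j) * poly (lagrange r x j) (x i)) = (\<Sum>j\<le>r. if j = i then poly g (x j) else 0)"
      using i by (intro sum.cong) (auto simp: poly_lagrange[OF assms(1)])
    then show ?thesis using i by (simp add: poly_sum)
  qed
  have c: "card (x ` {..r}) = Suc r" using assms(1) by (simp add: card_image)
  show "degree g < card (x ` {..r})" using assms(2) c by simp
  have "degree (\<Sum>j\<le>r. smult (poly g (x j)) (lagrange r x j)) \<le> r"
    by (intro degree_sum_le) (auto intro: order_trans[OF degree_smult_le] degree_lagrange)
  then show "degree (\<Sum>j\<le>r. smult (poly g (x j)) (lagrange r x j)) < card (x ` {..r})"
    using c by simp
qed

lemma poly_integrable_on: "(\<lambda>\<sigma>. poly g \<sigma> * poly h \<sigma>) integrable_on {a..c::real}"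
  by (intro integrable_continuous_real continuous_intros)

lemma integral_poly_square_pos:
  fixes g :: "real poly"
  assumes "a < c" "g \<noteq> 0"
  shows "0 < integral {a..c} (\<lambda>\<sigma>. poly g \<sigma> * poly g \<sigma>)"
proof -
  have cont: "continuous_on {a..c} (\<lambda>\<sigma>. poly g \<sigma> * poly g \<sigma>)" by (intro continuous_intros)
  have "integral {a..c} (\<lambda>\<sigma>. poly g \<sigma> * poly g \<sigma>) \<noteq> 0"
  proof
    assume "integral {a..c} (\<lambda>\<sigma>. poly g \<sigma> * poly g \<sigma>) = 0"
    then have "\<forall>\<sigma>\<in>{a..c}. poly g \<sigma> * poly g \<sigma> = 0"
      using integral_eq_0_iff[OF cont assms(1)] by simp
    then have "{a..c} \<subseteq> {\<sigma>. poly g \<sigma> = 0}" by auto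
    then have "finite {a..c}" using poly_roots_finite[OF assms(2)] finite_subset by blast
    then show False using assms(1) by (simp add: infinite_Icc)
  qed
  moreover have "0 \<le> integral {a..c} (\<lambda>\<sigma>. poly g \<sigma> * poly g \<sigma>)"
    by (intro integral_nonneg poly_integrable_on) auto
  ultimately show ?thesis by simp
qed

lemma integral_poly_by_parts:
  fixes g h :: "real poly"
  assumes "a \<le> c"
  shows "integral {a..c} (\<lambda>\<sigma>. poly (pderiv g) \<sigma> * poly h \<sigma>)
       + integral {a..c} (\<lambda>\<sigma>. poly (pderiv h) \<sigma> * poly g \<sigma>)
       = poly g c * poly h c - poly g a * poly h a"
proof -
  have "((\<lambda>\<sigma>. poly (pderiv g) \<sigma> * poly h \<sigma> + poly (pderiv h) \<sigma> * poly g \<sigma>) has_integral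
      poly g c * poly h c - poly g a * poly h a) {a..c}"
  proof (rule fundamental_theorem_of_calculus[OF assms])
    fix \<sigma> assume "\<sigma> \<in> {a..c}"
    show "((\<lambda>\<sigma>. poly g \<sigma> * poly h \<sigma>) has_vector_derivative
        poly (pderiv g) \<sigma> * poly h \<sigma> + poly (pderiv h) \<sigma> * poly g \<sigma>) (at \<sigma> within {a..c})"
      unfolding has_real_derivative_iff_has_vector_derivative[symmetric]
      by (auto intro!: derivative_eq_intros poly_DERIV[THEN has_field_derivative_at_within])
  qed
  then have "integral {a..c} (\<lambda>\<sigma>. poly (pderiv g) \<sigma> * poly h \<sigma> + poly (pderiv h) \<sigma> * poly g \<sigma>)
      = poly g c * poly h c - poly g a * poly h a"
    by (simp add: integral_unique)
  then show ?thesis by (simp add: integral_add poly_integrable_on)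
qed

context
  fixes r :: nat and t :: "nat \<Rightarrow> real" and tq :: "nat \<Rightarrow> nat \<Rightarrow> real" and n :: nat
  assumes step: "t (n - 1) < t n" and inj: "inj_on (tq n) {..r}"
begin

lemma tau_beta_pos: "i \<le> r \<Longrightarrow> 0 < tau t n * beta r t tq n i"
proof -
  assume "i \<le> r"
  then have "basis_fun r tq n i \<noteq> 0"
    using poly_lagrange[OF inj, of i i] by (auto simp: basis_fun_def)
  then have "0 < integral {t (n - 1)..t n} (\<lambda>\<sigma>. poly (basis_fun r tq n i) \<sigma> * poly (basis_fun r tq n i) \<sigma>)"
    by (rule integral_poly_square_pos[OF step])
  then show ?thesis using step by (simp add: beta_def tau_def)
qed

text \<open>Integration by parts leaves the product at \<open>t n\<close> minus the product at
  \<open>t (n - 1)\<close>; the jump term \<open>gam i * gam j\<close>, counted twice, turns the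
  minus into a plus. The symmetric part is therefore positive semidefinite.\<close>

lemma alpha'_symmetric_part:
  "alpha' r t tq n i j + alpha' r t tq n j i =
     poly (basis_fun r tq n i) (t n) * poly (basis_fun r tq n j) (t n)
     + poly (basis_fun r tq n i) (t (n - 1)) * poly (basis_fun r tq n j) (t (n - 1))"
  using integral_poly_by_parts[of "t (n - 1)" "t n" "basis_fun r tq n i" "basis_fun r tq n j"] step
  by (simp add: alpha'_def alpha_def gam_def algebra_simps)

text \<open>The operator \<open>\<Phi>\<close> sends \<open>\<phi>\<^sub>j\<close> to \<open>\<Sum>\<^sub>i \<alpha>'\<^sub>i\<^sub>j \<phi>\<^sub>i\<close>; testing \<open>\<Phi> v = 0\<close> with \<open>v\<close> gives
  \<open>v(t\<^sub>n)\<^sup>2 + v(t\<^sub>n\<^sub>-\<^sub>1)\<^sup>2 = 0\<close>, and then testing with \<open>v'\<close> gives \<open>v' = 0\<close>.\<close>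

lemma alpha'_left_inverse:
  "\<exists>A. \<forall>l\<le>r. \<forall>j\<le>r. (\<Sum>i\<le>r. A l i * alpha' r t tq n i j) = (if l = j then 1 else 0)"
proof -
  interpret vs: vector_space_pair "smult :: real \<Rightarrow> real poly \<Rightarrow> real poly" "smult :: real \<Rightarrow> real poly \<Rightarrow> real poly"
    by unfold_locales (auto simp: smult_add_right smult_add_left)
  define \<phi> where "\<phi> = basis_fun r tq n"
  define a c where "a = t (n - 1)" and "c = t n"
  have ac: "a < c" using step by (simp add: a_def c_def)
  \<comment> \<open>The discontinuous Galerkin time derivative of \<open>v\<close> tested with
    \<open>g\<close>, jump term at \<open>a\<close> included; its values on pairs of basis
    polynomials are the entries of \<open>alpha'\<close>.\<close>
  define F where "F v g = integral {a..c} (\<lambda>\<sigma>. poly (pderiv v) \<sigma> * poly g \<sigma>) + poly v a * poly g a"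
    for v g :: "real poly"
  have F_add: "F (v + v') g = F v g + F v' g" for v v' g
    by (simp add: F_def pderiv_add algebra_simps integral_add poly_integrable_on)
  have F_smult: "F (smult s v) g = s * F v g" for s v g
    by (simp add: F_def pderiv_smult algebra_simps poly_integrable_on)
  have F_add2: "F v (g + g') = F v g + F v g'" for v g g'
    by (simp add: F_def algebra_simps integral_add poly_integrable_on)
  have F_smult2: "F v (smult s g) = s * F v g" for s v g
  proof -
    have "(\<lambda>\<sigma>. poly (pderiv v) \<sigma> * poly (smult s g) \<sigma>) = (\<lambda>\<sigma>. s * (poly (pderiv v) \<sigma> * poly g \<sigma>))"
      by (simp add: fun_eq_iff)
    then show ?thesis by (simp add: F_def algebra_simps)
  qed
  \<comment> \<open>The coefficients are nodal values: \<open>\<Phi> v\<close> at node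
    \<open>l\<close> equals \<open>F v (\<phi> l)\<close>, so \<open>\<Phi> v = 0\<close> says that
    \<open>F v\<close> vanishes on all polynomials of degree at most \<open>r\<close>.\<close>
  define \<Phi> where "\<Phi> v = (\<Sum>i\<le>r. smult (F v (\<phi> i)) (\<phi> i))" for v
  have lin: "Vector_Spaces.linear smult smult \<Phi>"
    by unfold_locales
      (simp_all add: \<Phi>_def F_add F_smult smult_add_left sum.distrib vs.vs1.scale_sum_right)
  have rep: "g = (\<Sum>j\<le>r. smult (poly g (tq n j)) (\<phi> j))" if "degree g \<le> r" for g
    using lagrange_interpolation[OF inj that] by (simp add: \<phi>_def basis_fun_def)
  have F_zero: "F v 0 = 0" for v by (simp add: F_def)
  have Frep: "F v g = (\<Sum>j\<le>r. poly g (tq n j) * F v (\<phi> j))" if "degree g \<le> r" for v g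
  proof -
    have "F v (\<Sum>j\<in>S. smult (w j) (\<phi> j)) = (\<Sum>j\<in>S. w j * F v (\<phi> j))" if "finite S" for S w
      using that by induction (simp_all add: F_add2 F_smult2 F_zero)
    from this[of "{..r}" "\<lambda>j. poly g (tq n j)"] show ?thesis using rep[OF that] by simp
  qed
  have deg: "degree v \<le> r" if "v \<in> vs.vs1.span (\<phi> ` {..r})" for v
    using that
  proof (induction rule: vs.vs1.span_induct_alt)
    case (step s x y)
    then show ?case
      by (auto simp: \<phi>_def basis_fun_def intro!: degree_add_le order_trans[OF degree_smult_le] degree_lagrange)
  qed simp
  have coeff: "F v (\<phi> l) = poly (\<Phi> v) (tq n l)" if "l \<le> r" for v l
  proof -
    have "poly (\<Phi> v) (tq n l) = (\<Sum>i\<le>r. F v (\<phi> i) * poly (\<phi> i) (tq n l))"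
      by (simp add: \<Phi>_def poly_sum)
    also have "\<dots> = (\<Sum>i\<le>r. if i = l then F v (\<phi> i) else 0)"
      using that by (intro sum.cong) (auto simp: \<phi>_def basis_fun_def poly_lagrange[OF inj])
    finally show ?thesis using that by simp
  qed
  have ker: "v = 0" if v: "degree v \<le> r" and z: "\<Phi> v = 0" for v
  proof -
    have F0: "F v g = 0" if "degree g \<le> r" for g
      using Frep[OF that, of v] coeff[of _ v] z by simp
    have "2 * F v v = (poly v c)\<^sup>2 + (poly v a)\<^sup>2"
      using integral_poly_by_parts[of a c v v] ac by (simp add: F_def power2_eq_square)
    then have va: "poly v a = 0" using F0[OF v] by (simp add: add_nonneg_eq_0_iff)
    \<comment> \<open>The derivative is an admissible test polynomial. Since \<open>v\<close>
      vanishes at \<open>a\<close>, this value is the integral of the square of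
      \<open>pderiv v\<close>.\<close>
    have "F v (pderiv v) = 0"
      using F0[of "pderiv v"] v by (simp add: degree_pderiv)
    then have "pderiv v = 0"
      using integral_poly_square_pos[OF ac, of "pderiv v"] va by (auto simp: F_def)
    then have "degree v = 0" by (simp add: pderiv_eq_0_iff)
    then obtain s where "v = [:s:]" by (rule degree_eq_zeroE)
    then show ?thesis using va by simp
  qed
  have inj\<Phi>: "inj_on \<Phi> (vs.vs1.span (\<phi> ` {..r}))"
  proof (rule inj_onI)
    fix u v assume uv: "u \<in> vs.vs1.span (\<phi> ` {..r})" "v \<in> vs.vs1.span (\<phi> ` {..r})" "\<Phi> u = \<Phi> v"
    interpret L: Vector_Spaces.linear smult smult \<Phi> by (rule lin)
    have "\<Phi> (u - v) = 0" using L.diff[of u v] uv(3) by simp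
    then have "u - v = 0"
      using ker[OF deg[OF vs.vs1.span_diff[OF uv(1,2)]]] by blast
    then show "u = v" by simp
  qed
  obtain G where G: "Vector_Spaces.linear smult smult G"
    "\<And>v. v \<in> vs.vs1.span (\<phi> ` {..r}) \<Longrightarrow> G (\<Phi> v) = v"
    using vs.linear_inj_on_left_inverse[OF lin inj\<Phi>] by blast
  interpret G: Vector_Spaces.linear smult smult G by (rule G)
  have al: "F (\<phi> j) (\<phi> i) = alpha' r t tq n i j" for i j
    by (simp add: F_def alpha'_def alpha_def gam_def \<phi>_def a_def c_def mult.commute)
  \<comment> \<open>The left inverse has the nodal values of \<open>G (\<phi> i)\<close> as entries:
    the identity \<open>\<phi> j = G (\<Phi> (\<phi> j))\<close> is read off at node
    \<open>l\<close>.\<close>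
  have "(\<Sum>i\<le>r. poly (G (\<phi> i)) (tq n l) * alpha' r t tq n i j) = (if l = j then 1 else 0)"
    if "l \<le> r" "j \<le> r" for l j
  proof -
    have "\<phi> j = G (\<Phi> (\<phi> j))" using that by (simp add: G(2) vs.vs1.span_base)
    also have "\<dots> = (\<Sum>i\<le>r. smult (alpha' r t tq n i j) (G (\<phi> i)))"
      by (simp add: \<Phi>_def G.sum G.scale al)
    finally have e: "\<phi> j = (\<Sum>i\<le>r. smult (alpha' r t tq n i j) (G (\<phi> i)))" .
    have "poly (\<phi> j) (tq n l) = (\<Sum>i\<le>r. alpha' r t tq n i j * poly (G (\<phi> i)) (tq n l))"
      by (subst e) (simp add: poly_sum)
    then show ?thesis
      using that by (simp add: \<phi>_def basis_fun_def poly_lagrange[OF inj] mult.commute)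
  qed
  then show ?thesis by (intro exI[of _ "\<lambda>l i. poly (G (\<phi> i)) (tq n l)"]) auto
qed

end

section \<open>Square-integrable functions and operators into them\<close>

lemma L2_measurable: "f \<in> L2 \<Omega> \<Longrightarrow> f \<in> borel_measurable (lebesgue_on \<Omega>)"
  by (simp add: L2_def)

lemma L2_inner_integrable:
  assumes "f \<in> L2 \<Omega>" "g \<in> L2 \<Omega>"
  shows "integrable (lebesgue_on \<Omega>) (\<lambda>x. f x \<bullet> g x)"
proof (rule Bochner_Integration.integrable_bound)
  show "integrable (lebesgue_on \<Omega>) (\<lambda>x. (norm (f x))\<^sup>2 + (norm (g x))\<^sup>2)"
    using assms by (simp add: L2_def)
  show "(\<lambda>x. f x \<bullet> g x) \<in> borel_measurable (lebesgue_on \<Omega>)"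
    using assms by (intro borel_measurable_inner L2_measurable)
  have "norm (f x \<bullet> g x) \<le> norm ((norm (f x))\<^sup>2 + (norm (g x))\<^sup>2)" for x
  proof -
    have "\<bar>f x \<bullet> g x\<bar> \<le> norm (f x) * norm (g x)" by (rule Cauchy_Schwarz_ineq2)
    also have "\<dots> \<le> (norm (f x))\<^sup>2 + (norm (g x))\<^sup>2"
    proof -
      have "0 \<le> norm (f x) * norm (g x)" by simp
      then show ?thesis
        using sum_squares_bound[of "norm (f x)" "norm (g x)"] unfolding mult.assoc by linarith
    qed
    finally show ?thesis by simp
  qed
  then show "AE x in lebesgue_on \<Omega>. norm (f x \<bullet> g x) \<le> norm ((norm (f x))\<^sup>2 + (norm (g x))\<^sup>2)"
    by (intro AE_I2)
qed

lemma L2_zero: "(\<lambda>_. 0) \<in> L2 \<Omega>"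
  by (simp add: L2_def)

lemma L2_lin_mem:
  assumes "f \<in> L2 \<Omega>" "g \<in> L2 \<Omega>"
  shows "(\<lambda>x. f x + c *\<^sub>R g x) \<in> L2 \<Omega>"
proof -
  have m: "(\<lambda>x. f x + c *\<^sub>R g x) \<in> borel_measurable (lebesgue_on \<Omega>)"
    using assms by (intro borel_measurable_add borel_measurable_scaleR borel_measurable_const L2_measurable)
  have "integrable (lebesgue_on \<Omega>) (\<lambda>x. (norm (f x + c *\<^sub>R g x))\<^sup>2)"
  proof (rule Bochner_Integration.integrable_bound)
    show "integrable (lebesgue_on \<Omega>) (\<lambda>x. 2 * (norm (f x))\<^sup>2 + 2 * c\<^sup>2 * (norm (g x))\<^sup>2)"
      using assms by (simp add: L2_def)
    show "(\<lambda>x. (norm (f x + c *\<^sub>R g x))\<^sup>2) \<in> borel_measurable (lebesgue_on \<Omega>)"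
      using m by measurable
    have "(norm (f x + c *\<^sub>R g x))\<^sup>2 \<le> 2 * (norm (f x))\<^sup>2 + 2 * c\<^sup>2 * (norm (g x))\<^sup>2" for x
    proof -
      have "(norm (f x + c *\<^sub>R g x))\<^sup>2 \<le> (norm (f x) + \<bar>c\<bar> * norm (g x))\<^sup>2"
        using norm_triangle_ineq[of "f x" "c *\<^sub>R g x"] by (intro power_mono) auto
      also have "\<dots> \<le> 2 * (norm (f x))\<^sup>2 + 2 * (\<bar>c\<bar> * norm (g x))\<^sup>2"
        using sum_squares_bound[of "norm (f x)" "\<bar>c\<bar> * norm (g x)"] by (simp add: power2_sum)
      finally show ?thesis by (simp add: power_mult_distrib)
    qed
    then show "AE x in lebesgue_on \<Omega>. norm ((norm (f x + c *\<^sub>R g x))\<^sup>2)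
        \<le> norm (2 * (norm (f x))\<^sup>2 + 2 * c\<^sup>2 * (norm (g x))\<^sup>2)"
      by (intro AE_I2) simp
  qed
  then show ?thesis using m by (simp add: L2_def)
qed

lemma psd_form_L2: "psd_form (L2 \<Omega> :: (real^'d::finite \<Rightarrow> 'b::euclidean_space) set) (L2_inner \<Omega>)"
proof
  fix f g h :: "real^'d \<Rightarrow> 'b" and c
  assume fg: "f \<in> L2 \<Omega>" "g \<in> L2 \<Omega>"
  show "(\<lambda>x. f x + c *\<^sub>R g x) \<in> L2 \<Omega>" using fg by (rule L2_lin_mem)
  show "L2_inner \<Omega> f g = L2_inner \<Omega> g f" by (simp add: L2_inner_def inner_commute)
  show "L2_inner \<Omega> (\<lambda>x. f x + c *\<^sub>R g x) h = L2_inner \<Omega> f h + c * L2_inner \<Omega> g h" if "h \<in> L2 \<Omega>"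
    using that fg by (simp add: L2_inner_def inner_add_left L2_inner_integrable)
  show "0 \<le> L2_inner \<Omega> f f" unfolding L2_inner_def by (intro integral_nonneg_AE AE_I2) simp
qed (rule L2_zero)

lemma L2_norm_power2: "f \<in> L2 \<Omega> \<Longrightarrow> (L2_norm \<Omega> f)\<^sup>2 = L2_inner \<Omega> f f"
  using psd_form.nonneg[OF psd_form_L2, of f \<Omega>] by (simp add: L2_norm_def)

lemma L2_inner_cong_AE:
  assumes "f \<in> L2 \<Omega>" "f' \<in> L2 \<Omega>" "g \<in> L2 \<Omega>" "g' \<in> L2 \<Omega>"
    "AE x in lebesgue_on \<Omega>. f x = f' x" "AE x in lebesgue_on \<Omega>. g x = g' x"
  shows "L2_inner \<Omega> f g = L2_inner \<Omega> f' g'"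
  unfolding L2_inner_def
proof (rule integral_cong_AE)
  show "AE x in lebesgue_on \<Omega>. f x \<bullet> g x = f' x \<bullet> g' x"
    using assms(5,6) by eventually_elim simp
qed (intro borel_measurable_inner L2_measurable assms)+

lemma L2_inner_self_eq_0:
  assumes "f \<in> L2 \<Omega>" "L2_inner \<Omega> f f = 0"
  shows "AE x in lebesgue_on \<Omega>. f x = 0"
proof -
  have "AE x in lebesgue_on \<Omega>. f x \<bullet> f x = 0"
    using integral_nonneg_eq_0_iff_AE[OF L2_inner_integrable[OF assms(1) assms(1)]] assms(2)
    by (simp add: L2_inner_def)
  then show ?thesis by simp
qed

text \<open>Completeness of Lebesgue measure, applied to the extensions by zero. It makes gradients
  and \<open>matrix_inv (K x) *v f x\<close> measurable, both of which are controlled only almost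
  everywhere.\<close>

lemma borel_measurable_lebesgue_on_AE:
  fixes f g :: "'a::euclidean_space \<Rightarrow> 'b::euclidean_space"
  assumes S: "S \<in> sets lebesgue" and f: "f \<in> borel_measurable (lebesgue_on S)"
    and eq: "AE x in lebesgue_on S. f x = g x"
  shows "g \<in> borel_measurable (lebesgue_on S)"
proof -
  have "AE x in lebesgue. x \<in> S \<longrightarrow> f x = g x"
    using eq S AE_restrict_space_iff[of S lebesgue "\<lambda>x. f x = g x"] by simp
  then have "AE x in lebesgue. (if x \<in> S then f x else 0) = (if x \<in> S then g x else 0)"
    by eventually_elim auto
  then have "(\<lambda>x. if x \<in> S then g x else 0) \<in> borel_measurable lebesgue"
    by (rule borel_measurable_AE[OF borel_measurable_if_I[OF f S]])
  then show ?thesis by (rule borel_measurable_if_D)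
qed

lemma L2_I_bounded:
  assumes "\<Omega> \<in> lmeasurable" "f \<in> borel_measurable (lebesgue_on \<Omega>)"
    "AE x in lebesgue_on \<Omega>. norm (f x) \<le> C"
  shows "f \<in> L2 \<Omega>"
proof -
  interpret finite_measure "lebesgue_on \<Omega>" using assms(1) by (rule finite_measure_lebesgue_on)
  have "integrable (lebesgue_on \<Omega>) (\<lambda>x. (norm (f x))\<^sup>2)"
  proof (rule integrable_const_bound)
    show "AE x in lebesgue_on \<Omega>. norm ((norm (f x))\<^sup>2) \<le> C\<^sup>2"
      using assms(3) by eventually_elim (simp add: power_mono)
    show "(\<lambda>x. (norm (f x))\<^sup>2) \<in> borel_measurable (lebesgue_on \<Omega>)"
      using assms(2) by measurable
  qed
  then show ?thesis using assms(2) by (simp add: L2_def)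
qed

lemma L2_bounded_linear:
  fixes A :: "'b::euclidean_space \<Rightarrow> 'c::euclidean_space"
  assumes A: "bounded_linear A" and f: "f \<in> L2 \<Omega>"
  shows "(\<lambda>x. A (f x)) \<in> L2 \<Omega>"
proof -
  have m: "(\<lambda>x. A (f x)) \<in> borel_measurable (lebesgue_on \<Omega>)"
    using measurable_compose[OF L2_measurable[OF f]] A
    by (intro measurable_compose[OF L2_measurable[OF f]] borel_measurable_continuous_onI)
      (rule linear_continuous_on)
  obtain C where C: "\<And>x. norm (A x) \<le> norm x * C"
    using A bounded_linear.bounded by blast
  have "integrable (lebesgue_on \<Omega>) (\<lambda>x. (norm (A (f x)))\<^sup>2)"
  proof (rule Bochner_Integration.integrable_bound)
    show "integrable (lebesgue_on \<Omega>) (\<lambda>x. C\<^sup>2 * (norm (f x))\<^sup>2)"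
      using f by (simp add: L2_def)
    show "(\<lambda>x. (norm (A (f x)))\<^sup>2) \<in> borel_measurable (lebesgue_on \<Omega>)"
      using m by measurable
    have "(norm (A (f x)))\<^sup>2 \<le> C\<^sup>2 * (norm (f x))\<^sup>2" for x
      using power_mono[OF C[of "f x"], of 2] by (simp add: power_mult_distrib mult.commute)
    then show "AE x in lebesgue_on \<Omega>. norm ((norm (A (f x)))\<^sup>2) \<le> norm (C\<^sup>2 * (norm (f x))\<^sup>2)"
      by (intro AE_I2) simp
  qed
  then show ?thesis using m by (simp add: L2_def)
qed

text \<open>Linearity is required only almost everywhere, as the classical derivatives of finite
  element functions need not be additive on cell boundaries. Identity, gradient, divergence, strain
  and the application of the inverse permeability are instances.\<close>

locale L2_operator =
  fixes \<Omega> :: "(real^'d::finite) set" and X :: "('a \<Rightarrow> 'b::real_vector) set"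
    and D :: "('a \<Rightarrow> 'b) \<Rightarrow> real^'d \<Rightarrow> 'c::euclidean_space"
  assumes zero_mem: "(\<lambda>_. 0) \<in> X"
    and lin_mem: "f \<in> X \<Longrightarrow> g \<in> X \<Longrightarrow> (\<lambda>x. f x + c *\<^sub>R g x) \<in> X"
    and L2: "f \<in> X \<Longrightarrow> D f \<in> L2 \<Omega>"
    and lin: "f \<in> X \<Longrightarrow> g \<in> X \<Longrightarrow>
      AE x in lebesgue_on \<Omega>. D (\<lambda>x. f x + c *\<^sub>R g x) x = D f x + c *\<^sub>R D g x"
begin

lemma inner_lin:
  assumes "f \<in> X" "g \<in> X" "w \<in> L2 \<Omega>"
  shows "L2_inner \<Omega> (D (\<lambda>x. f x + c *\<^sub>R g x)) w = L2_inner \<Omega> (D f) w + c * L2_inner \<Omega> (D g) w"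
proof -
  interpret L: psd_form "L2 \<Omega> :: (real^'d \<Rightarrow> 'c) set" "L2_inner \<Omega>" by (rule psd_form_L2)
  have "L2_inner \<Omega> (D (\<lambda>x. f x + c *\<^sub>R g x)) w = L2_inner \<Omega> (\<lambda>x. D f x + c *\<^sub>R D g x) w"
    using assms by (intro L2_inner_cong_AE L2 lin_mem L.lin_mem lin) auto
  then show ?thesis using assms by (simp add: L.lin L2)
qed

lemma psd_form: "psd_form X (\<lambda>f g. L2_inner \<Omega> (D f) (D g))"
proof
  fix f g h c
  assume fg: "f \<in> X" "g \<in> X"
  show "L2_inner \<Omega> (D f) (D g) = L2_inner \<Omega> (D g) (D f)"
    using fg by (intro psd_form.sym[OF psd_form_L2] L2)
  show "L2_inner \<Omega> (D (\<lambda>x. f x + c *\<^sub>R g x)) (D h) = L2_inner \<Omega> (D f) (D h) + c * L2_inner \<Omega> (D g) (D h)"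
    if "h \<in> X" using fg that by (intro inner_lin L2)
  show "(\<lambda>x. f x + c *\<^sub>R g x) \<in> X" using fg by (rule lin_mem)
  show "0 \<le> L2_inner \<Omega> (D f) (D f)" using fg by (intro psd_form.nonneg[OF psd_form_L2] L2)
qed (rule zero_mem)

lemma inner_diff:
  assumes "f \<in> X" "g \<in> X" "w \<in> L2 \<Omega>"
  shows "L2_inner \<Omega> (D (\<lambda>x. f x - g x)) w = L2_inner \<Omega> (D f) w - L2_inner \<Omega> (D g) w"
  using inner_lin[OF assms, of "-1"] by simp

lemma inner_zero: "w \<in> L2 \<Omega> \<Longrightarrow> L2_inner \<Omega> (D (\<lambda>_. 0)) w = 0"
  using inner_lin[OF zero_mem zero_mem, of w 1] by simp

lemma inner_sum:
  assumes "finite I" "\<And>i. i \<in> I \<Longrightarrow> f i \<in> X" "w \<in> L2 \<Omega>"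
  shows "L2_inner \<Omega> (D (\<lambda>x. \<Sum>i\<in>I. c i *\<^sub>R f i x)) w = (\<Sum>i\<in>I. c i * L2_inner \<Omega> (D (f i)) w)"
  using assms
proof (induction I rule: finite_induct)
  case (insert i I)
  have "L2_inner \<Omega> (D (\<lambda>x. (\<Sum>i\<in>I. c i *\<^sub>R f i x) + c i *\<^sub>R f i x)) w
    = L2_inner \<Omega> (D (\<lambda>x. \<Sum>i\<in>I. c i *\<^sub>R f i x)) w + c i * L2_inner \<Omega> (D (f i)) w"
    using insert by (intro inner_lin psd_form.sum_mem[OF psd_form]) auto
  then show ?case using insert by (simp add: add.commute)
qed (simp add: inner_zero)

lemma compose_bounded_linear:
  assumes "bounded_linear (A :: 'c \<Rightarrow> 'e::euclidean_space)"
  shows "L2_operator \<Omega> X (\<lambda>f x. A (D f x))"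
proof
  interpret A: bounded_linear A by fact
  fix f g c assume fg: "f \<in> X" "g \<in> X"
  show "AE x in lebesgue_on \<Omega>. A (D (\<lambda>x. f x + c *\<^sub>R g x) x) = A (D f x) + c *\<^sub>R A (D g x)"
    using lin[OF fg, of c] by eventually_elim (simp add: A.add A.scaleR)
  show "(\<lambda>x. f x + c *\<^sub>R g x) \<in> X" using fg by (rule lin_mem)
  show "(\<lambda>x. A (D f x)) \<in> L2 \<Omega>" using fg by (intro L2_bounded_linear[OF assms] L2)
qed (rule zero_mem)

end

section \<open>Polynomial maps and functions transported from the reference cell\<close>

lemma matrix_inv_invertible:
  fixes A :: "real^'n::finite^'n"
  assumes "det A \<noteq> 0"
  shows "A ** matrix_inv A = mat 1" "matrix_inv A ** A = mat 1"
proof -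
  have "\<exists>A'. A ** A' = mat 1 \<and> A' ** A = mat 1"
    using assms invertible_det_nz[of A] by (simp add: invertible_def)
  then have "A ** matrix_inv A = mat 1 \<and> matrix_inv A ** A = mat 1"
    unfolding matrix_inv_def by (rule someI_ex)
  then show "A ** matrix_inv A = mat 1" "matrix_inv A ** A = mat 1" by auto
qed

text \<open>Cramer's rule displays every entry of the inverse as a quotient of polynomials in the
  entries of \<open>A\<close>, from which continuity of the inverse follows.\<close>

lemma matrix_inv_entry:
  fixes A :: "real^'n::finite^'n"
  assumes "det A \<noteq> 0"
  shows "matrix_inv A $ k $ l = det (\<chi> i j. if j = k then axis l 1 $ i else A $ i $ j) / det A"
proof -
  have "A *v (matrix_inv A *v axis l 1) = axis l 1"
    by (simp add: matrix_vector_mul_assoc matrix_inv_invertible[OF assms])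
  then have "matrix_inv A *v axis l 1 = (\<chi> k. det (\<chi> i j. if j = k then axis l 1 $ i else A $ i $ j) / det A)"
    using cramer[OF assms] by blast
  moreover have "(matrix_inv A *v axis l 1) $ k = matrix_inv A $ k $ l"
    by (simp add: matrix_vector_mul_component inner_axis)
  ultimately show ?thesis by simp
qed

lemma continuous_on_det:
  fixes A :: "'a::topological_space \<Rightarrow> real^'n::finite^'n"
  assumes "continuous_on S A"
  shows "continuous_on S (\<lambda>x. det (A x))"
  unfolding det_def
  by (intro continuous_intros) (rule assms)

lemma continuous_on_matrix_inv:
  fixes A :: "'a::topological_space \<Rightarrow> real^'n::finite^'n"
  assumes A: "continuous_on S A" and nz: "\<And>x. x \<in> S \<Longrightarrow> det (A x) \<noteq> 0"
  shows "continuous_on S (\<lambda>x. matrix_inv (A x))"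
proof -
  have "continuous_on S (\<lambda>x. \<chi> k l. det (\<chi> i j. if j = k then axis l 1 $ i else A x $ i $ j) / det (A x))"
  proof (intro continuous_on_vec_lambda continuous_on_divide continuous_on_det A)
    show "continuous_on S (\<lambda>x. if j = k then axis l 1 $ i else A x $ i $ j)" for i j k l
      by (cases "j = k") (auto intro!: continuous_intros A)
  qed (use nz in auto)
  then show ?thesis
    by (rule continuous_on_eq) (simp add: vec_eq_iff matrix_inv_entry nz)
qed

lemma borel_measurable_vec_nth [measurable]:
  fixes f :: "'a \<Rightarrow> 'b::euclidean_space^'n::finite"
  assumes "f \<in> borel_measurable M"
  shows "(\<lambda>x. f x $ i) \<in> borel_measurable M"
  by (rule measurable_compose[OF assms])
    (intro borel_measurable_continuous_onI continuous_intros)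

lemma borel_measurable_vec_lambda:
  fixes f :: "'n::finite \<Rightarrow> 'a \<Rightarrow> real"
  assumes "\<And>i. f i \<in> borel_measurable M"
  shows "(\<lambda>x. \<chi> i. f i x) \<in> borel_measurable M"
  by (subst borel_measurable_euclidean_space)
    (auto simp: Basis_vec_def inner_axis assms)

lemma borel_measurable_det:
  fixes A :: "'a \<Rightarrow> real^'n::finite^'n"
  assumes "\<And>i j. (\<lambda>x. A x $ i $ j) \<in> borel_measurable M"
  shows "(\<lambda>x. det (A x)) \<in> borel_measurable M"
  unfolding det_def using assms
  by (intro borel_measurable_sum borel_measurable_times borel_measurable_prod borel_measurable_const)

text \<open>Cramer's rule yields a measurable function also where \<open>A x\<close> is singular.\<close>

lemma borel_measurable_cramer:
  fixes A :: "'a \<Rightarrow> real^'n::finite^'n" and v :: "'a \<Rightarrow> real^'n"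
  assumes "A \<in> borel_measurable M" "v \<in> borel_measurable M"
  shows "(\<lambda>x. \<chi> k. det (\<chi> i j. if j = k then v x $ i else A x $ i $ j) / det (A x)) \<in> borel_measurable M"
proof (intro borel_measurable_vec_lambda borel_measurable_divide borel_measurable_det)
  show "(\<lambda>x. (\<chi> i j. if j = k then v x $ i else A x $ i $ j) $ i' $ j') \<in> borel_measurable M" for k i' j'
    using assms by (cases "j' = k") simp_all
qed (use assms in simp)

lemma real_polynomial_function_vec_nth: "real_polynomial_function (\<lambda>x::real^'n::finite. x $ i)"
  by (rule real_polynomial_function.intros(1)) (rule bounded_linear_vec_nth)

lemma real_polynomial_function_det:
  fixes A :: "'a::real_normed_vector \<Rightarrow> real^'n::finite^'n"
  assumes "\<And>i j. real_polynomial_function (\<lambda>x. A x $ i $ j)"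
  shows "real_polynomial_function (\<lambda>x. det (A x))"
  unfolding det_def using assms
  by (intro real_polynomial_function_sum real_polynomial_function.intros(4) real_polynomial_function.intros(2)
      real_polynomial_function_prod finite_permutations finite)

lemma finite_multi_indices: "finite {\<alpha> :: 'd::finite \<Rightarrow> nat. \<forall>i. \<alpha> i \<le> m i}"
proof -
  have "{\<alpha> :: 'd \<Rightarrow> nat. \<forall>i. \<alpha> i \<le> m i} = PiE UNIV (\<lambda>i. {..m i})" by (auto simp: PiE_def Pi_def)
  then show ?thesis by (simp add: finite_PiE)
qed

lemma tensor_poly_real_polynomial_function:
  assumes "g \<in> tensor_poly m"
  shows "real_polynomial_function g"
proof -
  obtain c where c: "\<And>x. g x = (\<Sum>\<alpha> | \<forall>i. \<alpha> i \<le> m i. c \<alpha> * (\<Prod>i\<in>UNIV. vec_nth x i ^ \<alpha> i))"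
    using assms by (auto simp: tensor_poly_def)
  have "real_polynomial_function (\<lambda>x. \<Sum>\<alpha> | \<forall>i. \<alpha> i \<le> m i. c \<alpha> * (\<Prod>i\<in>UNIV. vec_nth x i ^ \<alpha> i))"
    by (intro real_polynomial_function_sum real_polynomial_function.intros(4) real_polynomial_function.intros(2)
        real_polynomial_function_prod real_polynomial_function_power real_polynomial_function_vec_nth
        finite_multi_indices finite)
  then show ?thesis using c by presburger
qed

lemma tensor_poly_zero: "(\<lambda>_. 0) \<in> tensor_poly m"
  by (auto simp: tensor_poly_def intro!: exI[of _ "\<lambda>_. 0"])

lemma tensor_poly_lin:
  assumes "f \<in> tensor_poly m" "g \<in> tensor_poly m"
  shows "(\<lambda>x. f x + a * g x) \<in> tensor_poly m"
proof -
  obtain c d where cd: "\<And>x. f x = (\<Sum>\<alpha> | \<forall>i. \<alpha> i \<le> m i. c \<alpha> * (\<Prod>i\<in>UNIV. vec_nth x i ^ \<alpha> i))"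
    "\<And>x. g x = (\<Sum>\<alpha> | \<forall>i. \<alpha> i \<le> m i. d \<alpha> * (\<Prod>i\<in>UNIV. vec_nth x i ^ \<alpha> i))"
    using assms by (auto simp: tensor_poly_def)
  show ?thesis unfolding tensor_poly_def
    by (intro CollectI exI[of _ "\<lambda>\<alpha>. c \<alpha> + a * d \<alpha>"] allI)
      (simp add: cd sum.distrib sum_distrib_left algebra_simps)
qed

text \<open>The partial derivatives are carried as explicit functions, so that induction on the
  construction of a polynomial can build them.\<close>

definition polynomial_partials :: "(real^'n::finite \<Rightarrow> real) \<Rightarrow> ('n \<Rightarrow> real^'n \<Rightarrow> real) \<Rightarrow> bool" where
  "polynomial_partials p p' \<longleftrightarrow> (\<forall>i. real_polynomial_function (p' i)) \<and>
    (\<forall>x. (p has_derivative (\<lambda>h. \<Sum>i\<in>UNIV. h $ i * p' i x)) (at x))"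

lemma real_polynomial_partials:
  fixes p :: "real^'n::finite \<Rightarrow> real"
  assumes "real_polynomial_function p"
  shows "\<exists>p'. polynomial_partials p p'"
  unfolding polynomial_partials_def using assms
proof (induction p rule: real_polynomial_function.induct)
  case (linear f)
  interpret f: bounded_linear f by fact
  have "f h = (\<Sum>i\<in>UNIV. h $ i * f (axis i 1))" for h
  proof -
    have "f h = f (\<Sum>i\<in>UNIV. h $ i *\<^sub>R axis i 1)"
      using basis_expansion[of h] by (simp add: scalar_mult_eq_scaleR)
    then show ?thesis by (simp add: f.sum f.scaleR)
  qed
  then have "(f has_derivative (\<lambda>h. \<Sum>i\<in>UNIV. h $ i * f (axis i 1))) (at x)" for x
    by (intro has_derivative_eq_rhs[OF bounded_linear_imp_has_derivative[OF f.bounded_linear_axioms]] ext)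
  then show ?case
    by (intro exI[of _ "\<lambda>i x. f (axis i 1)"]) auto
next
  case (const c)
  then show ?case by (intro exI[of _ "\<lambda>i x. 0"]) auto
next
  case (add f g)
  from add.IH(1) obtain f' where f': "\<And>i. real_polynomial_function (f' i)"
    "\<And>x. (f has_derivative (\<lambda>h. \<Sum>i\<in>UNIV. h $ i * f' i x)) (at x)" by blast
  from add.IH(2) obtain g' where g': "\<And>i. real_polynomial_function (g' i)"
    "\<And>x. (g has_derivative (\<lambda>h. \<Sum>i\<in>UNIV. h $ i * g' i x)) (at x)" by blast
  note d = f'(1) g'(1) f'(2) g'(2)
  have "((\<lambda>x. f x + g x) has_derivative (\<lambda>h. \<Sum>i\<in>UNIV. h $ i * (f' i x + g' i x))) (at x)" for x
    using has_derivative_add[OF d(3,4)] by (simp add: sum.distrib algebra_simps)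
  moreover have "real_polynomial_function (\<lambda>x. f' i x + g' i x)" for i
    using d(1,2) by (intro real_polynomial_function.intros(3))
  ultimately show ?case by (intro exI[of _ "\<lambda>i x. f' i x + g' i x"]) blast
next
  case (mult f g)
  from mult.IH(1) obtain f' where f': "\<And>i. real_polynomial_function (f' i)"
    "\<And>x. (f has_derivative (\<lambda>h. \<Sum>i\<in>UNIV. h $ i * f' i x)) (at x)" by blast
  from mult.IH(2) obtain g' where g': "\<And>i. real_polynomial_function (g' i)"
    "\<And>x. (g has_derivative (\<lambda>h. \<Sum>i\<in>UNIV. h $ i * g' i x)) (at x)" by blast
  note d = f'(1) g'(1) f'(2) g'(2)
  have "((\<lambda>x. f x * g x) has_derivative (\<lambda>h. \<Sum>i\<in>UNIV. h $ i * (f x * g' i x + f' i x * g x))) (at x)" for x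
    using has_derivative_mult[OF d(3,4)]
    by (simp add: sum.distrib sum_distrib_left sum_distrib_right algebra_simps)
  moreover have "real_polynomial_function (\<lambda>x. f x * g' i x + f' i x * g x)" for i
    using d(1,2) mult.hyps by (intro real_polynomial_function.intros(3,4))
  ultimately show ?case by (intro exI[of _ "\<lambda>i x. f x * g' i x + f' i x * g x"]) blast
qed

lemma jacobian_eqI: "(F has_derivative (\<lambda>h. A *v h)) (at x) \<Longrightarrow> jacobian F (at x) = A"
  for F :: "real^'n::finite \<Rightarrow> real^'m::finite"
  by (metis frechet_derivative_at jacobian_def matrix_of_matrix_vector_mul)

lemma has_derivative_matrix_componentwise:
  fixes F :: "real^'n::finite \<Rightarrow> real^'m::finite"
  shows "(F has_derivative (\<lambda>h. A *v h)) (at x) \<longleftrightarrow>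
    (\<forall>i. ((\<lambda>x. F x $ i) has_derivative (\<lambda>h. \<Sum>j\<in>UNIV. h $ j * A $ i $ j)) (at x))"
  by (subst has_derivative_componentwise_within)
    (auto simp: Basis_vec_def inner_axis matrix_vector_mult_def mult.commute)

text \<open>The derivative is the full one even at boundary points of \<open>S\<close>: the maps in
  question are polynomial or rational and defined around \<open>S\<close>. For the compact reference
  cube, continuity of the Jacobian then bounds it.\<close>

definition C1_on :: "(real^'n::finite) set \<Rightarrow> (real^'n \<Rightarrow> real^'n) \<Rightarrow> bool" where
  "C1_on S F \<longleftrightarrow> (\<forall>x\<in>S. F differentiable (at x)) \<and> continuous_on S (\<lambda>x. jacobian F (at x))"

lemma polynomial_map_jacobian:
  fixes F :: "real^'n::finite \<Rightarrow> real^'n"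
  assumes "\<And>i. real_polynomial_function (\<lambda>x. F x $ i)"
  shows "F differentiable (at x)" "real_polynomial_function (\<lambda>x. jacobian F (at x) $ i $ j)"
proof -
  have "\<forall>i. \<exists>q. polynomial_partials (\<lambda>x. F x $ i) q"
    using real_polynomial_partials[OF assms] by blast
  from choice[OF this] obtain p' where "\<forall>i. polynomial_partials (\<lambda>x. F x $ i) (p' i)" by blast
  then have p': "\<And>i j. real_polynomial_function (p' i j)"
    "\<And>i x. ((\<lambda>x. F x $ i) has_derivative (\<lambda>h. \<Sum>j\<in>UNIV. h $ j * p' i j x)) (at x)"
    by (auto simp: polynomial_partials_def)
  have d: "(F has_derivative (\<lambda>h. (\<chi> i j. p' i j x) *v h)) (at x)" for x
    by (subst has_derivative_matrix_componentwise) (simp add: p')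
  then show "F differentiable (at x)" by (auto simp: differentiable_def)
  show "real_polynomial_function (\<lambda>x. jacobian F (at x) $ i $ j)"
    using p'(1)[of i j] by (simp add: jacobian_eqI[OF d])
qed

lemma real_polynomial_function_continuous_on:
  "real_polynomial_function p \<Longrightarrow> continuous_on S p" for p :: "real^'n::finite \<Rightarrow> real"
  by (simp add: continuous_on_polymonial_function real_polynomial_function_eq)

lemma C1_on_rational:
  fixes num :: "'n::finite \<Rightarrow> real^'n \<Rightarrow> real"
  assumes num: "\<And>i. real_polynomial_function (num i)" and den: "real_polynomial_function den"
    and nz: "\<And>x. x \<in> S \<Longrightarrow> den x \<noteq> 0"
  shows "C1_on S (\<lambda>x. \<chi> i. num i x / den x)"
proof -
  have "\<forall>i. \<exists>q. polynomial_partials (num i) q"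
    using real_polynomial_partials[OF num] by blast
  from choice[OF this] obtain num' where "\<forall>i. polynomial_partials (num i) (num' i)" by blast
  then have n: "\<And>i j. real_polynomial_function (num' i j)"
    "\<And>i x. (num i has_derivative (\<lambda>h. \<Sum>j\<in>UNIV. h $ j * num' i j x)) (at x)"
    by (auto simp: polynomial_partials_def)
  obtain den' where "polynomial_partials den den'"
    using real_polynomial_partials[OF den] by blast
  then have d: "\<And>j. real_polynomial_function (den' j)"
    "\<And>x. (den has_derivative (\<lambda>h. \<Sum>j\<in>UNIV. h $ j * den' j x)) (at x)"
    by (auto simp: polynomial_partials_def)
  define J where "J x = (\<chi> i j. (num' i j x * den x - num i x * den' j x) / (den x * den x))" for x
  have J: "((\<lambda>x. \<chi> i. num i x / den x) has_derivative (\<lambda>h. J x *v h)) (at x)" if "x \<in> S" for x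
  proof -
    have "((\<lambda>x. num i x / den x) has_derivative (\<lambda>h. \<Sum>j\<in>UNIV. h $ j * J x $ i $ j)) (at x)" for i
    proof (rule has_derivative_eq_rhs[OF has_derivative_divide'[OF n(2) d(2) nz[OF that]]])
      show "(\<lambda>h. ((\<Sum>j\<in>UNIV. h $ j * num' i j x) * den x - num i x * (\<Sum>j\<in>UNIV. h $ j * den' j x)) / (den x * den x))
          = (\<lambda>h. \<Sum>j\<in>UNIV. h $ j * J x $ i $ j)"
        by (simp add: fun_eq_iff J_def sum_distrib_left sum_distrib_right algebra_simps
            flip: sum_subtractf sum_divide_distrib)
    qed
    then show ?thesis by (subst has_derivative_matrix_componentwise) simp
  qed
  have "continuous_on S J"
    unfolding J_def using nz
    by (intro continuous_on_vec_lambda continuous_intros real_polynomial_function_continuous_on num den n d) auto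
  then have "continuous_on S (\<lambda>x. jacobian (\<lambda>x. \<chi> i. num i x / den x) (at x))"
    by (rule continuous_on_eq) (simp add: jacobian_eqI[OF J])
  then show ?thesis using J by (auto simp: C1_on_def differentiable_def)
qed

lemma C1_on_polynomial:
  fixes F :: "real^'n::finite \<Rightarrow> real^'n"
  assumes "\<And>i. real_polynomial_function (\<lambda>x. F x $ i)"
  shows "C1_on S F"
  using C1_on_rational[of "\<lambda>i x. F x $ i" "\<lambda>_. 1" S] assms real_polynomial_function.intros(2)[of 1]
  by simp

section \<open>Reference maps and derivatives of transported functions\<close>

locale reference_map =
  fixes T :: "real^'d::finite \<Rightarrow> real^'d"
  assumes polynomial: "\<And>i. real_polynomial_function (\<lambda>x. T x $ i)"
    and inj: "inj_on T (cbox 0 1)"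
    and regular: "\<And>x. x \<in> cbox 0 1 \<Longrightarrow> det (jacobian T (at x)) \<noteq> 0"
begin

abbreviation inverse_map :: "real^'d \<Rightarrow> real^'d" where
  "inverse_map \<equiv> the_inv_into (cbox 0 1) T"

lemma differentiable: "T differentiable (at x)"
  by (rule polynomial_map_jacobian(1)[OF polynomial])

lemma continuous: "continuous_on S T"
  by (meson continuous_at_imp_continuous_on differentiable differentiable_imp_continuous_within)

lemma inverse_map: "x \<in> cbox 0 1 \<Longrightarrow> inverse_map (T x) = x"
  by (rule the_inv_into_f_f[OF inj])

lemma continuous_inverse_map: "continuous_on (T ` cbox 0 1) inverse_map"
  by (rule continuous_on_inv_into[OF continuous compact_cbox inj])

lemma open_cell: "open (T ` box 0 1)"
  by (rule invariance_of_domain[OF continuous open_box inj_on_subset[OF inj box_subset_cbox]])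

lemma negligible_cell_boundary: "negligible (T ` (cbox 0 1 - box 0 1))"
  by (rule negligible_differentiable_image_negligible[OF order_refl negligible_frontier_interval])
    (auto simp: differentiable_on_def intro: differentiable_at_withinI differentiable)

text \<open>Near \<open>T x\<close> the function \<open>v\<close> is \<open>F\<close> composed with
  the inverse of \<open>T\<close>, whose derivative is supplied by the inverse function theorem; the
  rest is the chain rule.\<close>

lemma has_derivative_transported:
  fixes v F :: "real^'d \<Rightarrow> real^'d"
  assumes F: "F differentiable (at x)" and v: "\<And>x. x \<in> box 0 1 \<Longrightarrow> v (T x) = F x" and x: "x \<in> box 0 1"
  shows "(v has_derivative (\<lambda>h. (jacobian F (at x) ** matrix_inv (jacobian T (at x))) *v h)) (at (T x))"
proof -
  have xc: "x \<in> cbox 0 1" using x box_subset_cbox by blast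
  let ?J = "jacobian T (at x)"
  have g: "(inverse_map has_derivative (\<lambda>h. matrix_inv ?J *v h)) (at (T x))"
  proof (rule has_derivative_inverse_strong[OF open_box x continuous])
    show "inverse_map (T y) = y" if "y \<in> box 0 1" for y
      using that box_subset_cbox by (intro inverse_map) blast
    show "(T has_derivative (\<lambda>h. ?J *v h)) (at x)"
      using differentiable by (simp add: jacobian_works)
    show "(\<lambda>h. ?J *v h) \<circ> (\<lambda>h. matrix_inv ?J *v h) = id"
      by (simp add: fun_eq_iff matrix_vector_mul_assoc matrix_inv_invertible regular[OF xc])
  qed
  have "(F has_derivative (\<lambda>h. jacobian F (at x) *v h)) (at (inverse_map (T x)))"
    using F inverse_map[OF xc] by (simp add: jacobian_works)
  from diff_chain_at[OF g this]
  have "(F \<circ> inverse_map has_derivative (\<lambda>h. (jacobian F (at x) ** matrix_inv ?J) *v h)) (at (T x))"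
    by (simp add: o_def matrix_vector_mul_assoc)
  then show ?thesis
  proof (rule has_derivative_transform_within_open[OF _ open_cell])
    show "(F \<circ> inverse_map) y = v y" if "y \<in> T ` box 0 1" for y
      using that v inverse_map box_subset_cbox by (force simp: subset_iff)
  qed (use x in auto)
qed

end

section \<open>Cellwise smooth functions on the mesh\<close>

locale fe_mesh =
  fixes \<Omega> :: "(real^'d::finite) set" and Th TK
  assumes open_domain: "open \<Omega>" and bounded_domain: "bounded \<Omega>" and mesh: "mesh \<Omega> Th TK"
begin

lemma finite_mesh: "finite Th" and mesh_covers: "\<Union>Th = closure \<Omega>"
  and cell_image: "E \<in> Th \<Longrightarrow> TK E ` cbox 0 1 = E"
  using mesh by (auto simp: mesh_def)

lemma reference_map:
  assumes "E \<in> Th"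
  shows "reference_map (TK E)"
proof
  have E: "(\<forall>i. (\<lambda>x. TK E x $ i) \<in> Q_poly 1) \<and> inj_on (TK E) (cbox 0 1) \<and>
      (\<forall>x\<in>cbox 0 1. det (jacobian (TK E) (at x)) \<noteq> 0)"
    using mesh assms by (simp add: mesh_def)
  show "real_polynomial_function (\<lambda>x. TK E x $ i)" for i
    using E by (intro tensor_poly_real_polynomial_function[of _ "\<lambda>_. 1"]) blast
  show "inj_on (TK E) (cbox 0 1)" using E by simp
  show "det (jacobian (TK E) (at x)) \<noteq> 0" if "x \<in> cbox 0 1" for x using E that by simp
qed

lemma domain_lmeasurable: "\<Omega> \<in> lmeasurable"
  by (rule lmeasurable_open[OF bounded_domain open_domain])

lemma domain_sets: "\<Omega> \<in> sets lebesgue"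
  using domain_lmeasurable by (rule fmeasurableD)

lemma AE_domain_iff: "(AE x in lebesgue_on \<Omega>. P x) \<longleftrightarrow> negligible {x \<in> \<Omega>. \<not> P x}"
proof -
  have "(AE x in lebesgue_on \<Omega>. P x) \<longleftrightarrow> (AE x in lebesgue. x \<in> \<Omega> \<longrightarrow> P x)"
    using domain_sets by (intro AE_restrict_space_iff) simp
  also have "\<dots> \<longleftrightarrow> {x. \<not> (x \<in> \<Omega> \<longrightarrow> P x)} \<in> null_sets lebesgue"
    by (simp add: completion.AE_iff_null_sets)
  finally show ?thesis by (simp add: negligible_iff_null_sets)
qed

definition open_cells :: "(real^'d) set" where
  "open_cells = (\<Union>E\<in>Th. TK E ` box 0 1)"

lemma open_open_cells: "open open_cells"
  unfolding open_cells_def using reference_map.open_cell[OF reference_map] by blast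

lemma cell_subset: "E \<in> Th \<Longrightarrow> TK E ` cbox 0 1 \<subseteq> closure \<Omega>"
  using cell_image mesh_covers by auto

lemma open_cells_subset: "open_cells \<subseteq> closure \<Omega>"
  unfolding open_cells_def using cell_subset box_subset_cbox by blast

lemma AE_open_cells: "AE x in lebesgue_on \<Omega>. x \<in> open_cells"
proof -
  have "{x \<in> \<Omega>. x \<notin> open_cells} \<subseteq> (\<Union>E\<in>Th. TK E ` (cbox 0 1 - box 0 1))"
  proof
    fix x assume x: "x \<in> {x \<in> \<Omega>. x \<notin> open_cells}"
    then have "x \<in> \<Union>Th" using mesh_covers closure_subset by auto
    then obtain E where E: "E \<in> Th" "x \<in> TK E ` cbox 0 1" using cell_image by auto
    then show "x \<in> (\<Union>E\<in>Th. TK E ` (cbox 0 1 - box 0 1))" using x by (auto simp: open_cells_def)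
  qed
  moreover have "negligible (\<Union>E\<in>Th. TK E ` (cbox 0 1 - box 0 1))"
    using finite_mesh reference_map.negligible_cell_boundary[OF reference_map] by (intro negligible_Union) auto
  ultimately show ?thesis unfolding AE_domain_iff using negligible_subset by blast
qed

text \<open>Values of \<open>v\<close> are prescribed on the open cells only, but the pullback
  \<open>F\<close> is smooth up to the closed cube; compactness of the cube bounds the gradient,
  which is how \<open>vgrad v\<close> becomes square integrable.\<close>

definition piecewise_C1 :: "(real^'d \<Rightarrow> real^'d) \<Rightarrow> bool" where
  "piecewise_C1 v \<longleftrightarrow> (\<forall>E\<in>Th. \<exists>F. C1_on (cbox 0 1) F \<and> (\<forall>x\<in>box 0 1. v (TK E x) = F x))"

lemma C1_on_differentiable: "C1_on (cbox 0 1) F \<Longrightarrow> x \<in> box 0 1 \<Longrightarrow> F differentiable (at x)"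
  using box_subset_cbox by (auto simp: C1_on_def)

lemma piecewise_C1_differentiable:
  assumes "piecewise_C1 v" "y \<in> open_cells"
  shows "v differentiable (at y)"
proof -
  obtain E x where E: "E \<in> Th" "x \<in> box 0 1" "y = TK E x" using assms(2) by (auto simp: open_cells_def)
  obtain F where F: "C1_on (cbox 0 1) F" "\<And>x. x \<in> box 0 1 \<Longrightarrow> v (TK E x) = F x"
    using assms(1) E(1) by (auto simp: piecewise_C1_def)
  show ?thesis
    using reference_map.has_derivative_transported[OF reference_map[OF E(1)] C1_on_differentiable[OF F(1) E(2)] F(2) E(2)]
    by (auto simp: E(3) differentiable_def)
qed

lemma piecewise_C1_has_derivative:
  "piecewise_C1 v \<Longrightarrow> y \<in> open_cells \<Longrightarrow> (v has_derivative (\<lambda>h. vgrad v y *v h)) (at y)"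
  unfolding vgrad_def using piecewise_C1_differentiable jacobian_works by blast

lemma vgrad_lin:
  assumes "piecewise_C1 f" "piecewise_C1 g" "y \<in> open_cells"
  shows "vgrad (\<lambda>x. f x + c *\<^sub>R g x) y = vgrad f y + c *\<^sub>R vgrad g y"
proof -
  have "((\<lambda>x. f x + c *\<^sub>R g x) has_derivative (\<lambda>h. (vgrad f y + c *\<^sub>R vgrad g y) *v h)) (at y)"
    using has_derivative_add[OF piecewise_C1_has_derivative[OF assms(1,3)]
        has_derivative_scaleR_right[OF piecewise_C1_has_derivative[OF assms(2,3)]], of c]
    by (simp add: matrix_vector_mult_add_rdistrib scaleR_matrix_vector_assoc)
  then show ?thesis unfolding vgrad_def by (rule jacobian_eqI)
qed

lemma vgrad_cell:
  assumes "piecewise_C1 v" "E \<in> Th"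
  shows "\<exists>G. continuous_on (cbox 0 1) G \<and> (\<forall>x\<in>box 0 1. vgrad v (TK E x) = G x)"
proof -
  interpret T: reference_map "TK E" by (rule reference_map[OF assms(2)])
  obtain F where F: "C1_on (cbox 0 1) F" "\<And>x. x \<in> box 0 1 \<Longrightarrow> v (TK E x) = F x"
    using assms by (auto simp: piecewise_C1_def)
  define G where "G x = jacobian F (at x) ** matrix_inv (jacobian (TK E) (at x))" for x
  have T1: "continuous_on (cbox 0 1) (\<lambda>x. jacobian (TK E) (at x))"
    using C1_on_polynomial[OF T.polynomial] by (auto simp: C1_on_def)
  have "continuous_on (cbox 0 1) G" unfolding G_def matrix_matrix_mult_def
    by (intro continuous_intros continuous_on_matrix_inv T1 T.regular) (use F(1) in \<open>auto simp: C1_on_def\<close>)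
  moreover have "vgrad v (TK E x) = G x" if "x \<in> box 0 1" for x
    unfolding vgrad_def G_def
    by (rule jacobian_eqI[OF T.has_derivative_transported[OF C1_on_differentiable[OF F(1) that] F(2) that]])
  ultimately show ?thesis by auto
qed

lemma vgrad_continuous_on:
  assumes "piecewise_C1 v"
  shows "continuous_on open_cells (vgrad v)"
  unfolding open_cells_def
proof (rule continuous_on_open_UN)
  fix E assume E: "E \<in> Th"
  interpret T: reference_map "TK E" by (rule reference_map[OF E])
  show "open (TK E ` box 0 1)" by (rule T.open_cell)
  obtain G where G: "continuous_on (cbox 0 1) G" "\<And>x. x \<in> box 0 1 \<Longrightarrow> vgrad v (TK E x) = G x"
    using vgrad_cell[OF assms E] by auto
  have sub: "TK E ` box 0 1 \<subseteq> TK E ` cbox 0 1" using box_subset_cbox by blast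
  have "continuous_on (TK E ` box 0 1) (\<lambda>y. G (T.inverse_map y))"
    by (rule continuous_on_compose2[OF G(1) continuous_on_subset[OF T.continuous_inverse_map sub]])
      (use T.inverse_map box_subset_cbox in \<open>force simp: subset_iff\<close>)
  then show "continuous_on (TK E ` box 0 1) (vgrad v)"
    by (rule continuous_on_eq) (use T.inverse_map G(2) box_subset_cbox in \<open>force simp: subset_iff\<close>)
qed

lemma vgrad_bounded:
  assumes "piecewise_C1 v"
  shows "bounded (vgrad v ` open_cells)"
proof -
  have "bounded (vgrad v ` TK E ` box 0 1)" if E: "E \<in> Th" for E
  proof -
    obtain G where G: "continuous_on (cbox 0 1) G" "\<And>x. x \<in> box 0 1 \<Longrightarrow> vgrad v (TK E x) = G x"
      using vgrad_cell[OF assms E] by auto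
    have "vgrad v ` TK E ` box 0 1 \<subseteq> G ` cbox 0 1"
      using G(2) box_subset_cbox by (force simp: subset_iff)
    then show ?thesis
      by (rule bounded_subset[OF compact_imp_bounded[OF compact_continuous_image[OF G(1) compact_cbox]]])
  qed
  then show ?thesis unfolding open_cells_def image_UN by (intro bounded_UN finite_mesh ballI)
qed

lemma vgrad_L2:
  assumes "piecewise_C1 v"
  shows "vgrad v \<in> L2 \<Omega>"
proof -
  obtain C where C: "\<And>y. y \<in> open_cells \<Longrightarrow> norm (vgrad v y) \<le> C"
    using vgrad_bounded[OF assms] by (auto simp: bounded_iff)
  have "(\<lambda>x. indicator open_cells x *\<^sub>R vgrad v x) \<in> borel_measurable borel"
    by (rule borel_measurable_continuous_on_indicator[OF _ vgrad_continuous_on[OF assms]])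
      (simp add: open_open_cells)
  then have "(\<lambda>x. indicator open_cells x *\<^sub>R vgrad v x) \<in> borel_measurable (lebesgue_on \<Omega>)"
    by (intro measurable_restrict_space1 measurable_completion) simp
  moreover have "AE x in lebesgue_on \<Omega>. indicator open_cells x *\<^sub>R vgrad v x = vgrad v x"
    using AE_open_cells by eventually_elim simp
  ultimately have "vgrad v \<in> borel_measurable (lebesgue_on \<Omega>)"
    by (rule borel_measurable_lebesgue_on_AE[OF domain_sets])
  moreover have "AE x in lebesgue_on \<Omega>. norm (vgrad v x) \<le> C"
    using AE_open_cells by eventually_elim (rule C)
  ultimately show ?thesis by (rule L2_I_bounded[OF domain_lmeasurable])
qed

lemma L2_operator_vgrad:
  assumes "(\<lambda>_. 0) \<in> X" "\<And>f g c. f \<in> X \<Longrightarrow> g \<in> X \<Longrightarrow> (\<lambda>x. f x + c *\<^sub>R g x) \<in> X"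
    and pc: "\<And>f. f \<in> X \<Longrightarrow> piecewise_C1 f"
  shows "L2_operator \<Omega> X vgrad"
proof
  fix f g c assume fg: "f \<in> X" "g \<in> X"
  show "(\<lambda>x. f x + c *\<^sub>R g x) \<in> X" using assms(2) fg by blast
  show "vgrad f \<in> L2 \<Omega>" using vgrad_L2 pc fg by blast
  show "AE x in lebesgue_on \<Omega>. vgrad (\<lambda>x. f x + c *\<^sub>R g x) x = vgrad f x + c *\<^sub>R vgrad g x"
    using AE_open_cells by eventually_elim (rule vgrad_lin[OF pc[OF fg(1)] pc[OF fg(2)]])
qed (rule assms(1))

end

section \<open>Vanishing of finite element functions with vanishing strain\<close>

text \<open>The library states Sard's lemma for well-ordered index types only; \<open>'m\<close> is such a type of the
  same cardinality.\<close>

lemma negligible_image_degenerate_transfer: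
  fixes F :: "real^'d::finite \<Rightarrow> real^'d"
  assumes card: "CARD('d) = CARD('m::{finite,wellorder})"
    and F: "\<And>x. x \<in> S \<Longrightarrow> (F has_derivative F' x) (at x)"
    and ker: "\<And>x. x \<in> S \<Longrightarrow> \<exists>h. h \<noteq> 0 \<and> F' x h = 0"
  shows "negligible (F ` S)"
proof -
  obtain \<sigma> :: "'m::{finite,wellorder} \<Rightarrow> 'd" where \<sigma>: "bij \<sigma>"
    using card finite_same_card_bij[of "UNIV :: 'm::{finite,wellorder} set" "UNIV :: 'd set"] by auto
  define a :: "real^'d \<Rightarrow> real^('m::{finite,wellorder})" where "a x = (\<chi> i. x $ \<sigma> i)" for x
  define b :: "real^('m::{finite,wellorder}) \<Rightarrow> real^'d" where "b y = (\<chi> j. y $ inv \<sigma> j)" for y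
  have ab: "a (b y) = y" "b (a x) = x" for x y
    using \<sigma> by (auto simp: a_def b_def vec_eq_iff bij_is_inj bij_is_surj surj_f_inv_f inv_f_f)
  have linear_a: "linear a" by (rule linearI) (auto simp: a_def vec_eq_iff)
  have linear_b: "linear b" by (rule linearI) (auto simp: b_def vec_eq_iff)
  have bl: "bounded_linear a" "bounded_linear b"
    using linear_a linear_b by (simp_all add: linear_conv_bounded_linear)
  have "negligible ((a \<circ> F \<circ> b) ` a ` S)"
  proof (rule baby_Sard)
    fix y assume "y \<in> a ` S"
    then obtain x where x: "x \<in> S" "y = a x" by auto
    have "(F has_derivative F' x) (at (b y))" using F x ab by simp
    then have d: "((\<lambda>y. a (F (b y))) has_derivative (\<lambda>h. a (F' x (b h)))) (at y)"
      using bounded_linear.has_derivative[OF bl(1)] has_derivative_compose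
        bounded_linear_imp_has_derivative[OF bl(2)] by blast
    have xe: "F' (b y) = F' x" using x ab by simp
    show "(a \<circ> F \<circ> b has_derivative (\<lambda>h. a (F' (b y) (b h)))) (at y within a ` S)"
      using d unfolding xe o_def by (rule has_derivative_at_withinI)
    have lin: "linear (\<lambda>h. a (F' x (b h)))" using d by (rule has_derivative_linear)
    obtain h where h: "h \<noteq> 0" "F' x h = 0" using ker x by blast
    have "a h \<noteq> 0" using h ab(2)[of h] linear_0[OF linear_b] by metis
    moreover have "(\<lambda>h. a (F' x (b h))) (a h) = 0" using h ab linear_0[OF linear_a] by simp
    ultimately have "\<not> inj (\<lambda>h. a (F' x (b h)))"
      using linear_injective_0[OF lin] by blast
    then show "rank (matrix (\<lambda>h. a (F' (b y) (b h)))) < CARD('m::{finite,wellorder})"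
      unfolding xe less_rank_noninjective using matrix_vector_mul(2)[OF lin] by simp
  qed simp
  moreover have "(a \<circ> F \<circ> b) ` a ` S = a ` F ` S" using ab by (auto simp: image_image)
  ultimately have n: "negligible (a ` F ` S)" by simp
  have "negligible (b ` a ` F ` S)"
    by (rule negligible_differentiable_image_negligible[OF _ n bounded_linear_imp_differentiable_on[OF bl(2)]])
      (use card in simp)
  moreover have "b ` a ` F ` S = F ` S" by (simp add: image_image ab)
  ultimately show ?thesis by simp
qed

text \<open>The numeral types \<open>2\<close> and \<open>3\<close> are well-ordered and serve as
  the auxiliary index type.\<close>

lemma negligible_image_degenerate:
  fixes F :: "real^'d::finite \<Rightarrow> real^'d"
  assumes "CARD('d) = 2 \<or> CARD('d) = 3"
    and "\<And>x. x \<in> S \<Longrightarrow> (F has_derivative F' x) (at x)"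
    and "\<And>x. x \<in> S \<Longrightarrow> \<exists>h. h \<noteq> 0 \<and> F' x h = 0"
  shows "negligible (F ` S)"
  using assms(1)
proof
  assume "CARD('d) = 2"
  then show ?thesis
    using negligible_image_degenerate_transfer[where 'm = 2, OF _ assms(2,3)] by simp
next
  assume "CARD('d) = 3"
  then show ?thesis
    using negligible_image_degenerate_transfer[where 'm = 3, OF _ assms(2,3)] by simp
qed

text \<open>Where \<open>w\<close> is differentiable, the Jacobian of this map is the identity with
  row \<open>i\<close> replaced by the gradient of \<open>w\<close>. Its determinant is the
  \<open>i\<close>-th partial derivative of \<open>w\<close>, so the map degenerates exactly where
  that derivative vanishes.\<close>

definition replace_component :: "'d \<Rightarrow> (real^'d::finite \<Rightarrow> real) \<Rightarrow> real^'d \<Rightarrow> real^'d" where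
  "replace_component i w y = (\<chi> j. if j = i then w y else y $ j)"

text \<open>By the intermediate value theorem along the lines in direction \<open>i\<close> through the points near \<open>x0\<close>,
  the image contains an open box.\<close>

lemma replace_component_image_not_negligible:
  fixes w :: "real^'d::finite \<Rightarrow> real"
  assumes w: "continuous_on UNIV w" and S: "bounded {y. w y \<noteq> 0}" and x0: "0 < w x0"
  shows "\<not> negligible (replace_component i w ` {y. w y \<noteq> 0})"
proof -
  obtain R where R: "\<And>y. w y \<noteq> 0 \<Longrightarrow> norm y \<le> R"
    using S by (auto simp: bounded_iff)
  have "isCont w x0" using w by (simp add: continuous_on_eq_continuous_at)
  then obtain \<delta> where \<delta>: "0 < \<delta>" "\<And>y. dist y x0 < \<delta> \<Longrightarrow> dist (w y) (w x0) < w x0 / 2"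
    using x0 unfolding continuous_at_eps_delta by (metis half_gt_zero)
  \<comment> \<open>Moving every coordinate by at most \<open>\<eta>\<close> keeps the sum of the
    displacements at most \<open>CARD('d) * \<eta> = \<delta> / 2\<close>.\<close>
  define \<eta> where "\<eta> = \<delta> / (2 * CARD('d))"
  have \<eta>: "0 < \<eta>" using \<delta>(1) by (simp add: \<eta>_def)
  \<comment> \<open>The \<open>i\<close>-th coordinate runs through the values between 0 and
    \<open>w x0 / 2\<close>: on each line in direction \<open>i\<close> near \<open>x0\<close>,
    \<open>w\<close> exceeds the upper one and vanishes far away, so it takes them all. Excluding 0
    keeps the preimages in the support.\<close>
  define lo hi :: "real^'d" where "lo = (\<chi> j. if j = i then 0 else x0 $ j - \<eta>)"
    and "hi = (\<chi> j. if j = i then w x0 / 2 else x0 $ j + \<eta>)"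
  have "box lo hi \<subseteq> replace_component i w ` {y. w y \<noteq> 0}"
  proof
    fix y assume "y \<in> box lo hi"
    then have lh: "lo $ j < y $ j \<and> y $ j < hi $ j" for j by (simp add: mem_box_cart)
    have y: "0 < y $ i" "y $ i < w x0 / 2"
      using lh[of i] by (auto simp: lo_def hi_def)
    have y3: "\<bar>y $ j - x0 $ j\<bar> < \<eta>" if "j \<noteq> i" for j
      using lh[of j] that by (auto simp: lo_def hi_def abs_less_iff)
    define q where "q s = replace_component i (\<lambda>_. s) y" for s
    have "norm (q (x0 $ i) - x0) \<le> (\<Sum>j\<in>UNIV. \<bar>(q (x0 $ i) - x0) $ j\<bar>)"
      by (rule norm_le_l1_cart)
    also have "\<dots> \<le> (\<Sum>j\<in>(UNIV::'d set). \<eta>)"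
      using y3 \<eta> by (intro sum_mono) (auto simp: q_def replace_component_def less_imp_le)
    also have "\<dots> < \<delta>" using \<delta>(1) by (simp add: \<eta>_def)
    finally have "dist (w (q (x0 $ i))) (w x0) < w x0 / 2" by (intro \<delta>) (simp add: dist_norm)
    then have top: "w x0 / 2 < w (q (x0 $ i))" unfolding dist_real_def by linarith
    \<comment> \<open>Far enough in direction \<open>i\<close> to leave the ball of radius
      \<open>R\<close> that contains the support.\<close>
    define s1 where "s1 = \<bar>x0 $ i\<bar> + \<bar>R\<bar> + 1"
    have "s1 \<le> norm (q s1)"
      using component_le_norm_cart[of "q s1" i] by (simp add: q_def replace_component_def)
    then have bot: "w (q s1) = 0" using R[of "q s1"] unfolding s1_def by linarith
    have "continuous_on UNIV q"
      unfolding q_def replace_component_def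
    proof (intro continuous_on_vec_lambda)
      show "continuous_on UNIV (\<lambda>s::real. if j = i then s else y $ j)" for j
        by (cases "j = i") auto
    qed
    then have "continuous_on {x0 $ i..s1} (\<lambda>s. w (q s))"
      by (intro continuous_on_compose2[OF w]) (auto intro: continuous_on_subset)
    moreover have "x0 $ i \<le> s1" unfolding s1_def by linarith
    ultimately obtain s where s: "w (q s) = y $ i"
      using IVT2'[of "\<lambda>s. w (q s)" s1 "y $ i" "x0 $ i"] y top bot by auto
    have "replace_component i w (q s) = y"
      using s by (auto simp: vec_eq_iff q_def replace_component_def)
    then show "y \<in> replace_component i w ` {y. w y \<noteq> 0}"
      using s y(1) by (intro image_eqI[of _ _ "q s"]) auto
  qed
  moreover have "box lo hi \<noteq> {}"
    using x0 \<eta> by (simp add: interval_ne_empty_cart lo_def hi_def)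
  ultimately show ?thesis using negligible_interval(2) negligible_subset by blast
qed

context fe_mesh
begin

text \<open>If \<open>z $ i\<close> were positive somewhere, the image of the support of its zero
  extension \<open>w\<close> under \<open>replace_component i w\<close> would contain a box. That
  image is null, however: the map degenerates where the \<open>i\<close>-th derivative vanishes, and
  the remaining points form null sets whose images are null by differentiability. Applied to
  \<open>z\<close> and \<open>- z\<close>, the one-sided bound gives zero.\<close>

lemma H_space_component_nonpos:
  assumes dim: "CARD('d) = 2 \<or> CARD('d) = 3" and z: "z \<in> H_space \<Omega> Th TK m"
    and pc: "piecewise_C1 z"
    and ae: "AE x in lebesgue_on \<Omega>. vgrad z x $ i $ i = 0"
    and x: "x \<in> closure \<Omega>"
  shows "z x $ i \<le> 0"
proof (rule ccontr)
  assume "\<not> z x $ i \<le> 0"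
  define w where "w y = (if y \<in> closure \<Omega> then z y $ i else 0)" for y
  have zc: "continuous_on (closure \<Omega>) z" and z0: "\<And>y. y \<in> frontier \<Omega> \<Longrightarrow> z y = 0"
    using z by (auto simp: H_space_def)
  \<comment> \<open>The two closed sets overlap in the frontier only, where \<open>z\<close>
    vanishes, so the extension by zero is continuous.\<close>
  have "continuous_on (closure \<Omega> \<union> - \<Omega>) w"
    unfolding w_def
  proof (rule continuous_on_cases)
    show "\<forall>y. y \<in> closure \<Omega> \<and> y \<notin> closure \<Omega> \<or> y \<in> - \<Omega> \<and> y \<in> closure \<Omega> \<longrightarrow> z y $ i = 0"
      using z0 open_domain by (auto simp: frontier_def interior_open)
  qed (use open_domain in \<open>auto intro!: continuous_intros zc\<close>)
  moreover have "closure \<Omega> \<union> - \<Omega> = UNIV" using closure_subset by auto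
  ultimately have w: "continuous_on UNIV w" by simp
  have supp: "y \<in> \<Omega>" if "w y \<noteq> 0" for y
    using that z0[of y] open_domain by (cases "y \<in> \<Omega>") (auto simp: w_def frontier_def interior_open split: if_splits)
  let ?G = "replace_component i w" and ?S = "{y. w y \<noteq> 0}"
  have "bounded ?S" by (rule bounded_subset[OF bounded_domain]) (use supp in auto)
  then have "\<not> negligible (?G ` ?S)"
    using \<open>\<not> z x $ i \<le> 0\<close> x by (intro replace_component_image_not_negligible[OF w, of x]) (auto simp: w_def)
  moreover have "negligible (?G ` ?S)"
  proof -
    let ?N = "{y \<in> \<Omega>. \<not> vgrad z y $ i $ i = 0}"
    let ?A = "{y \<in> open_cells. vgrad z y $ i $ i = 0}"
    let ?B = "\<lambda>E. TK E ` (cbox 0 1 - box 0 1)"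
    have G': "(?G has_derivative (\<lambda>h. \<chi> j. if j = i then (vgrad z y *v h) $ i else h $ j)) (at y)"
      if y: "y \<in> open_cells" for y
    proof -
      have zd: "((\<lambda>y. z y $ i) has_derivative (\<lambda>h. (vgrad z y *v h) $ i)) (at y)"
        by (rule bounded_linear.has_derivative[OF bounded_linear_vec_nth piecewise_C1_has_derivative[OF pc y]])
      have wd: "(w has_derivative (\<lambda>h. (vgrad z y *v h) $ i)) (at y)"
        by (rule has_derivative_transform_within_open[OF zd open_open_cells y])
          (use open_cells_subset in \<open>auto simp: w_def\<close>)
      show ?thesis
      proof (subst has_derivative_componentwise_within, intro ballI)
        fix b :: "real^'d" assume "b \<in> Basis"
        then obtain j where b: "b = axis j 1" by (auto simp: Basis_vec_def)
        have "((\<lambda>y. y $ j) has_derivative (\<lambda>h. h $ j)) (at y)"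
          by (rule bounded_linear_imp_has_derivative[OF bounded_linear_vec_nth])
        then show "((\<lambda>y. ?G y \<bullet> b) has_derivative
            (\<lambda>h. (\<chi> j. if j = i then (vgrad z y *v h) $ i else h $ j) \<bullet> b)) (at y)"
          using wd by (cases "j = i") (simp_all add: b inner_axis replace_component_def)
      qed
    qed
    have "?S \<subseteq> (\<Union>E\<in>Th. ?B E) \<union> (?N \<inter> open_cells) \<union> ?A"
    proof
      fix y assume "y \<in> ?S"
      then have y: "y \<in> \<Omega>" using supp by simp
      then have "y \<in> \<Union>Th" using mesh_covers closure_subset by auto
      then obtain E x where E: "E \<in> Th" "y = TK E x" "x \<in> cbox 0 1" using cell_image by blast
      show "y \<in> (\<Union>E\<in>Th. ?B E) \<union> (?N \<inter> open_cells) \<union> ?A"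
        using y E by (cases "x \<in> box 0 1") (auto simp: open_cells_def)
    qed
    then have sub: "?G ` ?S \<subseteq> (\<Union>E\<in>Th. ?G ` ?B E) \<union> ?G ` (?N \<inter> open_cells) \<union> ?G ` ?A"
      unfolding image_Un[symmetric] image_UN[symmetric] by (rule image_mono)
    have "negligible (?G ` ?B E)" if E: "E \<in> Th" for E
    proof -
      interpret T: reference_map "TK E" by (rule reference_map[OF E])
      obtain g where g: "\<And>j. (\<lambda>x. g x $ j) \<in> Q_poly m" "\<And>x. x \<in> cbox 0 1 \<Longrightarrow> z (TK E x) = g x"
      proof -
        have "\<exists>g. (\<forall>j. (\<lambda>x. g x $ j) \<in> Q_poly m) \<and> (\<forall>x\<in>cbox 0 1. z (TK E x) = g x)"
          using z E by (simp add: H_space_def)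
        then show ?thesis using that by blast
      qed
      \<comment> \<open>On a cell boundary \<open>w\<close> itself may fail to be differentiable.
        The polynomial map \<open>F\<close> agrees with \<open>?G\<close> composed with
        \<open>TK E\<close> on the closed cube, and it sends the boundary of the cube to a null
        set.\<close>
      define F where "F x = (\<chi> j. if j = i then g x $ i else TK E x $ j)" for x
      have "real_polynomial_function (\<lambda>x. F x $ j)" for j
        using tensor_poly_real_polynomial_function[OF g(1)[of i]] T.polynomial[of j] by (cases "j = i") (simp_all add: F_def)
      then have "F differentiable (at x)" for x by (rule polynomial_map_jacobian(1))
      then have "negligible (F ` (cbox 0 1 - box 0 1))"
        by (intro negligible_differentiable_image_negligible[OF order_refl negligible_frontier_interval])
          (auto simp: differentiable_on_def intro: differentiable_at_withinI)
      moreover have "?G ` ?B E = F ` (cbox 0 1 - box 0 1)"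
        unfolding image_image
      proof (intro image_cong refl)
        fix x :: "real^'d" assume x: "x \<in> cbox 0 1 - box 0 1"
        then have "TK E x \<in> closure \<Omega>" using cell_subset[OF E] by auto
        then show "?G (TK E x) = F x"
          using x g(2)[of x] by (auto simp: replace_component_def w_def F_def)
      qed
      ultimately show ?thesis by simp
    qed
    then have n1: "negligible (\<Union>E\<in>Th. ?G ` ?B E)" using finite_mesh by (intro negligible_Union) auto
    have "negligible ?N" using ae by (simp add: AE_domain_iff)
    then have "negligible (?N \<inter> open_cells)" by (rule negligible_subset) auto
    then have n2: "negligible (?G ` (?N \<inter> open_cells))"
      by (rule negligible_differentiable_image_negligible[OF order_refl])
        (use G' in \<open>auto simp: differentiable_on_def differentiable_def intro: has_derivative_at_withinI\<close>)
    have n3: "negligible (?G ` ?A)"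
    proof (rule negligible_image_degenerate[OF dim])
      fix y assume y: "y \<in> ?A"
      then show "(?G has_derivative (\<lambda>h. \<chi> j. if j = i then (vgrad z y *v h) $ i else h $ j)) (at y)"
        by (intro G') simp
      have "(vgrad z y *v axis i 1) $ i = 0"
        using y by (simp add: matrix_vector_mul_component inner_axis)
      then show "\<exists>h. h \<noteq> 0 \<and> (\<chi> j. if j = i then (vgrad z y *v h) $ i else h $ j) = 0"
        by (intro exI[of _ "axis i 1"]) (auto simp: vec_eq_iff axis_def)
    qed
    show ?thesis using negligible_subset[OF _ sub] n1 n2 n3 by (simp add: negligible_Un)
  qed
  ultimately show False by simp
qed

end

section \<open>The discrete spaces\<close>

lemma continuous_on_closure_L2:
  fixes f :: "real^'d::finite \<Rightarrow> 'b::euclidean_space"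
  assumes "open \<Omega>" "bounded \<Omega>" "continuous_on (closure \<Omega>) f"
  shows "f \<in> L2 \<Omega>"
proof -
  have lm: "\<Omega> \<in> lmeasurable" by (rule lmeasurable_open[OF assms(2,1)])
  have "compact (f ` closure \<Omega>)" using assms by (intro compact_continuous_image) (simp_all add: compact_closure)
  then have "bounded (f ` closure \<Omega>)" by (rule compact_imp_bounded)
  then obtain C where C: "\<And>y. y \<in> closure \<Omega> \<Longrightarrow> norm (f y) \<le> C"
    by (auto simp: bounded_iff)
  have "f \<in> borel_measurable (lebesgue_on \<Omega>)"
    by (rule continuous_imp_measurable_on_sets_lebesgue[OF continuous_on_subset[OF assms(3) closure_subset] fmeasurableD[OF lm]])
  moreover have "AE x in lebesgue_on \<Omega>. norm (f x) \<le> C"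
    using closure_subset[of \<Omega>] by (intro AE_I2 C) auto
  ultimately show ?thesis by (rule L2_I_bounded[OF lm])
qed

lemma test_functions_L2:
  assumes "\<phi> \<in> test_functions \<Omega>" "open \<Omega>" "bounded \<Omega>"
  shows "grad \<phi> \<in> L2 \<Omega>" "\<phi> \<in> L2 \<Omega>"
proof -
  have C: "C_k m \<phi>" for m using assms(1) by (simp add: test_functions_def)
  have "(\<lambda>x. frechet_derivative \<phi> (at x) (axis i 1)) differentiable_on UNIV" for i
    using C[of "Suc (Suc 0)"] by auto
  then have "continuous_on UNIV (\<lambda>x. \<chi> i. frechet_derivative \<phi> (at x) (axis i 1))"
    by (intro continuous_on_vec_lambda differentiable_imp_continuous_on)
  then have "continuous_on UNIV (grad \<phi>)" by (simp add: grad_def[abs_def])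
  then show "grad \<phi> \<in> L2 \<Omega>"
    by (intro continuous_on_closure_L2 assms) (rule continuous_on_subset, auto)
  show "\<phi> \<in> L2 \<Omega>" using C[of 0]
    by (intro continuous_on_closure_L2 assms) (rule continuous_on_subset, auto)
qed

lemma Hdiv_lin:
  assumes "open \<Omega>" "bounded \<Omega>" "f \<in> Hdiv \<Omega>" "g \<in> Hdiv \<Omega>"
  shows "(\<lambda>x. f x + c *\<^sub>R g x) \<in> Hdiv \<Omega>"
proof -
  obtain df dg where d: "df \<in> L2 \<Omega>" "has_weak_divergence \<Omega> f df" "dg \<in> L2 \<Omega>" "has_weak_divergence \<Omega> g dg"
    using assms by (auto simp: Hdiv_def)
  have fg: "f \<in> L2 \<Omega>" "g \<in> L2 \<Omega>" using assms by (auto simp: Hdiv_def)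
  have "has_weak_divergence \<Omega> (\<lambda>x. f x + c *\<^sub>R g x) (\<lambda>x. df x + c *\<^sub>R dg x)"
    unfolding has_weak_divergence_def
  proof
    fix \<phi> assume \<phi>: "\<phi> \<in> test_functions \<Omega>"
    note L = test_functions_L2[OF \<phi> assms(1,2)]
    have "L2_inner \<Omega> f (grad \<phi>) = - L2_inner \<Omega> df \<phi>" "L2_inner \<Omega> g (grad \<phi>) = - L2_inner \<Omega> dg \<phi>"
      using d(2,4) \<phi> by (auto simp: has_weak_divergence_def)
    then show "L2_inner \<Omega> (\<lambda>x. f x + c *\<^sub>R g x) (grad \<phi>) = - L2_inner \<Omega> (\<lambda>x. df x + c *\<^sub>R dg x) \<phi>"
      using psd_form.lin[OF psd_form_L2 fg L(1), of c] psd_form.lin[OF psd_form_L2 d(1,3) L(2), of c]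
      by simp
  qed
  moreover have "(\<lambda>x. df x + c *\<^sub>R dg x) \<in> L2 \<Omega>" using d(1,3) by (rule L2_lin_mem)
  ultimately show ?thesis using L2_lin_mem[OF fg] unfolding Hdiv_def by blast
qed

lemma tensor_poly_mono:
  assumes "\<And>i. m i \<le> m' i"
  shows "tensor_poly m \<subseteq> tensor_poly m'"
proof
  fix g assume "g \<in> tensor_poly m"
  then obtain c where c: "\<And>x. g x = (\<Sum>\<alpha> | \<forall>i. \<alpha> i \<le> m i. c \<alpha> * (\<Prod>i\<in>UNIV. vec_nth x i ^ \<alpha> i))"
    by (auto simp: tensor_poly_def)
  have "g x = (\<Sum>\<alpha> | \<forall>i. \<alpha> i \<le> m' i. (if \<forall>i. \<alpha> i \<le> m i then c \<alpha> else 0) * (\<Prod>i\<in>UNIV. vec_nth x i ^ \<alpha> i))" for x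
    unfolding c using assms order_trans
    by (intro sum.mono_neutral_cong_left finite_multi_indices) (auto intro: order_trans)
  then show "g \<in> tensor_poly m'"
    unfolding tensor_poly_def by (intro CollectI exI[of _ "\<lambda>\<alpha>. if \<forall>i. \<alpha> i \<le> m i then c \<alpha> else 0"] allI)
qed

text \<open>This supplies the hypothesis \<open>rep\<close> of \<open>psd_form_dominated\<close>.
  Points are given as pairs of a cell and a reference point, so a point shared by several cells
  causes no conflict; a generator is indexed by a cell, a monomial and a component. The matrix
  \<open>A\<close> is the identity for displacements and the Piola factor for fluxes.\<close>

lemma cellwise_polynomial_representation:
  fixes f :: "real^'d::finite \<Rightarrow> real^'d" and TK :: "'e \<Rightarrow> real^'d \<Rightarrow> real^'d"
    and A :: "'e \<Rightarrow> real^'d \<Rightarrow> real^'d^'d"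
  assumes fin: "finite Th"
    and f: "\<forall>E\<in>Th. \<exists>g. (\<forall>i. (\<lambda>x. g x $ i) \<in> Q_poly m) \<and> (\<forall>x\<in>C. f (TK E x) = A E x *v g x)"
  shows "\<exists>c. \<forall>y\<in>Th \<times> C. f (case y of (E, x) \<Rightarrow> TK E x) =
    (\<Sum>j \<in> Th \<times> {\<alpha>. \<forall>i. \<alpha> i \<le> m} \<times> (UNIV :: 'd set). c j *\<^sub>R
      (case j of (E', \<alpha>, i) \<Rightarrow> case y of (E, x) \<Rightarrow>
        if E' = E then A E x *v ((\<Prod>l\<in>UNIV. x $ l ^ \<alpha> l) *\<^sub>R axis i 1) else 0))"
proof -
  obtain G where G: "\<And>E i. E \<in> Th \<Longrightarrow> (\<lambda>x. G E x $ i) \<in> Q_poly m"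
    "\<And>E x. E \<in> Th \<Longrightarrow> x \<in> C \<Longrightarrow> f (TK E x) = A E x *v G E x"
    using bchoice[OF f] by auto
  let ?mono = "\<lambda>x \<alpha>. \<Prod>l\<in>UNIV. x $ l ^ \<alpha> l" and ?I = "{\<alpha>. \<forall>i::'d. \<alpha> i \<le> m}"
  have "\<forall>p\<in>Th \<times> UNIV. \<exists>c. \<forall>x. G (fst p) x $ snd p = (\<Sum>\<alpha>\<in>?I. c \<alpha> * ?mono x \<alpha>)"
    using G(1) by (auto simp: tensor_poly_def)
  from bchoice[OF this] obtain c where c: "\<And>E i x. E \<in> Th \<Longrightarrow> G E x $ i = (\<Sum>\<alpha>\<in>?I. c (E, i) \<alpha> * ?mono x \<alpha>)"
    by auto
  show ?thesis
  proof (intro exI[of _ "\<lambda>(E, \<alpha>, i). c (E, i) \<alpha>"] ballI)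
    fix y assume "y \<in> Th \<times> C"
    then obtain E x where y: "y = (E, x)" "E \<in> Th" "x \<in> C" by auto
    have "(\<Sum>j \<in> Th \<times> ?I \<times> (UNIV :: 'd set). (case j of (E, \<alpha>, i) \<Rightarrow> c (E, i) \<alpha>) *\<^sub>R
        (case j of (E', \<alpha>, i) \<Rightarrow> case y of (E, x) \<Rightarrow>
        if E' = E then A E x *v (?mono x \<alpha> *\<^sub>R axis i 1) else 0))
      = (\<Sum>E'\<in>Th. \<Sum>\<alpha>\<in>?I. \<Sum>i\<in>UNIV. if E' = E then c (E', i) \<alpha> *\<^sub>R (A E x *v (?mono x \<alpha> *\<^sub>R axis i 1)) else 0)"
      by (simp add: sum.cartesian_product y(1) case_prod_unfold) (intro sum.cong refl, auto)
    also have "\<dots> = (\<Sum>E'\<in>Th. if E' = E then \<Sum>\<alpha>\<in>?I. \<Sum>i\<in>UNIV. c (E, i) \<alpha> *\<^sub>R (A E x *v (?mono x \<alpha> *\<^sub>R axis i 1)) else 0)"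
      by (intro sum.cong refl) simp
    also have "\<dots> = (\<Sum>\<alpha>\<in>?I. \<Sum>i\<in>UNIV. c (E, i) \<alpha> *\<^sub>R (A E x *v (?mono x \<alpha> *\<^sub>R axis i 1)))"
      using fin y(2) by simp
    also have "\<dots> = A E x *v (\<Sum>\<alpha>\<in>?I. \<Sum>i\<in>UNIV. (c (E, i) \<alpha> * ?mono x \<alpha>) *\<^sub>R axis i 1)"
      by (simp add: linear_sum[OF matrix_vector_mul_linear] matrix_vector_mult_scaleR)
    also have "(\<Sum>\<alpha>\<in>?I. \<Sum>i\<in>UNIV. (c (E, i) \<alpha> * ?mono x \<alpha>) *\<^sub>R axis i 1) = G E x"
      by (subst sum.swap) (simp add: vec_eq_iff c[OF y(2)] axis_def if_distrib sum.delta cong: if_cong flip: scaleR_sum_left)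
    finally show "f (case y of (E, x) \<Rightarrow> TK E x) = (\<Sum>j \<in> Th \<times> ?I \<times> (UNIV :: 'd set). (case j of (E, \<alpha>, i) \<Rightarrow> c (E, i) \<alpha>) *\<^sub>R
        (case j of (E', \<alpha>, i) \<Rightarrow> case y of (E, x) \<Rightarrow>
        if E' = E then A E x *v (?mono x \<alpha> *\<^sub>R axis i 1) else 0))"
      using G(2)[OF y(2,3)] y(1) by simp
  qed
qed

lemma tensor_poly_lin_vec:
  assumes "\<forall>i. (\<lambda>x. f x $ i) \<in> tensor_poly (m i)" "\<forall>i. (\<lambda>x. g x $ i) \<in> tensor_poly (m i)"
  shows "\<forall>i. (\<lambda>x. (f x + c *\<^sub>R g x) $ i) \<in> tensor_poly (m i)"
proof
  fix i
  show "(\<lambda>x. (f x + c *\<^sub>R g x) $ i) \<in> tensor_poly (m i)"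
    using tensor_poly_lin[OF assms(1)[rule_format, of i] assms(2)[rule_format, of i], of c] by simp
qed

text \<open>Continuity spreads \<open>v y \<noteq> 0\<close> to a neighbourhood of \<open>y\<close>.
  The point \<open>y\<close> may lie outside \<open>\<Omega>\<close>, but a nonempty open subset of
  \<open>closure \<Omega>\<close> meets \<open>\<Omega>\<close> in a nonempty open set, which is not
  negligible.\<close>

lemma continuous_AE_zero:
  fixes v :: "real^'d::finite \<Rightarrow> 'b::real_normed_vector"
  assumes cont: "isCont v y" and U: "open U" "y \<in> U" "U \<subseteq> closure \<Omega>" and \<Omega>: "open \<Omega>"
    and null: "negligible {x \<in> \<Omega>. v x \<noteq> 0}"
  shows "v y = 0"
proof (rule ccontr)
  assume "v y \<noteq> 0"
  then have "\<forall>\<^sub>F x in at y. v x \<noteq> 0"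
    using cont by (intro tendsto_imp_eventually_ne) (simp_all add: isCont_def)
  then obtain S where S: "open S" "y \<in> S" "\<forall>x\<in>S. x \<noteq> y \<longrightarrow> v x \<noteq> 0"
    unfolding eventually_at_topological by blast
  then have S': "v x \<noteq> 0" if "x \<in> S" for x
    using that \<open>v y \<noteq> 0\<close> by (cases "x = y") auto
  have "S \<inter> U \<inter> \<Omega> \<noteq> {}"
    using S U open_Int_closure_eq_empty[of "S \<inter> U" \<Omega>] by blast
  moreover have "open (S \<inter> U \<inter> \<Omega>)" using S U \<Omega> by auto
  moreover have "negligible (S \<inter> U \<inter> \<Omega>)" using null by (rule negligible_subset) (use S' in auto)
  ultimately show False using open_not_negligible by blast
qed

context fe_mesh
begin

subsection \<open>The scalar space\<close>

lemma W_L2: "w \<in> W_space \<Omega> Th TK s \<Longrightarrow> w \<in> L2 \<Omega>"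
  by (simp add: W_space_def)

lemma W_zero: "(\<lambda>_. 0) \<in> W_space \<Omega> Th TK s"
  by (auto simp: W_space_def L2_zero intro!: bexI[OF _ tensor_poly_zero])

lemma W_lin:
  assumes f: "f \<in> W_space \<Omega> Th TK s" and g: "g \<in> W_space \<Omega> Th TK s"
  shows "(\<lambda>x. f x + c *\<^sub>R g x) \<in> W_space \<Omega> Th TK s"
proof -
  have "\<exists>h\<in>Q_poly s. \<forall>x\<in>box 0 1. f (TK E x) + c *\<^sub>R g (TK E x) = h x" if E: "E \<in> Th" for E
  proof -
    obtain f' where f': "f' \<in> Q_poly s" "\<forall>x\<in>box 0 1. f (TK E x) = f' x" using f E by (auto simp: W_space_def)
    obtain g' where g': "g' \<in> Q_poly s" "\<forall>x\<in>box 0 1. g (TK E x) = g' x" using g E by (auto simp: W_space_def)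
    show ?thesis using f' g' by (intro bexI[OF _ tensor_poly_lin[OF f'(1) g'(1), of c]]) simp
  qed
  moreover have "(\<lambda>x. f x + c *\<^sub>R g x) \<in> L2 \<Omega>" using L2_lin_mem f g W_L2 by blast
  ultimately show ?thesis by (simp add: W_space_def)
qed

subsection \<open>The displacement space\<close>

lemma H_cell:
  assumes "z \<in> H_space \<Omega> Th TK m" "E \<in> Th"
  obtains g where "\<forall>i. (\<lambda>x. g x $ i) \<in> Q_poly m" "\<forall>x\<in>cbox 0 1. z (TK E x) = g x"
  using assms unfolding H_space_def by blast

lemma H_zero: "(\<lambda>_. 0) \<in> H_space \<Omega> Th TK m"
  by (auto simp: H_space_def tensor_poly_zero intro!: exI[of _ "\<lambda>_. 0"])

lemma H_lin:
  assumes f: "f \<in> H_space \<Omega> Th TK m" and g: "g \<in> H_space \<Omega> Th TK m"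
  shows "(\<lambda>x. f x + c *\<^sub>R g x) \<in> H_space \<Omega> Th TK m"
proof -
  have "\<exists>h. (\<forall>i. (\<lambda>x. h x $ i) \<in> Q_poly m) \<and> (\<forall>x\<in>cbox 0 1. f (TK E x) + c *\<^sub>R g (TK E x) = h x)" if E: "E \<in> Th" for E
  proof -
    obtain f' where f': "\<forall>i. (\<lambda>x. f' x $ i) \<in> Q_poly m" "\<forall>x\<in>cbox 0 1. f (TK E x) = f' x" by (rule H_cell[OF f E])
    obtain g' where g': "\<forall>i. (\<lambda>x. g' x $ i) \<in> Q_poly m" "\<forall>x\<in>cbox 0 1. g (TK E x) = g' x" by (rule H_cell[OF g E])
    show ?thesis
      using tensor_poly_lin_vec[OF f'(1) g'(1), of c] f'(2) g'(2)
      by (intro exI[of _ "\<lambda>x. f' x + c *\<^sub>R g' x"]) auto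
  qed
  moreover have "continuous_on (closure \<Omega>) (\<lambda>x. f x + c *\<^sub>R g x)"
    using f g by (auto simp: H_space_def intro!: continuous_intros)
  moreover have "\<forall>x\<in>frontier \<Omega>. f x + c *\<^sub>R g x = 0" using f g by (auto simp: H_space_def)
  ultimately show ?thesis by (simp add: H_space_def)
qed

lemma H_L2: "z \<in> H_space \<Omega> Th TK m \<Longrightarrow> z \<in> L2 \<Omega>"
  by (rule continuous_on_closure_L2[OF open_domain bounded_domain]) (simp add: H_space_def)

lemma H_piecewise_C1:
  assumes "z \<in> H_space \<Omega> Th TK m"
  shows "piecewise_C1 z"
  unfolding piecewise_C1_def
proof
  fix E assume E: "E \<in> Th"
  obtain g where g: "\<forall>i. (\<lambda>x. g x $ i) \<in> Q_poly m" "\<forall>x\<in>cbox 0 1. z (TK E x) = g x"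
    by (rule H_cell[OF assms E])
  have "C1_on (cbox 0 1) g"
    using g(1) by (intro C1_on_polynomial tensor_poly_real_polynomial_function[of _ "\<lambda>_. m"]) blast
  then show "\<exists>F. C1_on (cbox 0 1) F \<and> (\<forall>x\<in>box 0 1. z (TK E x) = F x)"
    using g(2) box_subset_cbox[of 0 "1::real^'d"] by blast
qed

lemma L2_operator_H: "L2_operator \<Omega> (H_space \<Omega> Th TK m) (\<lambda>z. z)"
proof
qed (rule H_zero H_lin H_L2 AE_I2 refl; assumption?)+

lemma L2_operator_vgrad_H: "L2_operator \<Omega> (H_space \<Omega> Th TK m) vgrad"
  by (rule L2_operator_vgrad) (rule H_zero H_lin H_piecewise_C1; assumption)+

lemma bounded_linear_trace: "bounded_linear (trace :: real^'n::finite^'n \<Rightarrow> real)"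
  by (intro linear_conv_bounded_linear[THEN iffD1] linearI)
    (simp_all add: trace_def sum.distrib sum_distrib_left)

lemma bounded_linear_symmetric_part:
  "bounded_linear (\<lambda>A :: real^'n::finite^'n. (1/2) *\<^sub>R (A + transpose A))"
  by (intro linear_conv_bounded_linear[THEN iffD1] linearI)
    (simp_all add: transpose_def vec_eq_iff algebra_simps)

lemma divergence_eq: "divergence = (\<lambda>v x. trace (vgrad v x))"
  by (simp add: fun_eq_iff divergence_def)

lemma strain_eq: "strain = (\<lambda>v x. (1/2) *\<^sub>R (vgrad v x + transpose (vgrad v x)))"
  by (simp add: fun_eq_iff strain_def)

lemma strain_diagonal: "strain v x $ i $ i = vgrad v x $ i $ i"
  by (simp add: strain_def transpose_def)

lemma L2_operator_divergence_H: "L2_operator \<Omega> (H_space \<Omega> Th TK m) divergence"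
  unfolding divergence_eq by (rule L2_operator.compose_bounded_linear[OF L2_operator_vgrad_H bounded_linear_trace])

lemma L2_operator_strain_H: "L2_operator \<Omega> (H_space \<Omega> Th TK m) strain"
  unfolding strain_eq by (rule L2_operator.compose_bounded_linear[OF L2_operator_vgrad_H bounded_linear_symmetric_part])

lemma vgrad_zero_on_open_cells:
  assumes "\<And>y. y \<in> open_cells \<Longrightarrow> v y = 0" "y \<in> open_cells"
  shows "vgrad v y = 0"
proof -
  have "(v has_derivative (\<lambda>h. 0 *v h)) (at y)"
    by (rule has_derivative_transform_within_open[OF _ open_open_cells assms(2), of "\<lambda>_. 0"])
      (use assms(1) in auto)
  then show ?thesis unfolding vgrad_def by (rule jacobian_eqI)
qed

text \<open>Only the diagonal of the strain is needed: \<open>\<partial>\<^sub>i z\<^sub>i = 0\<close> and \<open>z = 0\<close> on the boundary give \<open>z\<^sub>i = 0\<close>.\<close>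

lemma H_strain_zero:
  assumes dim: "CARD('d) = 2 \<or> CARD('d) = 3" and z: "z \<in> H_space \<Omega> Th TK m"
    and s: "L2_inner \<Omega> (strain z) (strain z) = 0" and y: "y \<in> closure \<Omega>"
  shows "z y = 0"
proof -
  \<comment> \<open>This is \<open>- z\<close>, which provides the lower bound for \<open>z\<close>.
    It is spelled as a combination with the zero function so that \<open>H_lin\<close> and the
    almost-everywhere linearity of \<open>vgrad\<close> apply as they stand.\<close>
  let ?z = "\<lambda>x. 0 + (-1) *\<^sub>R z x"
  have z': "?z \<in> H_space \<Omega> Th TK m" by (rule H_lin[OF H_zero z])
  have "AE x in lebesgue_on \<Omega>. strain z x = 0"
    by (rule L2_inner_self_eq_0[OF L2_operator.L2[OF L2_operator_strain_H z] s])
  then have ae: "AE x in lebesgue_on \<Omega>. vgrad z x $ i $ i = 0" for i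
    by eventually_elim (simp add: strain_diagonal[symmetric])
  have "AE x in lebesgue_on \<Omega>. vgrad ?z x = vgrad (\<lambda>_. 0) x + (-1) *\<^sub>R vgrad z x"
    by (rule L2_operator.lin[OF L2_operator_vgrad_H H_zero z])
  then have ae': "AE x in lebesgue_on \<Omega>. vgrad ?z x $ i $ i = 0" for i
    using ae[of i] AE_open_cells
    by eventually_elim (simp add: vgrad_zero_on_open_cells)
  have "z y $ i = 0" for i
    using H_space_component_nonpos[OF dim z H_piecewise_C1[OF z] ae y, of i]
      H_space_component_nonpos[OF dim z' H_piecewise_C1[OF z'] ae' y, of i] by simp
  then show ?thesis by (simp add: vec_eq_iff)
qed

lemma H1_form: "psd_form (H_space \<Omega> Th TK m) (\<lambda>f g. 1 * L2_inner \<Omega> f g + 1 * L2_inner \<Omega> (vgrad f) (vgrad g))"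
  by (rule psd_form_add[OF L2_operator.psd_form[OF L2_operator_H] L2_operator.psd_form[OF L2_operator_vgrad_H]]) auto

text \<open>The constant may depend on the mesh. By \<open>psd_form_dominated\<close> it is enough
  that a displacement with zero strain form has zero \<open>H1\<close> form, and that is what
  \<open>H_strain_zero\<close> provides.\<close>

lemma H_korn:
  assumes dim: "CARD('d) = 2 \<or> CARD('d) = 3"
  shows "\<exists>C\<ge>0. \<forall>z\<in>H_space \<Omega> Th TK m.
    L2_inner \<Omega> z z + L2_inner \<Omega> (vgrad z) (vgrad z) \<le> C * L2_inner \<Omega> (strain z) (strain z)"
proof -
  have zero: "L2_inner \<Omega> z z + L2_inner \<Omega> (vgrad z) (vgrad z) = 0 \<and> L2_inner \<Omega> (strain z) (strain z) = 0"
    if z: "z \<in> H_space \<Omega> Th TK m" and z0: "\<And>y. y \<in> closure \<Omega> \<Longrightarrow> z y = 0" for z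
  proof -
    have "AE x in lebesgue_on \<Omega>. z x = 0"
      using z0 closure_subset[of \<Omega>] by (intro AE_I2) auto
    moreover have v: "AE x in lebesgue_on \<Omega>. vgrad z x = 0"
      using AE_open_cells by eventually_elim (rule vgrad_zero_on_open_cells, use z0 open_cells_subset in auto)
    moreover have "AE x in lebesgue_on \<Omega>. strain z x = 0"
      using v by eventually_elim (simp add: strain_def transpose_def vec_eq_iff)
    ultimately show ?thesis
      using L2_inner_cong_AE[OF H_L2[OF z] L2_zero H_L2[OF z] L2_zero]
        L2_inner_cong_AE[OF _ L2_zero _ L2_zero, of "vgrad z" \<Omega> "vgrad z"]
        L2_inner_cong_AE[OF _ L2_zero _ L2_zero, of "strain z" \<Omega> "strain z"]
        L2_operator.L2[OF L2_operator_vgrad_H z] L2_operator.L2[OF L2_operator_strain_H z]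
      by (simp add: L2_inner_def)
  qed
  have "\<exists>C\<ge>0. \<forall>z\<in>H_space \<Omega> Th TK m.
    1 * L2_inner \<Omega> z z + 1 * L2_inner \<Omega> (vgrad z) (vgrad z) \<le> C * L2_inner \<Omega> (strain z) (strain z)"
  proof (rule psd_form_dominated[OF L2_operator.psd_form[OF L2_operator_strain_H] H1_form])
    fix z assume z: "z \<in> H_space \<Omega> Th TK m"
    show "1 * L2_inner \<Omega> z z + 1 * L2_inner \<Omega> (vgrad z) (vgrad z) = 0" if "L2_inner \<Omega> (strain z) (strain z) = 0"
      using zero[OF z] H_strain_zero[OF dim z that] by simp
    have "\<forall>E\<in>Th. \<exists>g. (\<forall>i. (\<lambda>x. g x $ i) \<in> Q_poly m) \<and> (\<forall>x\<in>cbox 0 1. z (TK E x) = mat 1 *v g x)"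
      using z by (simp add: H_space_def)
    from cellwise_polynomial_representation[where f = z and TK = TK and A = "\<lambda>_ _. mat 1", OF finite_mesh this]
    show "\<exists>c. \<forall>y\<in>Th \<times> cbox 0 1. z (case y of (E, x) \<Rightarrow> TK E x) =
      (\<Sum>j \<in> Th \<times> {\<alpha>. \<forall>i. \<alpha> i \<le> m} \<times> (UNIV :: 'd set). c j *\<^sub>R
      (case j of (E', \<alpha>, i) \<Rightarrow> case y of (E, x) \<Rightarrow>
        if E' = E then mat 1 *v ((\<Prod>l\<in>UNIV. x $ l ^ \<alpha> l) *\<^sub>R axis i 1) else 0))" .
    show "L2_inner \<Omega> (strain z) (strain z) = 0"
      if c: "\<And>y. y \<in> Th \<times> cbox 0 1 \<Longrightarrow> z (case y of (E, x) \<Rightarrow> TK E x) = 0"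
    proof -
      have "z y = 0" if "y \<in> closure \<Omega>" for y
      proof -
        have "y \<in> \<Union>Th" using that mesh_covers by simp
        then obtain E x where "E \<in> Th" "x \<in> cbox 0 1" "y = TK E x" using cell_image by blast
        then show ?thesis using c[of "(E, x)"] by simp
      qed
      then show ?thesis using zero[OF z] by blast
    qed
  qed (intro finite_cartesian_product finite_mesh finite_multi_indices finite)
  then show ?thesis by simp
qed

end

section \<open>Pointwise bounds for the inverse permeability\<close>

lemma L2_I_dominated:
  assumes f: "f \<in> borel_measurable (lebesgue_on \<Omega>)" and g: "g \<in> L2 \<Omega>"
    and le: "AE x in lebesgue_on \<Omega>. norm (f x) \<le> C * norm (g x)"
  shows "f \<in> L2 \<Omega>"
proof -
  have "integrable (lebesgue_on \<Omega>) (\<lambda>x. (norm (f x))\<^sup>2)"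
  proof (rule Bochner_Integration.integrable_bound)
    show "integrable (lebesgue_on \<Omega>) (\<lambda>x. C\<^sup>2 * (norm (g x))\<^sup>2)"
      using g by (simp add: L2_def)
    show "(\<lambda>x. (norm (f x))\<^sup>2) \<in> borel_measurable (lebesgue_on \<Omega>)"
      using f by measurable
    show "AE x in lebesgue_on \<Omega>. norm ((norm (f x))\<^sup>2) \<le> norm (C\<^sup>2 * (norm (g x))\<^sup>2)"
      using le
    proof eventually_elim
      case (elim x)
      then show ?case using power_mono[OF elim, of 2] by (simp add: power_mult_distrib)
    qed
  qed
  then show ?thesis using f by (simp add: L2_def)
qed

lemma norm_matrix_vector_le:
  fixes A :: "real^'n::finite^'m::finite"
  shows "norm (A *v x) \<le> real CARD('m) * norm A * norm x"
proof -
  have "norm (A *v x) \<le> (\<Sum>i\<in>UNIV. \<bar>(A *v x) $ i\<bar>)" by (rule norm_le_l1_cart)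
  also have "\<dots> \<le> (\<Sum>i\<in>(UNIV::'m set). norm A * norm x)"
  proof (rule sum_mono)
    fix i
    have "\<bar>(A *v x) $ i\<bar> \<le> norm (A $ i) * norm x"
      by (simp add: matrix_vector_mul_component Cauchy_Schwarz_ineq2)
    also have "\<dots> \<le> norm A * norm x"
      by (intro mult_right_mono Finite_Cartesian_Product.norm_nth_le) simp
    finally show "\<bar>(A *v x) $ i\<bar> \<le> norm A * norm x" .
  qed
  finally show ?thesis by simp
qed

context
  fixes A :: "real^'d::finite^'d" and \<kappa> C :: real
  assumes sym: "transpose A = A" and \<kappa>: "0 < \<kappa>" and coercive: "\<forall>\<xi>. \<kappa> * (\<xi> \<bullet> \<xi>) \<le> \<xi> \<bullet> (A *v \<xi>)"
    and bound: "norm A \<le> C"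
begin

lemma coercive_det: "det A \<noteq> 0"
proof -
  have "\<xi> = 0" if "A *v \<xi> = 0" for \<xi>
  proof -
    have "\<kappa> * (\<xi> \<bullet> \<xi>) \<le> 0" using coercive that by (metis inner_zero_right)
    then have "\<xi> \<bullet> \<xi> \<le> 0" using \<kappa> by (simp add: mult_le_0_iff)
    then show ?thesis using inner_ge_zero[of \<xi>] inner_eq_zero_iff[of \<xi>] by linarith
  qed
  then have "inj ((*v) A)" using linear_injective_0[of "(*v) A"] by simp
  then show ?thesis
    using matrix_left_invertible_injective invertible_left_inverse invertible_det_nz by blast
qed

lemma coercive_inverse: "A *v (matrix_inv A *v \<xi>) = \<xi>"
  by (simp add: matrix_vector_mul_assoc matrix_inv_invertible[OF coercive_det])

lemma coercive_inverse_bound: "norm (matrix_inv A *v \<xi>) \<le> (1 / \<kappa>) * norm \<xi>"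
proof -
  let ?\<eta> = "matrix_inv A *v \<xi>"
  have "\<kappa> * (norm ?\<eta> * norm ?\<eta>) \<le> ?\<eta> \<bullet> \<xi>"
    using coercive[rule_format, of ?\<eta>] by (simp add: coercive_inverse dot_square_norm power2_eq_square)
  also have "\<dots> \<le> norm ?\<eta> * norm \<xi>" by (rule norm_cauchy_schwarz)
  finally have "norm ?\<eta> * (\<kappa> * norm ?\<eta>) \<le> norm ?\<eta> * norm \<xi>" by (simp add: algebra_simps)
  then have "\<kappa> * norm ?\<eta> \<le> norm \<xi>"
    using \<kappa> by (cases "?\<eta> = 0") (simp_all add: mult_le_cancel_left)
  then show ?thesis using \<kappa> by (simp add: field_simps)
qed

lemma coercive_inverse_symmetric: "(matrix_inv A *v \<xi>) \<bullet> \<zeta> = (matrix_inv A *v \<zeta>) \<bullet> \<xi>"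
proof -
  have "(matrix_inv A *v \<xi>) \<bullet> \<zeta> = (matrix_inv A *v \<xi>) \<bullet> (A *v (matrix_inv A *v \<zeta>))"
    by (simp add: coercive_inverse)
  also have "\<dots> = (transpose A *v (matrix_inv A *v \<xi>)) \<bullet> (matrix_inv A *v \<zeta>)"
    by (simp add: dot_lmul_matrix[symmetric] transpose_matrix_vector inner_commute)
  also have "\<dots> = \<xi> \<bullet> (matrix_inv A *v \<zeta>)" by (simp add: sym coercive_inverse)
  finally show ?thesis by (simp add: inner_commute)
qed

text \<open>With \<open>\<eta> = matrix_inv A *v \<xi>\<close> the right-hand side is
  \<open>\<eta> \<bullet> (A *v \<eta>)\<close>, at least \<open>\<kappa> |\<eta>|^2\<close>, and
  \<open>|\<xi>| = |A *v \<eta>|\<close> is at most \<open>CARD('d) * C * |\<eta>|\<close>. The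
  summand 1 keeps the denominator positive.\<close>

lemma coercive_inverse_lower: "\<kappa> / (real CARD('d) * C + 1)\<^sup>2 * (\<xi> \<bullet> \<xi>) \<le> (matrix_inv A *v \<xi>) \<bullet> \<xi>"
proof -
  let ?\<eta> = "matrix_inv A *v \<xi>" and ?D = "real CARD('d) * C + 1"
  have C: "0 \<le> C" using bound norm_ge_zero order_trans by blast
  have D: "0 < ?D" using C by (simp add: add_nonneg_pos)
  have "norm \<xi> \<le> real CARD('d) * norm A * norm ?\<eta>"
    using norm_matrix_vector_le[of A ?\<eta>] by (simp add: coercive_inverse)
  also have "\<dots> \<le> ?D * norm ?\<eta>"
  proof (rule mult_right_mono)
    have "real CARD('d) * norm A \<le> real CARD('d) * C" by (rule mult_left_mono[OF bound]) simp
    then show "real CARD('d) * norm A \<le> ?D" by linarith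
  qed simp
  finally have "(norm \<xi>)\<^sup>2 \<le> (?D * norm ?\<eta>)\<^sup>2" by (intro power_mono) auto
  then have "\<xi> \<bullet> \<xi> \<le> ?D\<^sup>2 * (?\<eta> \<bullet> ?\<eta>)" by (simp add: power_mult_distrib dot_square_norm)
  then have "\<kappa> * (\<xi> \<bullet> \<xi>) \<le> ?D\<^sup>2 * (\<kappa> * (?\<eta> \<bullet> ?\<eta>))"
    using mult_left_mono[of "\<xi> \<bullet> \<xi>" "?D\<^sup>2 * (?\<eta> \<bullet> ?\<eta>)" \<kappa>] \<kappa> by (simp add: mult.left_commute)
  also have "\<dots> \<le> ?D\<^sup>2 * (?\<eta> \<bullet> \<xi>)"
    using coercive[rule_format, of ?\<eta>] by (intro mult_left_mono) (simp_all add: coercive_inverse)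
  finally show ?thesis using D by (simp add: field_simps)
qed

end

context fe_mesh
begin

subsection \<open>The flux space\<close>

lemma V_cell:
  assumes "v \<in> V_space \<Omega> Th TK s" "E \<in> Th"
  obtains g where "\<forall>i. (\<lambda>x. g x $ i) \<in> tensor_poly ((\<lambda>_. s)(i := s + 1))"
    "\<forall>x\<in>box 0 1. v (TK E x) = inverse (det (jacobian (TK E) (at x))) *\<^sub>R (jacobian (TK E) (at x) *v g x)"
  using assms unfolding V_space_def RT_ref_def by blast

lemma V_Hdiv: "v \<in> V_space \<Omega> Th TK s \<Longrightarrow> v \<in> Hdiv \<Omega>"
  by (simp add: V_space_def)

lemma V_L2: "v \<in> V_space \<Omega> Th TK s \<Longrightarrow> v \<in> L2 \<Omega>"
  by (simp add: V_space_def Hdiv_def)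

lemma V_lin:
  assumes f: "f \<in> V_space \<Omega> Th TK s" and g: "g \<in> V_space \<Omega> Th TK s"
  shows "(\<lambda>x. f x + c *\<^sub>R g x) \<in> V_space \<Omega> Th TK s"
proof -
  have "\<exists>h\<in>RT_ref s. \<forall>x\<in>box 0 1. f (TK E x) + c *\<^sub>R g (TK E x)
      = inverse (det (jacobian (TK E) (at x))) *\<^sub>R (jacobian (TK E) (at x) *v h x)" if E: "E \<in> Th" for E
  proof -
    obtain f' where f': "\<forall>i. (\<lambda>x. f' x $ i) \<in> tensor_poly ((\<lambda>_. s)(i := s + 1))"
      "\<forall>x\<in>box 0 1. f (TK E x) = inverse (det (jacobian (TK E) (at x))) *\<^sub>R (jacobian (TK E) (at x) *v f' x)"
      by (rule V_cell[OF f E])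
    obtain g' where g': "\<forall>i. (\<lambda>x. g' x $ i) \<in> tensor_poly ((\<lambda>_. s)(i := s + 1))"
      "\<forall>x\<in>box 0 1. g (TK E x) = inverse (det (jacobian (TK E) (at x))) *\<^sub>R (jacobian (TK E) (at x) *v g' x)"
      by (rule V_cell[OF g E])
    have "(\<lambda>x. f' x + c *\<^sub>R g' x) \<in> RT_ref s"
      using tensor_poly_lin_vec[OF f'(1) g'(1), of c] by (simp add: RT_ref_def)
    then show ?thesis
      using f'(2) g'(2)
      by (intro bexI[of _ "\<lambda>x. f' x + c *\<^sub>R g' x"]) (auto simp: matrix_vector_right_distrib matrix_vector_mult_scaleR algebra_simps)
  qed
  moreover have "(\<lambda>x. f x + c *\<^sub>R g x) \<in> Hdiv \<Omega>"
    by (rule Hdiv_lin[OF open_domain bounded_domain V_Hdiv[OF f] V_Hdiv[OF g]])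
  ultimately show ?thesis by (simp add: V_space_def)
qed

lemma V_zero: "(\<lambda>_. 0) \<in> V_space \<Omega> Th TK s"
proof -
  have "(\<lambda>_. 0) \<in> Hdiv \<Omega>"
    by (auto simp: Hdiv_def L2_zero has_weak_divergence_def L2_inner_def intro!: bexI[of _ "\<lambda>_. 0"])
  moreover have "(\<lambda>_. 0) \<in> RT_ref s" by (simp add: RT_ref_def tensor_poly_zero)
  ultimately show ?thesis by (auto simp: V_space_def intro!: bexI[of _ "\<lambda>_. 0"])
qed

lemma V_piecewise_C1:
  assumes "v \<in> V_space \<Omega> Th TK s"
  shows "piecewise_C1 v"
  unfolding piecewise_C1_def
proof
  fix E assume E: "E \<in> Th"
  interpret T: reference_map "TK E" by (rule reference_map[OF E])
  obtain g where g: "\<forall>i. (\<lambda>x. g x $ i) \<in> tensor_poly ((\<lambda>_. s)(i := s + 1))"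
    "\<forall>x\<in>box 0 1. v (TK E x) = inverse (det (jacobian (TK E) (at x))) *\<^sub>R (jacobian (TK E) (at x) *v g x)"
    by (rule V_cell[OF assms E])
  let ?J = "\<lambda>x. jacobian (TK E) (at x)"
  let ?F = "\<lambda>x. \<chi> i. (\<Sum>j\<in>UNIV. ?J x $ i $ j * g x $ j) / det (?J x)"
  have gp: "real_polynomial_function (\<lambda>x. g x $ j)" for j
    using g(1) by (intro tensor_poly_real_polynomial_function[of _ "(\<lambda>_. s)(j := s + 1)"]) blast
  have Jp: "real_polynomial_function (\<lambda>x. ?J x $ i $ j)" for i j
    by (rule polynomial_map_jacobian(2)[OF T.polynomial])
  have "C1_on (cbox 0 1) ?F"
    by (intro C1_on_rational real_polynomial_function_sum real_polynomial_function.intros(4)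
        real_polynomial_function_det gp Jp T.regular finite)
  moreover have "\<forall>x\<in>box 0 1. v (TK E x) = ?F x"
    using g(2) by (simp add: vec_eq_iff matrix_vector_mult_def divide_inverse mult.commute)
  ultimately show "\<exists>F. C1_on (cbox 0 1) F \<and> (\<forall>x\<in>box 0 1. v (TK E x) = F x)"
    by (intro exI[of _ ?F] conjI)
qed

lemma L2_operator_V: "L2_operator \<Omega> (V_space \<Omega> Th TK s) (\<lambda>z. z)"
proof
qed (rule V_zero V_lin V_L2 AE_I2 refl; assumption?)+

lemma L2_operator_vgrad_V: "L2_operator \<Omega> (V_space \<Omega> Th TK s) vgrad"
  by (rule L2_operator_vgrad) (rule V_zero V_lin V_piecewise_C1; assumption)+

lemma L2_operator_divergence_V: "L2_operator \<Omega> (V_space \<Omega> Th TK s) divergence"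
  unfolding divergence_eq by (rule L2_operator.compose_bounded_linear[OF L2_operator_vgrad_V bounded_linear_trace])

lemma Hdiv_form:
  "psd_form (V_space \<Omega> Th TK s) (\<lambda>f g. 1 * L2_inner \<Omega> f g + 1 * L2_inner \<Omega> (divergence f) (divergence g))"
  by (rule psd_form_add[OF L2_operator.psd_form[OF L2_operator_V] L2_operator.psd_form[OF L2_operator_divergence_V]]) auto

text \<open>Finite dimension yields a mesh-dependent constant. The kernels compare because a flux
  that is null in \<open>L2\<close> vanishes on the open cells by continuity, and with it the
  divergence there.\<close>

lemma V_inverse_estimate:
  "\<exists>C\<ge>0. \<forall>v\<in>V_space \<Omega> Th TK s. L2_inner \<Omega> (divergence v) (divergence v) \<le> C * L2_inner \<Omega> v v"
proof (rule psd_form_dominated[OF L2_operator.psd_form[OF L2_operator_V] L2_operator.psd_form[OF L2_operator_divergence_V]])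
  fix v assume v: "v \<in> V_space \<Omega> Th TK s"
  show "L2_inner \<Omega> (divergence v) (divergence v) = 0" if "L2_inner \<Omega> v v = 0"
  proof -
    have n: "negligible {x \<in> \<Omega>. v x \<noteq> 0}"
      using L2_inner_self_eq_0[OF V_L2[OF v] that] by (simp add: AE_domain_iff)
    have v0: "v y = 0" if y: "y \<in> open_cells" for y
      by (rule continuous_AE_zero[OF _ open_open_cells y open_cells_subset open_domain n])
        (rule differentiable_imp_continuous_within[OF piecewise_C1_differentiable[OF V_piecewise_C1[OF v] y]])
    have "AE x in lebesgue_on \<Omega>. divergence v x = 0"
      using AE_open_cells by eventually_elim (simp add: divergence_def vgrad_zero_on_open_cells[OF v0] trace_def)
    then have "L2_inner \<Omega> (divergence v) (divergence v) = L2_inner \<Omega> (\<lambda>_. 0::real) (\<lambda>_. 0)"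
      by (intro L2_inner_cong_AE L2_operator.L2[OF L2_operator_divergence_V v] L2_zero)
    then show ?thesis by (simp add: L2_inner_def)
  qed
  let ?A = "\<lambda>E x. inverse (det (jacobian (TK E) (at x))) *\<^sub>R jacobian (TK E) (at x)"
  have "\<forall>E\<in>Th. \<exists>g. (\<forall>i. (\<lambda>x. g x $ i) \<in> Q_poly (s + 1)) \<and> (\<forall>x\<in>box 0 1. v (TK E x) = ?A E x *v g x)"
  proof
    fix E assume E: "E \<in> Th"
    obtain g where g: "\<forall>i. (\<lambda>x. g x $ i) \<in> tensor_poly ((\<lambda>_. s)(i := s + 1))"
      "\<forall>x\<in>box 0 1. v (TK E x) = inverse (det (jacobian (TK E) (at x))) *\<^sub>R (jacobian (TK E) (at x) *v g x)"
      by (rule V_cell[OF v E])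
    \<comment> \<open>Any finite set of generators will do, so the anisotropic degrees are enlarged
      to \<open>s + 1\<close> in every variable.\<close>
    have "tensor_poly ((\<lambda>_. s)(i := s + 1)) \<subseteq> Q_poly (s + 1)" for i :: 'd
      by (rule tensor_poly_mono) simp
    then show "\<exists>g. (\<forall>i. (\<lambda>x. g x $ i) \<in> Q_poly (s + 1)) \<and> (\<forall>x\<in>box 0 1. v (TK E x) = ?A E x *v g x)"
      using g by (intro exI[of _ g]) (auto simp: scaleR_matrix_vector_assoc)
  qed
  from cellwise_polynomial_representation[where f = v and TK = TK and A = ?A, OF finite_mesh this]
  show "\<exists>c. \<forall>y\<in>Th \<times> box 0 1. v (case y of (E, x) \<Rightarrow> TK E x) =
    (\<Sum>j \<in> Th \<times> {\<alpha>. \<forall>i. \<alpha> i \<le> s + 1} \<times> (UNIV :: 'd set). c j *\<^sub>R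
      (case j of (E', \<alpha>, i) \<Rightarrow> case y of (E, x) \<Rightarrow>
        if E' = E then ?A E x *v ((\<Prod>l\<in>UNIV. x $ l ^ \<alpha> l) *\<^sub>R axis i 1) else 0))" .
  show "L2_inner \<Omega> v v = 0"
    if c: "\<And>y. y \<in> Th \<times> box 0 1 \<Longrightarrow> v (case y of (E, x) \<Rightarrow> TK E x) = 0"
  proof -
    have v0: "v y = 0" if y: "y \<in> open_cells" for y
      using y c by (auto simp: open_cells_def)
    have "AE x in lebesgue_on \<Omega>. v x = 0" using AE_open_cells by eventually_elim (rule v0)
    then have "L2_inner \<Omega> v v = L2_inner \<Omega> (\<lambda>_. 0::real^'d) (\<lambda>_. 0)"
      by (intro L2_inner_cong_AE V_L2[OF v] L2_zero)
    then show ?thesis by (simp add: L2_inner_def)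
  qed
qed (intro finite_cartesian_product finite_mesh finite_multi_indices finite)

text \<open>By coercivity \<open>K x\<close> is invertible almost everywhere; there
  \<open>matrix_inv (K x) *v f x\<close> agrees with Cramer's quotient, whose measurability holds
  without exception.\<close>

lemma L2_operator_permeability_inverse:
  assumes K: "permeability \<Omega> K"
  shows "L2_operator \<Omega> (V_space \<Omega> Th TK s) (\<lambda>Q x. matrix_inv (K x) *v Q x)"
proof
  obtain C \<kappa> where K': "K \<in> borel_measurable (lebesgue_on \<Omega>)" "AE x in lebesgue_on \<Omega>. norm (K x) \<le> C"
    "AE x in lebesgue_on \<Omega>. transpose (K x) = K x" "0 < \<kappa>"
    "AE x in lebesgue_on \<Omega>. \<forall>\<xi>. \<kappa> * (\<xi> \<bullet> \<xi>) \<le> \<xi> \<bullet> (K x *v \<xi>)"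
    using K by (auto simp: permeability_def)
  fix f assume f: "f \<in> V_space \<Omega> Th TK s"
  note fm = L2_measurable[OF V_L2[OF f]]
  have "AE x in lebesgue_on \<Omega>. (\<chi> k. det (\<chi> i j. if j = k then f x $ i else K x $ i $ j) / det (K x)) = matrix_inv (K x) *v f x"
    using K'(3,5)
  proof eventually_elim
    case (elim x)
    note d = coercive_det[OF elim(1) K'(4) elim(2) order_refl]
    show ?case
      using cramer[OF d, of "matrix_inv (K x) *v f x" "f x"]
      by (simp add: matrix_vector_mul_assoc matrix_inv_invertible[OF d])
  qed
  then have "(\<lambda>x. matrix_inv (K x) *v f x) \<in> borel_measurable (lebesgue_on \<Omega>)"
    by (rule borel_measurable_lebesgue_on_AE[OF domain_sets borel_measurable_cramer[OF K'(1) fm]])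
  moreover have "AE x in lebesgue_on \<Omega>. norm (matrix_inv (K x) *v f x) \<le> (1 / \<kappa>) * norm (f x)"
    using K'(3,5) by eventually_elim (rule coercive_inverse_bound[OF _ K'(4) _ order_refl])
  ultimately show "(\<lambda>x. matrix_inv (K x) *v f x) \<in> L2 \<Omega>" by (rule L2_I_dominated[OF _ V_L2[OF f]])
  fix g c
  show "AE x in lebesgue_on \<Omega>. matrix_inv (K x) *v (f x + c *\<^sub>R g x)
      = matrix_inv (K x) *v f x + c *\<^sub>R (matrix_inv (K x) *v g x)"
    by (intro AE_I2) (simp add: matrix_vector_right_distrib matrix_vector_mult_scaleR)
qed (rule V_zero V_lin; assumption?)+

lemma permeability_form:
  assumes K: "permeability \<Omega> K"
  shows "psd_form (V_space \<Omega> Th TK s) (\<lambda>q v. L2_inner \<Omega> (\<lambda>x. matrix_inv (K x) *v q x) v)" (is ?form)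
    and "\<exists>c>0. \<forall>v\<in>V_space \<Omega> Th TK s. c * L2_inner \<Omega> v v \<le> L2_inner \<Omega> (\<lambda>x. matrix_inv (K x) *v v x) v" (is ?coercive)
proof -
  obtain C \<kappa> where K': "AE x in lebesgue_on \<Omega>. norm (K x) \<le> C"
    "AE x in lebesgue_on \<Omega>. transpose (K x) = K x" "0 < \<kappa>"
    "AE x in lebesgue_on \<Omega>. \<forall>\<xi>. \<kappa> * (\<xi> \<bullet> \<xi>) \<le> \<xi> \<bullet> (K x *v \<xi>)"
    using K by (auto simp: permeability_def)
  interpret O: L2_operator \<Omega> "V_space \<Omega> Th TK s" "\<lambda>Q x. matrix_inv (K x) *v Q x"
    by (rule L2_operator_permeability_inverse[OF K])
  \<comment> \<open>The absolute value makes \<open>c\<close> positive without deducing a sign of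
    \<open>C\<close> from a bound that holds only almost everywhere.\<close>
  define D where "D = \<bar>C\<bar>"
  have KD: "AE x in lebesgue_on \<Omega>. norm (K x) \<le> D"
    using K'(1) by eventually_elim (simp add: D_def)
  define c where "c = \<kappa> / (real CARD('d) * D + 1)\<^sup>2"
  have c: "0 < c" unfolding c_def D_def using K'(3) by (intro divide_pos_pos zero_less_power) (auto intro: add_nonneg_pos)
  have lower: "c * L2_inner \<Omega> v v \<le> L2_inner \<Omega> (\<lambda>x. matrix_inv (K x) *v v x) v"
    if v: "v \<in> V_space \<Omega> Th TK s" for v
  proof -
    have "c * L2_inner \<Omega> v v = (\<integral>x. c * (v x \<bullet> v x) \<partial>(lebesgue_on \<Omega>))"
      by (simp add: L2_inner_def)
    also have "\<dots> \<le> L2_inner \<Omega> (\<lambda>x. matrix_inv (K x) *v v x) v"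
      unfolding L2_inner_def
    proof (rule integral_mono_AE)
      show "integrable (lebesgue_on \<Omega>) (\<lambda>x. c * (v x \<bullet> v x))"
        by (intro integrable_mult_right L2_inner_integrable V_L2[OF v])
      show "integrable (lebesgue_on \<Omega>) (\<lambda>x. (matrix_inv (K x) *v v x) \<bullet> v x)"
        by (intro L2_inner_integrable V_L2[OF v] O.L2[OF v])
      show "AE x in lebesgue_on \<Omega>. c * (v x \<bullet> v x) \<le> (matrix_inv (K x) *v v x) \<bullet> v x"
        using K'(2,4) KD unfolding c_def by eventually_elim (rule coercive_inverse_lower[OF _ K'(3)])
    qed
    finally show ?thesis .
  qed
  then show ?coercive using c by blast
  show ?form
  proof
    fix f g h a assume fg: "f \<in> V_space \<Omega> Th TK s" "g \<in> V_space \<Omega> Th TK s"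
    show "(\<lambda>x. f x + a *\<^sub>R g x) \<in> V_space \<Omega> Th TK s" by (rule V_lin[OF fg])
    show "L2_inner \<Omega> (\<lambda>x. matrix_inv (K x) *v f x) g = L2_inner \<Omega> (\<lambda>x. matrix_inv (K x) *v g x) f"
      unfolding L2_inner_def
    proof (rule integral_cong_AE)
      show "AE x in lebesgue_on \<Omega>. (matrix_inv (K x) *v f x) \<bullet> g x = (matrix_inv (K x) *v g x) \<bullet> f x"
        using K'(2,4) by eventually_elim (rule coercive_inverse_symmetric[OF _ K'(3) _ order_refl])
    qed (intro borel_measurable_inner L2_measurable O.L2[OF fg(1)] O.L2[OF fg(2)] V_L2[OF fg(1)] V_L2[OF fg(2)])+
    show "L2_inner \<Omega> (\<lambda>x. matrix_inv (K x) *v (f x + a *\<^sub>R g x)) h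
      = L2_inner \<Omega> (\<lambda>x. matrix_inv (K x) *v f x) h + a * L2_inner \<Omega> (\<lambda>x. matrix_inv (K x) *v g x) h"
      if "h \<in> V_space \<Omega> Th TK s" by (rule O.inner_lin[OF fg V_L2[OF that]])
    have "0 \<le> c * L2_inner \<Omega> f f"
      using c psd_form.nonneg[OF psd_form_L2 V_L2[OF fg(1)]] by simp
    also have "\<dots> \<le> L2_inner \<Omega> (\<lambda>x. matrix_inv (K x) *v f x) f" by (rule lower[OF fg(1)])
    finally show "0 \<le> L2_inner \<Omega> (\<lambda>x. matrix_inv (K x) *v f x) f" .
  qed (rule V_zero)
qed

end

section \<open>Contraction of the fixed-stress iteration on one time interval\<close>

text \<open>As \<open>B\<close> is symmetric, twice the sum sees only
  \<open>\<alpha> i j + \<alpha> j i\<close> and equals \<open>B g g + B h h\<close>, where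
  \<open>g\<close> and \<open>h\<close> are the combinations of the \<open>f i\<close> with
  coefficients \<open>x i\<close> and \<open>y i\<close>.\<close>

lemma (in psd_form) sum_symmetric_part_nonneg:
  fixes \<alpha> :: "'i \<Rightarrow> 'i \<Rightarrow> real"
  assumes I: "finite I" "\<And>i. i \<in> I \<Longrightarrow> f i \<in> X"
    and \<alpha>: "\<And>i j. i \<in> I \<Longrightarrow> j \<in> I \<Longrightarrow> \<alpha> i j + \<alpha> j i = x i * x j + y i * y j"
  shows "0 \<le> (\<Sum>i\<in>I. \<Sum>j\<in>I. \<alpha> i j * B (f j) (f i))"
proof -
  let ?q = "\<lambda>x. \<Sum>i\<in>I. \<Sum>j\<in>I. x i * x j * B (f i) (f j)"
  have q: "0 \<le> ?q x" for x
  proof -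
    let ?g = "\<lambda>z. \<Sum>i\<in>I. x i *\<^sub>R f i z"
    have g: "?g \<in> X" using I by (rule sum_mem)
    have "0 \<le> B ?g ?g" by (rule nonneg[OF g])
    also have "\<dots> = (\<Sum>i\<in>I. x i * B (f i) ?g)" by (rule sum_left[OF I g])
    also have "\<dots> = (\<Sum>i\<in>I. x i * (\<Sum>j\<in>I. x j * B (f i) (f j)))"
      using I by (intro sum.cong refl arg_cong2[where f = "(*)"] sum_right) auto
    also have "\<dots> = ?q x" by (simp add: sum_distrib_left mult.assoc)
    finally show ?thesis .
  qed
  have s: "B (f j) (f i) = B (f i) (f j)" if "i \<in> I" "j \<in> I" for i j
    using sym I that by blast
  have "2 * (\<Sum>i\<in>I. \<Sum>j\<in>I. \<alpha> i j * B (f j) (f i))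
    = (\<Sum>i\<in>I. \<Sum>j\<in>I. \<alpha> i j * B (f i) (f j)) + (\<Sum>j\<in>I. \<Sum>i\<in>I. \<alpha> i j * B (f j) (f i))"
    using s by (subst sum.swap) (simp cong: sum.cong)
  also have "\<dots> = (\<Sum>i\<in>I. \<Sum>j\<in>I. (\<alpha> i j + \<alpha> j i) * B (f i) (f j))"
    by (simp add: sum.distrib algebra_simps)
  also have "\<dots> = ?q x + ?q y"
    using \<alpha> by (simp add: sum.distrib[symmetric] distrib_right cong: sum.cong)
  finally show ?thesis using q[of x] q[of y] by linarith
qed

locale discrete_biot = fe_mesh \<Omega> Th TK
  for \<Omega> :: "(real^'d::finite) set" and Th TK +
  fixes s :: nat and M b mu lam L :: real and K :: "real^'d \<Rightarrow> real^'d^'d"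
  assumes dim: "CARD('d) = 2 \<or> CARD('d) = 3"
    and M: "0 < M" and b: "0 < b" and mu: "0 < mu" and lam: "0 < lam"
    and K: "permeability \<Omega> K"
    and L: "0 < L" "b\<^sup>2 / (2 * lam) \<le> L"
begin

abbreviation "W \<equiv> W_space \<Omega> Th TK s"
abbreviation "V \<equiv> V_space \<Omega> Th TK s"
abbreviation "H \<equiv> H_space \<Omega> Th TK (s + 1)"
abbreviation "ip \<equiv> L2_inner \<Omega>"
abbreviation "darcy q v \<equiv> ip (\<lambda>x. matrix_inv (K x) *v q x) v"

definition elastic :: "(real^'d \<Rightarrow> real^'d) \<Rightarrow> (real^'d \<Rightarrow> real^'d) \<Rightarrow> real" where
  "elastic U Z = 2 * mu * ip (strain U) (strain Z) + lam * ip (divergence U) (divergence Z)"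

lemma elastic_form: "psd_form H elastic"
  unfolding elastic_def[abs_def] using psd_form_add[OF L2_operator.psd_form[OF L2_operator_strain_H] L2_operator.psd_form[OF L2_operator_divergence_H],
      of "2 * mu" lam] mu lam by simp

lemma darcy_form: "psd_form V (\<lambda>q v. darcy q v)"
  by (rule permeability_form(1)[OF K])

lemma W_form: "psd_form W ip"
  by (rule psd_form_subset[OF psd_form_L2 subsetI[OF W_L2] W_zero W_lin])

lemma divergence_V_L2: "v \<in> V \<Longrightarrow> divergence v \<in> L2 \<Omega>"
  by (rule L2_operator.L2[OF L2_operator_divergence_V])

lemma divergence_H_L2: "z \<in> H \<Longrightarrow> divergence z \<in> L2 \<Omega>"
  by (rule L2_operator.L2[OF L2_operator_divergence_H])

text \<open>Expanding \<open>|b P - lam div U|^2 >= 0\<close> and using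
  \<open>a(U,U) = b <P, div U>\<close> gives
  \<open>2 lam a(U,U) <= b^2 |P|^2 + lam^2 |div U|^2\<close>; the last term is at most
  \<open>lam a(U,U)\<close> and is absorbed. What remains, \<open>lam a(U,U) <= b^2 |P|^2\<close>,
  is where the threshold on \<open>L\<close> enters.\<close>

lemma elastic_le_pressure:
  assumes U: "U \<in> H" and P: "P \<in> L2 \<Omega>" and eq: "\<And>z. z \<in> H \<Longrightarrow> elastic U z = b * ip P (divergence z)"
  shows "elastic U U \<le> 2 * L * ip P P"
proof -
  interpret L: psd_form "L2 \<Omega> :: (real^'d \<Rightarrow> real) set" ip by (rule psd_form_L2)
  let ?D = "divergence U"
  have D: "?D \<in> L2 \<Omega>" by (rule divergence_H_L2[OF U])
  have bP: "(\<lambda>x. b *\<^sub>R P x) \<in> L2 \<Omega>" and lD: "(\<lambda>x. lam *\<^sub>R ?D x) \<in> L2 \<Omega>"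
    using P D by (auto intro: L.scale_mem simp del: real_scaleR_def)
  have "0 \<le> ip (\<lambda>x. b *\<^sub>R P x - lam *\<^sub>R ?D x) (\<lambda>x. b *\<^sub>R P x - lam *\<^sub>R ?D x)"
    by (rule L.nonneg[OF L.diff_mem[OF bP lD]])
  also have "\<dots> = b * (b * ip P P) - 2 * (lam * (b * ip P ?D)) + lam * (lam * ip ?D ?D)"
    using P D bP lD
    by (simp add: L.diff_left L.diff_right L.diff_mem L.scale_left L.scale_right L.sym[OF D P] del: real_scaleR_def)
  finally have 1: "2 * (lam * (b * ip P ?D)) \<le> b * (b * ip P P) + lam * (lam * ip ?D ?D)" by simp
  have 2: "lam * ip ?D ?D \<le> elastic U U"
    unfolding elastic_def
    using psd_form.nonneg[OF psd_form_L2 L2_operator.L2[OF L2_operator_strain_H U]] mu by simp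
  have "lam * elastic U U \<le> b * (b * ip P P)"
    using 1 mult_left_mono[OF 2, of lam] lam unfolding eq[OF U, symmetric] by linarith
  moreover have "b * b \<le> 2 * L * lam" using L lam by (simp add: field_simps power2_eq_square)
  from mult_right_mono[OF this L.nonneg[OF P]] have "b * (b * ip P P) \<le> 2 * L * lam * ip P P"
    by (simp only: mult.assoc)
  ultimately have "lam * elastic U U \<le> lam * (2 * L * ip P P)" by (simp add: algebra_simps)
  then show ?thesis using lam by simp
qed

text \<open>With \<open>c(X, Y) = L \<langle>X, Y\<rangle> - a(U\<^sub>X, U\<^sub>Y)\<close>, where \<open>a\<close> is the elastic form, \<open>\<bar>c(Z, Z)\<bar> \<le> L \<bar>Z\<bar>\<^sup>2\<close>;
  this passes to \<open>c(X, Y)\<close> by polarization.\<close>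

lemma coupling_bound:
  assumes X: "X \<in> L2 \<Omega>" and Y: "Y \<in> L2 \<Omega>" and U: "UX \<in> H" "UY \<in> H"
    and eqX: "\<And>z. z \<in> H \<Longrightarrow> elastic UX z = b * ip X (divergence z)"
    and eqY: "\<And>z. z \<in> H \<Longrightarrow> elastic UY z = b * ip Y (divergence z)"
  shows "L * ip Y X - b * ip (divergence UY) X \<le> L / 2 * (ip X X + ip Y Y)"
proof -
  interpret L: psd_form "L2 \<Omega> :: (real^'d \<Rightarrow> real) set" ip by (rule psd_form_L2)
  interpret E: psd_form H elastic by (rule elastic_form)
  have m: "elastic UX UY = b * ip (divergence UY) X"
    using eqX[OF U(2)] L.sym[OF X divergence_H_L2[OF U(2)]] by simp
  \<comment> \<open>The pressure bound for the difference \<open>X - Y\<close> is combined with the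
    mere nonnegativity of the energy of \<open>UX + UY\<close>: the diagonal energies cancel and
    \<open>- 4 a(UX, UY)\<close> remains.\<close>
  have "elastic (\<lambda>x. UX x - UY x) (\<lambda>x. UX x - UY x) \<le> 2 * L * ip (\<lambda>x. X x - Y x) (\<lambda>x. X x - Y x)"
  proof (rule elastic_le_pressure[OF E.diff_mem[OF U] L.diff_mem[OF X Y]])
    fix z assume z: "z \<in> H"
    show "elastic (\<lambda>x. UX x - UY x) z = b * ip (\<lambda>x. X x - Y x) (divergence z)"
      unfolding E.diff_left[OF U z] L.diff_left[OF X Y divergence_H_L2[OF z]] right_diff_distrib
      using eqX[OF z] eqY[OF z] by linarith
  qed
  also have "elastic (\<lambda>x. UX x - UY x) (\<lambda>x. UX x - UY x) = elastic UX UX - 2 * elastic UX UY + elastic UY UY"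
    using E.diff_left[OF U E.diff_mem[OF U]] E.diff_right[OF U U(1)] E.diff_right[OF U U(2)] E.sym[OF U] by linarith
  also have "ip (\<lambda>x. X x - Y x) (\<lambda>x. X x - Y x) = ip X X - 2 * ip Y X + ip Y Y"
    by (simp add: L.diff_left L.diff_right L.diff_mem X Y L.sym[OF X Y])
  finally have d: "elastic UX UX - 2 * elastic UX UY + elastic UY UY \<le> 2 * L * (ip X X - 2 * ip Y X + ip Y Y)" .
  have "0 \<le> elastic (\<lambda>x. UX x + UY x) (\<lambda>x. UX x + UY x)"
    by (rule E.nonneg[OF E.add_mem[OF U]])
  also have "\<dots> = elastic UX UX + 2 * elastic UX UY + elastic UY UY"
    using E.add_left[OF U E.add_mem[OF U]] E.add_right[OF U U(1)] E.add_right[OF U U(2)] E.sym[OF U] by linarith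
  finally have a: "0 \<le> elastic UX UX + 2 * elastic UX UY + elastic UY UY" .
  have "2 * L * (ip X X - 2 * ip Y X + ip Y Y) = 2 * (L * (ip X X + ip Y Y)) - 4 * (L * ip Y X)"
    by (simp add: algebra_simps)
  then have "4 * (L * ip Y X) - 4 * elastic UX UY \<le> 2 * (L * (ip X X + ip Y Y))" using a d by linarith
  then show ?thesis unfolding m by simp
qed

lemma H1_le_pressure:
  "\<exists>C\<ge>0. \<forall>U\<in>H. \<forall>P\<in>L2 \<Omega>. (\<forall>z\<in>H. elastic U z = b * ip P (divergence z)) \<longrightarrow>
     ip U U + ip (vgrad U) (vgrad U) \<le> C * ip P P"
proof -
  obtain C where C: "0 \<le> C" "\<And>z. z \<in> H \<Longrightarrow> ip z z + ip (vgrad z) (vgrad z) \<le> C * ip (strain z) (strain z)"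
    using H_korn[OF dim, of "s + 1"] by blast
  show ?thesis
  proof (intro exI[of _ "C * (L / mu)"] conjI ballI impI)
    fix U and P :: "real^'d \<Rightarrow> real"
    assume U: "U \<in> H" and P: "P \<in> L2 \<Omega>" and eq: "\<forall>z\<in>H. elastic U z = b * ip P (divergence z)"
    have "elastic U U \<le> 2 * L * ip P P" using U P eq by (intro elastic_le_pressure) auto
    moreover have "0 \<le> lam * ip (divergence U) (divergence U)"
      using psd_form.nonneg[OF psd_form_L2 divergence_H_L2[OF U]] lam by simp
    ultimately have "mu * ip (strain U) (strain U) \<le> L * ip P P" unfolding elastic_def by linarith
    then have "ip (strain U) (strain U) \<le> L / mu * ip P P" using mu by (simp add: field_simps)
    then show "ip U U + ip (vgrad U) (vgrad U) \<le> C * (L / mu) * ip P P"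
      using C(2)[OF U] mult_left_mono[OF _ C(1)] by fastforce
  qed (use C L mu in auto)
qed

text \<open>Testing Darcy's law with \<open>q\<close> itself gives
  \<open>c |q|^2 <= <P, div q> <= |P| |div q|\<close>. The inverse estimate replaces
  \<open>|div q|\<close> by \<open>sqrt C |q|\<close>, one factor \<open>|q|\<close> cancels, and
  \<open>c^2 |q|^2 <= C |P|^2\<close> is left; the factor \<open>1 + C\<close> adds the
  divergence.\<close>

lemma Hdiv_le_pressure:
  "\<exists>C\<ge>0. \<forall>q\<in>V. \<forall>P\<in>L2 \<Omega>. (\<forall>v\<in>V. darcy q v = ip P (divergence v)) \<longrightarrow>
     ip q q + ip (divergence q) (divergence q) \<le> C * ip P P"
proof -
  obtain C where C: "0 \<le> C" "\<And>v. v \<in> V \<Longrightarrow> ip (divergence v) (divergence v) \<le> C * ip v v"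
    using V_inverse_estimate[of s] by blast
  obtain c where c: "0 < c" "\<And>v. v \<in> V \<Longrightarrow> c * ip v v \<le> darcy v v"
    using permeability_form(2)[OF K, of s] by blast
  show ?thesis
  proof (intro exI[of _ "(1 + C) * (C / c\<^sup>2)"] conjI ballI impI)
    fix q and P :: "real^'d \<Rightarrow> real"
    assume q: "q \<in> V" and P: "P \<in> L2 \<Omega>" and eq: "\<forall>v\<in>V. darcy q v = ip P (divergence v)"
    have nn: "0 \<le> ip q q" "0 \<le> ip P P"
      by (rule psd_form.nonneg[OF psd_form_L2 V_L2[OF q]], rule psd_form.nonneg[OF psd_form_L2 P])
    have "c * ip q q \<le> ip P (divergence q)" using c(2)[OF q] eq q by simp
    then have "(c * ip q q)\<^sup>2 \<le> (ip P (divergence q))\<^sup>2" using c(1) nn by (intro power_mono) auto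
    also have "\<dots> \<le> ip P P * ip (divergence q) (divergence q)"
      by (rule psd_form.cauchy_schwarz[OF psd_form_L2 P divergence_V_L2[OF q]])
    also have "\<dots> \<le> ip P P * (C * ip q q)" using C(2)[OF q] nn by (intro mult_left_mono) auto
    finally have *: "ip q q * (c\<^sup>2 * ip q q) \<le> ip q q * (C * ip P P)"
      by (simp add: power_mult_distrib power2_eq_square algebra_simps)
    have "c\<^sup>2 * ip q q \<le> C * ip P P"
    proof (cases "ip q q = 0")
      case False
      then show ?thesis using * nn by (simp add: mult_le_cancel_left)
    qed (use C nn in simp)
    then have "ip q q \<le> C / c\<^sup>2 * ip P P" using c(1) by (simp add: field_simps)
    then have "(1 + C) * ip q q \<le> (1 + C) * (C / c\<^sup>2 * ip P P)" using C by (intro mult_left_mono) auto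
    then show "ip q q + ip (divergence q) (divergence q) \<le> (1 + C) * (C / c\<^sup>2) * ip P P"
      using C(2)[OF q] by (simp add: algebra_simps)
  qed (use C in auto)
qed

end

section \<open>Norms of the discrete spaces and sequences dominated by the pressure\<close>

context discrete_biot
begin

lemma Hdiv_norm_eq: "v \<in> V \<Longrightarrow> Hdiv_norm \<Omega> v = sqrt (ip v v + ip (divergence v) (divergence v))"
  by (simp add: Hdiv_norm_def L2_norm_power2 V_L2 divergence_V_L2)

lemma H1_norm_eq: "z \<in> H \<Longrightarrow> H1_norm \<Omega> z = sqrt (ip z z + ip (vgrad z) (vgrad z))"
  by (simp add: H1_norm_def L2_norm_power2 H_L2 L2_operator.L2[OF L2_operator_vgrad_H])

text \<open>The bound on \<open>f\<close> starts at index 1 because the initial flux and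
  displacement are not tied to the initial pressure.\<close>

lemma tendsto_zero_dominated:
  fixes f :: "nat \<Rightarrow> real"
  assumes P: "\<And>k. P k \<in> L2 \<Omega>" "(\<lambda>k. L2_norm \<Omega> (P k :: real^'d \<Rightarrow> real)) \<longlonglongrightarrow> 0"
    and f: "\<And>k. 0 \<le> f k" "\<And>k. f (Suc k) \<le> C * ip (P (Suc k)) (P (Suc k))" and C: "0 \<le> C"
  shows "(\<lambda>k. sqrt (f k)) \<longlonglongrightarrow> 0"
proof -
  have "(\<lambda>k. sqrt (f (Suc k))) \<longlonglongrightarrow> 0"
  proof (rule tendsto_sandwich[OF _ _ tendsto_const])
    show "(\<lambda>k. sqrt C * L2_norm \<Omega> (P (Suc k))) \<longlonglongrightarrow> 0"
      using tendsto_mult_right_zero[OF LIMSEQ_Suc[OF P(2)]] by simp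
    show "\<forall>\<^sub>F k in sequentially. sqrt (f (Suc k)) \<le> sqrt C * L2_norm \<Omega> (P (Suc k))"
      using real_sqrt_le_mono[OF f(2)] by (intro always_eventually allI) (simp add: L2_norm_def real_sqrt_mult)
    show "\<forall>\<^sub>F k in sequentially. 0 \<le> sqrt (f (Suc k))"
      using f(1) by (intro always_eventually allI) simp
  qed
  then show ?thesis by (rule LIMSEQ_imp_Suc)
qed

end

text \<open>The error system on a single interval. \<open>g i\<close> stands for
  \<open>tau * beta\<close>, and the time matrix is represented by two properties, its symmetric
  part and a left inverse. Each equation is posed for iterate \<open>Suc k\<close>; iterate 0 enters
  as data of the flow equation.\<close>

locale iteration_errors = discrete_biot \<Omega> Th TK s M b mu lam L K
  for \<Omega> :: "(real^'d::finite) set" and Th TK s M b mu lam L K +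
  fixes r :: nat and \<alpha> A :: "nat \<Rightarrow> nat \<Rightarrow> real" and g x y :: "nat \<Rightarrow> real"
    and ep :: "nat \<Rightarrow> nat \<Rightarrow> real^'d \<Rightarrow> real" and eq eu :: "nat \<Rightarrow> nat \<Rightarrow> real^'d \<Rightarrow> real^'d"
  assumes ep: "\<And>k j. j \<le> r \<Longrightarrow> ep k j \<in> W" and eq: "\<And>k j. j \<le> r \<Longrightarrow> eq k j \<in> V"
    and eu: "\<And>k j. j \<le> r \<Longrightarrow> eu k j \<in> H"
    and g: "\<And>i. i \<le> r \<Longrightarrow> 0 < g i"
    and sym_part: "\<And>i j. \<alpha> i j + \<alpha> j i = x i * x j + y i * y j"
    and left_inverse: "\<And>l j. l \<le> r \<Longrightarrow> j \<le> r \<Longrightarrow> (\<Sum>i\<le>r. A l i * \<alpha> i j) = (if l = j then 1 else 0)"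
    and flow: "\<And>k i w. i \<le> r \<Longrightarrow> w \<in> W \<Longrightarrow>
      (1 / M) * (\<Sum>j\<le>r. \<alpha> i j * ip (ep (Suc k) j) w)
      + L * (\<Sum>j\<le>r. \<alpha> i j * ip (\<lambda>x. ep (Suc k) j x - ep k j x) w)
      + g i * ip (divergence (eq (Suc k) i)) w
      = - b * (\<Sum>j\<le>r. \<alpha> i j * ip (divergence (eu k j)) w)"
    and darcy: "\<And>k i v. i \<le> r \<Longrightarrow> v \<in> V \<Longrightarrow> darcy (eq (Suc k) i) v = ip (ep (Suc k) i) (divergence v)"
    and mechanics: "\<And>k i z. i \<le> r \<Longrightarrow> z \<in> H \<Longrightarrow> elastic (eu (Suc k) i) z = b * ip (ep (Suc k) i) (divergence z)"
begin

definition S_p :: "nat \<Rightarrow> nat \<Rightarrow> real^'d \<Rightarrow> real" where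
  "S_p k i = (\<lambda>x. \<Sum>j\<le>r. \<alpha> i j *\<^sub>R ep k j x)"

definition S_u :: "nat \<Rightarrow> nat \<Rightarrow> real^'d \<Rightarrow> real^'d" where
  "S_u k i = (\<lambda>x. \<Sum>j\<le>r. \<alpha> i j *\<^sub>R eu k j x)"

text \<open>With the weights \<open>1 / g i\<close> the flux terms add up to the form of the symmetric part of \<open>\<alpha>\<close>,
  which is nonnegative.\<close>

definition energy :: "nat \<Rightarrow> real" where
  "energy k = (\<Sum>i\<le>r. ip (S_p k i) (S_p k i) / g i)"

text \<open>Of the coefficient \<open>1 / M + L\<close> of the new iterate, \<open>L / 2\<close> is
  spent on its share of the coupling bound; the share of the old iterate is the numerator.\<close>

definition rate :: real where
  "rate = (L / 2) / (1 / M + L / 2)"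

lemma S_p_mem: "S_p k i \<in> W"
  unfolding S_p_def using ep by (intro psd_form.sum_mem[OF W_form]) auto

lemma S_u_mem: "S_u k i \<in> H"
  unfolding S_u_def using eu by (intro psd_form.sum_mem[OF elastic_form]) auto

lemma S_p_nonneg: "0 \<le> ip (S_p k i) (S_p k i)"
  by (rule psd_form.nonneg[OF W_form S_p_mem])

lemma S_p_left: "w \<in> L2 \<Omega> \<Longrightarrow> ip (S_p k i) w = (\<Sum>j\<le>r. \<alpha> i j * ip (ep k j) w)"
  unfolding S_p_def using ep W_L2 by (intro psd_form.sum_left[OF psd_form_L2]) auto

lemma S_u_divergence: "w \<in> L2 \<Omega> \<Longrightarrow> ip (divergence (S_u k i)) w = (\<Sum>j\<le>r. \<alpha> i j * ip (divergence (eu k j)) w)"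
  unfolding S_u_def using eu by (intro L2_operator.inner_sum[OF L2_operator_divergence_H]) auto

lemma S_p_mechanics: "z \<in> H \<Longrightarrow> elastic (S_u (Suc k) i) z = b * ip (S_p (Suc k) i) (divergence z)"
proof -
  assume z: "z \<in> H"
  have "elastic (S_u (Suc k) i) z = (\<Sum>j\<le>r. \<alpha> i j * elastic (eu (Suc k) j) z)"
    unfolding S_u_def using eu z by (intro psd_form.sum_left[OF elastic_form]) auto
  also have "\<dots> = b * (\<Sum>j\<le>r. \<alpha> i j * ip (ep (Suc k) j) (divergence z))"
    unfolding sum_distrib_left using mechanics z by (intro sum.cong refl) auto
  finally show ?thesis using z by (simp add: S_p_left divergence_H_L2)
qed

lemma S_p_flow:
  assumes "i \<le> r" "w \<in> W"
  shows "(1 / M + L) * ip (S_p (Suc k) i) w + g i * ip (divergence (eq (Suc k) i)) w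
    = L * ip (S_p k i) w - b * ip (divergence (S_u k i)) w"
proof -
  have w: "w \<in> L2 \<Omega>" using assms(2) by (rule W_L2)
  have "(\<Sum>j\<le>r. \<alpha> i j * ip (\<lambda>x. ep (Suc k) j x - ep k j x) w) = (\<Sum>j\<le>r. \<alpha> i j * (ip (ep (Suc k) j) w - ip (ep k j) w))"
    using ep W_L2 w by (intro sum.cong refl arg_cong2[where f = "(*)"] psd_form.diff_left[OF psd_form_L2]) auto
  also have "\<dots> = ip (S_p (Suc k) i) w - ip (S_p k i) w"
    by (simp add: S_p_left w sum_subtractf right_diff_distrib)
  finally have d: "(\<Sum>j\<le>r. \<alpha> i j * ip (\<lambda>x. ep (Suc k) j x - ep k j x) w) = ip (S_p (Suc k) i) w - ip (S_p k i) w" .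
  show ?thesis
    using flow[OF assms, of k] unfolding d S_p_left[OF w, symmetric] S_u_divergence[OF w, symmetric]
    by (simp add: algebra_simps)
qed

lemma dissipation_nonneg: "0 \<le> (\<Sum>i\<le>r. ip (divergence (eq (Suc k) i)) (S_p (Suc k) i))"
proof -
  have "0 \<le> (\<Sum>i\<le>r. \<Sum>j\<le>r. \<alpha> i j * darcy (eq (Suc k) j) (eq (Suc k) i))"
    using eq sym_part by (intro psd_form.sum_symmetric_part_nonneg[OF darcy_form]) auto
  also have "\<dots> = (\<Sum>i\<le>r. ip (divergence (eq (Suc k) i)) (S_p (Suc k) i))"
  proof (rule sum.cong[OF refl])
    fix i assume i: "i \<in> {..r}"
    then have d: "divergence (eq (Suc k) i) \<in> L2 \<Omega>" using eq divergence_V_L2 by auto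
    have "(\<Sum>j\<le>r. \<alpha> i j * darcy (eq (Suc k) j) (eq (Suc k) i)) = ip (S_p (Suc k) i) (divergence (eq (Suc k) i))"
      unfolding S_p_left[OF d] using darcy eq i by (intro sum.cong refl) auto
    also have "\<dots> = ip (divergence (eq (Suc k) i)) (S_p (Suc k) i)"
      by (rule psd_form.sym[OF psd_form_L2 W_L2[OF S_p_mem] d])
    finally show "(\<Sum>j\<le>r. \<alpha> i j * darcy (eq (Suc k) j) (eq (Suc k) i)) = ip (divergence (eq (Suc k) i)) (S_p (Suc k) i)" .
  qed
  finally show ?thesis .
qed

text \<open>The coupling bound needs the mechanics equation for the new and for the old iterate, so
  both indices are at least 1.\<close>

lemma energy_decreases: "energy (Suc (Suc k)) \<le> rate * energy (Suc k)"
proof -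
  let ?k = "Suc k"
  have le: "(1 / M + L / 2) * (ip (S_p (Suc ?k) i) (S_p (Suc ?k) i) / g i) + ip (divergence (eq (Suc ?k) i)) (S_p (Suc ?k) i)
      \<le> L / 2 * (ip (S_p ?k i) (S_p ?k i) / g i)" if i: "i \<le> r" for i
  proof -
    let ?X = "S_p (Suc ?k) i" and ?Y = "S_p ?k i"
    have "(1 / M + L) * ip ?X ?X + g i * ip (divergence (eq (Suc ?k) i)) ?X
      = L * ip ?Y ?X - b * ip (divergence (S_u ?k i)) ?X" by (rule S_p_flow[OF i S_p_mem])
    also have "\<dots> \<le> L / 2 * (ip ?X ?X + ip ?Y ?Y)"
      by (rule coupling_bound[OF W_L2[OF S_p_mem] W_L2[OF S_p_mem] S_u_mem S_u_mem S_p_mechanics S_p_mechanics])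
    finally have "((1 / M + L / 2) * ip ?X ?X + g i * ip (divergence (eq (Suc ?k) i)) ?X) \<le> L / 2 * ip ?Y ?Y"
      by (simp add: algebra_simps)
    from divide_right_mono[OF this less_imp_le[OF g[OF i]]] show ?thesis
      using g[OF i] by (simp add: add_divide_distrib)
  qed
  have "(1 / M + L / 2) * energy (Suc ?k) \<le> (1 / M + L / 2) * energy (Suc ?k)
      + (\<Sum>i\<le>r. ip (divergence (eq (Suc ?k) i)) (S_p (Suc ?k) i))"
    using dissipation_nonneg[of ?k] by simp
  also have "\<dots> = (\<Sum>i\<le>r. (1 / M + L / 2) * (ip (S_p (Suc ?k) i) (S_p (Suc ?k) i) / g i)
      + ip (divergence (eq (Suc ?k) i)) (S_p (Suc ?k) i))"
    by (simp only: energy_def sum_distrib_left sum.distrib)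
  also have "\<dots> \<le> (\<Sum>i\<le>r. L / 2 * (ip (S_p ?k i) (S_p ?k i) / g i))"
    by (intro sum_mono le) simp
  also have "\<dots> = L / 2 * energy ?k" by (simp only: energy_def sum_distrib_left)
  finally have *: "(1 / M + L / 2) * energy (Suc ?k) \<le> L / 2 * energy ?k" .
  have "0 < 1 / M + L / 2" using M L by (simp add: add_pos_pos)
  then have "energy (Suc ?k) \<le> (L / 2 * energy ?k) / (1 / M + L / 2)"
    by (subst pos_le_divide_eq) (use * in \<open>simp_all add: mult.commute\<close>)
  then show ?thesis unfolding rate_def by simp
qed

lemma rate: "0 < rate" "rate < 1"
  using M L by (simp_all add: rate_def add_pos_pos)

lemma energy_geometric: "energy (Suc k) \<le> rate ^ k * energy 1"
proof (induction k)
  case (Suc k)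
  have "energy (Suc (Suc k)) \<le> rate * energy (Suc k)" by (rule energy_decreases)
  also have "\<dots> \<le> rate * (rate ^ k * energy 1)" using Suc rate by (intro mult_left_mono) auto
  finally show ?case by simp
qed simp

lemma S_p_geometric:
  assumes i: "i \<le> r"
  shows "\<exists>C\<ge>0. \<exists>\<theta>. 0 < \<theta> \<and> \<theta> < 1 \<and> (\<forall>k. L2_norm \<Omega> (S_p k i) \<le> C * \<theta> ^ k)"
proof -
  have nn: "0 \<le> energy k" for k
    unfolding energy_def using S_p_nonneg g by (intro sum_nonneg divide_nonneg_pos) auto
  have le: "ip (S_p k i) (S_p k i) \<le> g i * energy k" for k
  proof -
    have "ip (S_p k i) (S_p k i) / g i \<le> energy k"
      unfolding energy_def using i S_p_nonneg g by (intro member_le_sum divide_nonneg_pos) auto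
    then show ?thesis using g[OF i] by (simp add: field_simps)
  qed
  \<comment> \<open>The first summand covers \<open>k = 0\<close>. The second starts from
    \<open>energy 1\<close>, so the exponent lags one behind \<open>k\<close> and the division by
    \<open>sqrt rate\<close> makes up for it; the square roots appear because \<open>energy\<close>
    is quadratic.\<close>
  define C where "C = L2_norm \<Omega> (S_p 0 i) + sqrt (g i * energy 1) / sqrt rate"
  have n0: "0 \<le> L2_norm \<Omega> (S_p 0 i)" using S_p_nonneg by (simp add: L2_norm_def)
  have gE: "0 \<le> g i * energy 1" using g[OF i] nn by simp
  have "L2_norm \<Omega> (S_p k i) \<le> C * sqrt rate ^ k" for k
  proof (cases k)
    case 0
    then show ?thesis using gE rate by (simp add: C_def)
  next
    case (Suc l)
    have "ip (S_p k i) (S_p k i) \<le> g i * (rate ^ l * energy 1)"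
      using le[of k] mult_left_mono[OF energy_geometric[of l] less_imp_le[OF g[OF i]]] unfolding Suc by linarith
    then have "L2_norm \<Omega> (S_p k i) \<le> sqrt (g i * energy 1) * sqrt rate ^ l"
      unfolding L2_norm_def by (simp add: real_sqrt_mult[symmetric] real_sqrt_power[symmetric] mult.left_commute mult.commute)
    also have "\<dots> = sqrt (g i * energy 1) / sqrt rate * sqrt rate ^ k" using rate Suc by simp
    also have "\<dots> \<le> C * sqrt rate ^ k" using n0 rate by (intro mult_right_mono) (simp_all add: C_def)
    finally show ?thesis .
  qed
  moreover have "0 \<le> C" using n0 gE rate by (simp add: C_def)
  ultimately show ?thesis using rate by (intro exI[of _ C] exI[of _ "sqrt rate"] conjI allI) auto
qed

lemma pressure_tendsto:
  assumes i: "i \<le> r"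
  shows "(\<lambda>k. L2_norm \<Omega> (ep k i)) \<longlonglongrightarrow> 0"
proof -
  have "(\<lambda>k. L2_norm \<Omega> (S_p k j)) \<longlonglongrightarrow> 0" if j: "j \<le> r" for j
  proof -
    obtain C \<theta> where C: "0 < \<theta>" "\<theta> < 1" "\<And>k. L2_norm \<Omega> (S_p k j) \<le> C * \<theta> ^ k"
      using S_p_geometric[OF j] by blast
    show ?thesis
    proof (rule tendsto_sandwich[OF _ _ tendsto_const])
      show "(\<lambda>k. C * \<theta> ^ k) \<longlonglongrightarrow> 0"
        using C(1,2) by (intro tendsto_mult_right_zero LIMSEQ_realpow_zero) auto
    qed (use C(3) S_p_nonneg in \<open>auto simp: L2_norm_def\<close>)
  qed
  then have "(\<lambda>k. sqrt (ip (\<lambda>x. \<Sum>j\<le>r. A i j *\<^sub>R S_p k j x) (\<lambda>x. \<Sum>j\<le>r. A i j *\<^sub>R S_p k j x))) \<longlonglongrightarrow> 0"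
    using S_p_mem by (intro psd_form.tendsto_sum_zero[OF W_form, of "{..r}" "\<lambda>j k. S_p k j"]) (auto simp: L2_norm_def)
  moreover have "(\<lambda>x. \<Sum>j\<le>r. A i j *\<^sub>R S_p k j x) = ep k i" for k
  proof
    fix z
    have "(\<Sum>j\<le>r. A i j *\<^sub>R S_p k j z) = (\<Sum>j\<le>r. \<Sum>l\<le>r. A i j * \<alpha> j l * ep k l z)"
      by (simp add: S_p_def sum_distrib_left mult.assoc)
    also have "\<dots> = (\<Sum>l\<le>r. (\<Sum>j\<le>r. A i j * \<alpha> j l) * ep k l z)"
      by (subst sum.swap) (simp add: sum_distrib_right)
    also have "\<dots> = (\<Sum>l\<le>r. if i = l then ep k l z else 0)"
      using left_inverse[OF i] by (intro sum.cong) auto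
    finally show "(\<Sum>j\<le>r. A i j *\<^sub>R S_p k j z) = ep k i z" using i by simp
  qed
  ultimately show ?thesis by (simp add: L2_norm_def)
qed

lemma flux_tendsto:
  assumes i: "i \<le> r"
  shows "(\<lambda>k. Hdiv_norm \<Omega> (eq k i)) \<longlonglongrightarrow> 0"
proof -
  obtain C where C: "0 \<le> C" "\<And>q P. q \<in> V \<Longrightarrow> P \<in> L2 \<Omega> \<Longrightarrow> (\<forall>v\<in>V. darcy q v = ip P (divergence v)) \<Longrightarrow>
     ip q q + ip (divergence q) (divergence q) \<le> C * ip P P"
    using Hdiv_le_pressure by blast
  have "(\<lambda>k. sqrt (ip (eq k i) (eq k i) + ip (divergence (eq k i)) (divergence (eq k i)))) \<longlonglongrightarrow> 0"
  proof (rule tendsto_zero_dominated[OF W_L2[OF ep[OF i]] pressure_tendsto[OF i] _ _ C(1)])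
    show "0 \<le> ip (eq k i) (eq k i) + ip (divergence (eq k i)) (divergence (eq k i))" for k
      using psd_form.nonneg[OF Hdiv_form eq[OF i, of k]] by simp
    show "ip (eq (Suc k) i) (eq (Suc k) i) + ip (divergence (eq (Suc k) i)) (divergence (eq (Suc k) i))
      \<le> C * ip (ep (Suc k) i) (ep (Suc k) i)" for k
      using darcy[OF i] by (intro C(2) eq[OF i] W_L2[OF ep[OF i]]) auto
  qed
  then show ?thesis by (simp only: Hdiv_norm_eq[OF eq[OF i]])
qed

lemma displacement_tendsto:
  assumes i: "i \<le> r"
  shows "(\<lambda>k. H1_norm \<Omega> (eu k i)) \<longlonglongrightarrow> 0"
proof -
  obtain C where C: "0 \<le> C" "\<And>U P. U \<in> H \<Longrightarrow> P \<in> L2 \<Omega> \<Longrightarrow> (\<forall>z\<in>H. elastic U z = b * ip P (divergence z)) \<Longrightarrow>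
     ip U U + ip (vgrad U) (vgrad U) \<le> C * ip P P"
    using H1_le_pressure by blast
  have "(\<lambda>k. sqrt (ip (eu k i) (eu k i) + ip (vgrad (eu k i)) (vgrad (eu k i)))) \<longlonglongrightarrow> 0"
  proof (rule tendsto_zero_dominated[OF W_L2[OF ep[OF i]] pressure_tendsto[OF i] _ _ C(1)])
    show "0 \<le> ip (eu k i) (eu k i) + ip (vgrad (eu k i)) (vgrad (eu k i))" for k
      using psd_form.nonneg[OF H1_form eu[OF i, of k]] by simp
    show "ip (eu (Suc k) i) (eu (Suc k) i) + ip (vgrad (eu (Suc k) i)) (vgrad (eu (Suc k) i))
      \<le> C * ip (ep (Suc k) i) (ep (Suc k) i)" for k
      using mechanics[OF i] by (intro C(2) eu[OF i] W_L2[OF ep[OF i]]) auto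
  qed
  then show ?thesis by (simp only: H1_norm_eq[OF eu[OF i]])
qed

end

section \<open>Traces and limits of the iterates\<close>

lemma left_trace_represented:
  fixes v :: "real \<Rightarrow> 'a \<Rightarrow> 'b::real_normed_vector"
  assumes v: "represented_by r N t tq v Y" and n: "n \<in> {1..N}" and step: "t (n - 1) < t n"
  shows "left_trace v (t n) = (\<lambda>x. \<Sum>j\<le>r. poly (basis_fun r tq n j) (t n) *\<^sub>R Y n j x)"
proof
  fix x
  let ?g = "\<lambda>\<sigma>. \<Sum>j\<le>r. poly (basis_fun r tq n j) \<sigma> *\<^sub>R Y n j x"
  have "((\<lambda>\<theta>. v \<theta> x) \<longlongrightarrow> ?g (t n)) (at_left (t n))"
  proof (rule Lim_transform_eventually)
    show "(?g \<longlongrightarrow> ?g (t n)) (at_left (t n))"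
      by (intro tendsto_intros tendsto_poly)
    show "\<forall>\<^sub>F \<theta> in at_left (t n). ?g \<theta> = v \<theta> x"
      using eventually_at_leftI[OF _ step, of "\<lambda>\<theta>. ?g \<theta> = v \<theta> x"] v n by (simp add: represented_by_def)
  qed
  then show "left_trace v (t n) x = ?g (t n)"
    unfolding left_trace_def by (intro tendsto_Lim) simp_all
qed

text \<open>The intervals are open on the left, so the limit from the right at \<open>t n\<close> is
  governed by the coefficients of interval \<open>Suc n\<close>.\<close>

lemma right_trace_represented:
  fixes v :: "real \<Rightarrow> 'a \<Rightarrow> 'b::real_normed_vector"
  assumes v: "represented_by r N t tq v Y" and n: "Suc n \<in> {1..N}" and step: "t n < t (Suc n)"
  shows "right_trace v (t n) = (\<lambda>x. \<Sum>j\<le>r. poly (basis_fun r tq (Suc n) j) (t n) *\<^sub>R Y (Suc n) j x)"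
proof
  fix x
  let ?g = "\<lambda>\<sigma>. \<Sum>j\<le>r. poly (basis_fun r tq (Suc n) j) \<sigma> *\<^sub>R Y (Suc n) j x"
  have "((\<lambda>\<theta>. v \<theta> x) \<longlongrightarrow> ?g (t n)) (at_right (t n))"
  proof (rule Lim_transform_eventually)
    show "(?g \<longlongrightarrow> ?g (t n)) (at_right (t n))"
      by (intro tendsto_intros tendsto_poly)
    show "\<forall>\<^sub>F \<theta> in at_right (t n). ?g \<theta> = v \<theta> x"
    proof (rule eventually_at_rightI[OF _ step])
      fix \<theta> assume "\<theta> \<in> {t n<..<t (Suc n)}"
      then show "?g \<theta> = v \<theta> x"
        using bspec[OF v[unfolded represented_by_def] n] by simp
    qed
  qed
  then show "right_trace v (t n) x = ?g (t n)"
    unfolding right_trace_def by (intro tendsto_Lim) simp_all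
qed

context psd_form
begin

lemma converges_in_sum:
  assumes nrm: "\<And>f. f \<in> X \<Longrightarrow> nrm f = sqrt (B f f)"
    and I: "finite I" and mem: "\<And>j k. j \<in> I \<Longrightarrow> v k j \<in> X" "\<And>j. j \<in> I \<Longrightarrow> w j \<in> X"
    and lim: "\<And>j. j \<in> I \<Longrightarrow> (\<lambda>k. nrm (\<lambda>x. v k j x - w j x)) \<longlonglongrightarrow> 0"
  shows "converges_in X nrm (\<lambda>k x. \<Sum>j\<in>I. c j *\<^sub>R v k j x) (\<lambda>x. \<Sum>j\<in>I. c j *\<^sub>R w j x)"
  unfolding converges_in_def
proof (intro conjI allI)
  show "(\<lambda>x. \<Sum>j\<in>I. c j *\<^sub>R v k j x) \<in> X" for k using I mem by (intro sum_mem) auto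
  show "(\<lambda>x. \<Sum>j\<in>I. c j *\<^sub>R w j x) \<in> X" using I mem by (intro sum_mem) auto
  have d: "(\<lambda>x. v k j x - w j x) \<in> X" if "j \<in> I" for j k using mem that by (intro diff_mem) auto
  have eq: "(\<lambda>x. (\<Sum>j\<in>I. c j *\<^sub>R v k j x) - (\<Sum>j\<in>I. c j *\<^sub>R w j x)) = (\<lambda>x. \<Sum>j\<in>I. c j *\<^sub>R (v k j x - w j x))" for k
    by (simp add: sum_subtractf scaleR_diff_right)
  have dm: "(\<lambda>x. \<Sum>j\<in>I. c j *\<^sub>R (v k j x - w j x)) \<in> X" for k using I d by (intro sum_mem) auto
  show "(\<lambda>k. nrm (\<lambda>x. (\<Sum>j\<in>I. c j *\<^sub>R v k j x) - (\<Sum>j\<in>I. c j *\<^sub>R w j x))) \<longlonglongrightarrow> 0"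
    unfolding eq nrm[OF dm]
    by (rule tendsto_sum_zero[OF I, of "\<lambda>j k x. v k j x - w j x"]) (use d lim nrm in auto)
qed

text \<open>\<open>lim_in\<close> picks some limit. One exists, namely \<open>w\<close>, and the
  triangle inequality through \<open>v k\<close> makes the distance between two limits zero;
  equality of functions is out of reach for a semidefinite \<open>B\<close>.\<close>

lemma lim_in_eq:
  assumes nrm: "\<And>f. f \<in> X \<Longrightarrow> nrm f = sqrt (B f f)" and w: "converges_in X nrm v w"
  shows "lim_in X nrm v \<in> X" "B (\<lambda>x. lim_in X nrm v x - w x) (\<lambda>x. lim_in X nrm v x - w x) = 0"
proof -
  define w' where "w' = lim_in X nrm v"
  have w': "converges_in X nrm v w'" unfolding w'_def lim_in_def by (rule someI[of "converges_in X nrm v", OF w])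
  show wX': "lim_in X nrm v \<in> X" using w' by (simp add: converges_in_def w'_def)
  have X: "w \<in> X" "w' \<in> X" "v k \<in> X" for k using w w' by (auto simp: converges_in_def)
  let ?N = "\<lambda>f. sqrt (B f f)"
  have le: "?N (\<lambda>x. w' x - w x) \<le> ?N (\<lambda>x. v k x - w x) + ?N (\<lambda>x. v k x - w' x)" for k
  proof -
    have d: "(\<lambda>x. v k x - w x) \<in> X" "(\<lambda>x. v k x - w' x) \<in> X" using X by (auto intro: diff_mem)
    have "(\<lambda>x. w' x - w x) = (\<lambda>x. (v k x - w x) + (-1) *\<^sub>R (v k x - w' x))" by auto
    then have "?N (\<lambda>x. w' x - w x) = ?N (\<lambda>x. (v k x - w x) + (-1) *\<^sub>R (v k x - w' x))" by simp
    also have "\<dots> \<le> ?N (\<lambda>x. v k x - w x) + ?N (\<lambda>x. (-1) *\<^sub>R (v k x - w' x))"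
      by (rule norm_triangle[OF d(1) scale_mem[OF d(2)]])
    also have "?N (\<lambda>x. (-1) *\<^sub>R (v k x - w' x)) = ?N (\<lambda>x. v k x - w' x)"
      using norm_scale[OF d(2), of "-1"] by simp
    finally show ?thesis .
  qed
  have conv: "(\<lambda>k. ?N (\<lambda>x. v k x - z x)) \<longlonglongrightarrow> 0" if "converges_in X nrm v z" for z
  proof -
    have "(\<lambda>x. v k x - z x) \<in> X" for k using that by (intro diff_mem) (auto simp: converges_in_def)
    then show ?thesis using that nrm by (simp add: converges_in_def)
  qed
  have "?N (\<lambda>x. w' x - w x) \<le> 0"
    using tendsto_add[OF conv[OF w] conv[OF w']] le
    by (intro LIMSEQ_le_const[of _ 0]) auto
  moreover have "0 \<le> B (\<lambda>x. w' x - w x) (\<lambda>x. w' x - w x)" using X by (intro nonneg diff_mem)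
  ultimately show "B (\<lambda>x. lim_in X nrm v x - w x) (\<lambda>x. lim_in X nrm v x - w x) = 0"
    unfolding w'_def by simp
qed

end

context discrete_biot
begin

lemma L2_norm_eq: "L2_norm \<Omega> w = sqrt (ip w w)"
  by (simp add: L2_norm_def)

lemma H1_norm_form: "z \<in> H \<Longrightarrow> H1_norm \<Omega> z = sqrt (1 * ip z z + 1 * ip (vgrad z) (vgrad z))"
  by (simp only: H1_norm_eq mult_1)

lemma Hdiv_norm_form: "v \<in> V \<Longrightarrow> Hdiv_norm \<Omega> v = sqrt (1 * ip v v + 1 * ip (divergence v) (divergence v))"
  by (simp only: Hdiv_norm_eq mult_1)

text \<open>The flow equation sees displacements through their divergence, so two limits whose
  difference has \<open>H1\<close> norm zero are interchangeable in it.\<close>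

lemma divergence_null:
  assumes d: "d \<in> H" and z: "1 * ip d d + 1 * ip (vgrad d) (vgrad d) = 0" and w: "w \<in> L2 \<Omega>"
  shows "ip (divergence d) w = 0"
proof -
  have "0 \<le> ip d d" "0 \<le> ip (vgrad d) (vgrad d)"
    by (rule psd_form.nonneg[OF psd_form_L2 H_L2[OF d]],
        rule psd_form.nonneg[OF psd_form_L2 L2_operator.L2[OF L2_operator_vgrad_H d]])
  then have "ip (vgrad d) (vgrad d) = 0" using z by simp
  then have "AE x in lebesgue_on \<Omega>. vgrad d x = 0"
    by (rule L2_inner_self_eq_0[OF L2_operator.L2[OF L2_operator_vgrad_H d]])
  then have "AE x in lebesgue_on \<Omega>. divergence d x = 0"
    by eventually_elim (simp add: divergence_def trace_def)
  then have "ip (divergence d) w = ip (\<lambda>_. 0) w"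
    by (intro L2_inner_cong_AE divergence_H_L2[OF d] L2_zero w) auto
  then show ?thesis by (simp add: L2_inner_def)
qed

end

section \<open>Errors of the concrete scheme and induction over the time intervals\<close>

locale iterated_biot = discrete_biot \<Omega> Th TK s M b mu lam L K
  for \<Omega> :: "(real^'d::finite) set" and Th TK s M b mu lam L K +
  fixes f :: "real \<Rightarrow> real^'d \<Rightarrow> real" and r N :: nat and t :: "nat \<Rightarrow> real" and tq :: "nat \<Rightarrow> nat \<Rightarrow> real"
    and p :: "real \<Rightarrow> real^'d \<Rightarrow> real" and q u :: "real \<Rightarrow> real^'d \<Rightarrow> real^'d"
    and P :: "nat \<Rightarrow> nat \<Rightarrow> real^'d \<Rightarrow> real" and Q U :: "nat \<Rightarrow> nat \<Rightarrow> real^'d \<Rightarrow> real^'d"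
    and pk :: "nat \<Rightarrow> real \<Rightarrow> real^'d \<Rightarrow> real" and qk uk :: "nat \<Rightarrow> real \<Rightarrow> real^'d \<Rightarrow> real^'d"
    and Pk :: "nat \<Rightarrow> nat \<Rightarrow> nat \<Rightarrow> real^'d \<Rightarrow> real"
    and Qk Uk :: "nat \<Rightarrow> nat \<Rightarrow> nat \<Rightarrow> real^'d \<Rightarrow> real^'d"
  assumes step: "\<And>n. n \<in> {1..N} \<Longrightarrow> t (n - 1) < t n"
    and nodes: "\<And>n. n \<in> {1..N} \<Longrightarrow> inj_on (tq n) {..r}"
    and coupled: "coupled_solution \<Omega> W V H M b mu lam K f r N t tq p q u P Q U"
    and iterates: "fixed_stress_iterates \<Omega> W V H M b mu lam K f r N t tq L pk qk uk Pk Qk Uk"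
begin

lemma coupled_representation:
  "represented_by r N t tq p P" "represented_by r N t tq q Q" "represented_by r N t tq u U"
  using coupled by (auto simp: coupled_solution_def)

lemma iterates_representation:
  "represented_by r N t tq (pk k) (Pk k)" "represented_by r N t tq (qk k) (Qk k)" "represented_by r N t tq (uk k) (Uk k)"
  using iterates by (auto simp: fixed_stress_iterates_def)

lemma coefficients_mem:
  assumes "n \<in> {1..N}" "i \<le> r"
  shows "P n i \<in> W" "Q n i \<in> V" "U n i \<in> H" "Pk k n i \<in> W" "Qk k n i \<in> V" "Uk k n i \<in> H"
  using coupled iterates assms unfolding coupled_solution_def fixed_stress_iterates_def by blast+

definition error_p :: "nat \<Rightarrow> nat \<Rightarrow> nat \<Rightarrow> real^'d \<Rightarrow> real" where
  "error_p n k j = (\<lambda>x. Pk k n j x - P n j x)"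

definition error_q :: "nat \<Rightarrow> nat \<Rightarrow> nat \<Rightarrow> real^'d \<Rightarrow> real^'d" where
  "error_q n k j = (\<lambda>x. Qk k n j x - Q n j x)"

definition error_u :: "nat \<Rightarrow> nat \<Rightarrow> nat \<Rightarrow> real^'d \<Rightarrow> real^'d" where
  "error_u n k j = (\<lambda>x. Uk k n j x - U n j x)"

definition converged :: "nat \<Rightarrow> bool" where
  "converged n \<longleftrightarrow> (\<forall>i\<le>r. (\<lambda>k. L2_norm \<Omega> (error_p n k i)) \<longlonglongrightarrow> 0 \<and>
     (\<lambda>k. Hdiv_norm \<Omega> (error_q n k i)) \<longlonglongrightarrow> 0 \<and> (\<lambda>k. H1_norm \<Omega> (error_u n k i)) \<longlonglongrightarrow> 0)"

lemma converged_sum: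
  assumes n: "n \<in> {1..N}" and c: "converged n"
  shows "converges_in W (L2_norm \<Omega>) (\<lambda>k x. \<Sum>j\<le>r. a j *\<^sub>R Pk k n j x) (\<lambda>x. \<Sum>j\<le>r. a j *\<^sub>R P n j x)"
    and "converges_in V (Hdiv_norm \<Omega>) (\<lambda>k x. \<Sum>j\<le>r. a j *\<^sub>R Qk k n j x) (\<lambda>x. \<Sum>j\<le>r. a j *\<^sub>R Q n j x)"
    and "converges_in H (H1_norm \<Omega>) (\<lambda>k x. \<Sum>j\<le>r. a j *\<^sub>R Uk k n j x) (\<lambda>x. \<Sum>j\<le>r. a j *\<^sub>R U n j x)"
proof -
  have lim: "(\<lambda>k. L2_norm \<Omega> (\<lambda>x. Pk k n i x - P n i x)) \<longlonglongrightarrow> 0"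
    "(\<lambda>k. Hdiv_norm \<Omega> (\<lambda>x. Qk k n i x - Q n i x)) \<longlonglongrightarrow> 0"
    "(\<lambda>k. H1_norm \<Omega> (\<lambda>x. Uk k n i x - U n i x)) \<longlonglongrightarrow> 0" if "i \<in> {..r}" for i
    using c that by (simp_all add: converged_def error_p_def error_q_def error_u_def)
  have mem: "P n i \<in> W" "Q n i \<in> V" "U n i \<in> H" "Pk k n i \<in> W" "Qk k n i \<in> V" "Uk k n i \<in> H"
    if "i \<in> {..r}" for i k
    using that by (intro coefficients_mem[OF n]; simp)+
  show "converges_in W (L2_norm \<Omega>) (\<lambda>k x. \<Sum>j\<le>r. a j *\<^sub>R Pk k n j x) (\<lambda>x. \<Sum>j\<le>r. a j *\<^sub>R P n j x)"
    by (rule psd_form.converges_in_sum[OF W_form L2_norm_eq finite_atMost mem(4) mem(1) lim(1)])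
  show "converges_in V (Hdiv_norm \<Omega>) (\<lambda>k x. \<Sum>j\<le>r. a j *\<^sub>R Qk k n j x) (\<lambda>x. \<Sum>j\<le>r. a j *\<^sub>R Q n j x)"
    by (rule psd_form.converges_in_sum[OF Hdiv_form Hdiv_norm_form finite_atMost mem(5) mem(2) lim(2)])
  show "converges_in H (H1_norm \<Omega>) (\<lambda>k x. \<Sum>j\<le>r. a j *\<^sub>R Uk k n j x) (\<lambda>x. \<Sum>j\<le>r. a j *\<^sub>R U n j x)"
    by (rule psd_form.converges_in_sum[OF H1_form H1_norm_form finite_atMost mem(6) mem(3) lim(3)])
qed

lemma converged_left_trace:
  assumes n: "n \<in> {1..N}" and c: "converged n"
  shows "converges_in W (L2_norm \<Omega>) (\<lambda>k. left_trace (pk k) (t n)) (left_trace p (t n))"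
    and "converges_in V (Hdiv_norm \<Omega>) (\<lambda>k. left_trace (qk k) (t n)) (left_trace q (t n))"
    and "converges_in H (H1_norm \<Omega>) (\<lambda>k. left_trace (uk k) (t n)) (left_trace u (t n))"
  unfolding left_trace_represented[OF iterates_representation(1) n step[OF n]]
    left_trace_represented[OF iterates_representation(2) n step[OF n]]
    left_trace_represented[OF iterates_representation(3) n step[OF n]]
    left_trace_represented[OF coupled_representation(1) n step[OF n]]
    left_trace_represented[OF coupled_representation(2) n step[OF n]]
    left_trace_represented[OF coupled_representation(3) n step[OF n]]
  by (rule converged_sum[OF n c])+

lemma converged_right_trace:
  assumes n: "Suc n \<in> {1..N}" and c: "converged (Suc n)"
  shows "converges_in W (L2_norm \<Omega>) (\<lambda>k. right_trace (pk k) (t n)) (right_trace p (t n))"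
    and "converges_in V (Hdiv_norm \<Omega>) (\<lambda>k. right_trace (qk k) (t n)) (right_trace q (t n))"
    and "converges_in H (H1_norm \<Omega>) (\<lambda>k. right_trace (uk k) (t n)) (right_trace u (t n))"
  unfolding right_trace_represented[OF iterates_representation(1) n step[OF n, simplified]]
    right_trace_represented[OF iterates_representation(2) n step[OF n, simplified]]
    right_trace_represented[OF iterates_representation(3) n step[OF n, simplified]]
    right_trace_represented[OF coupled_representation(1) n step[OF n, simplified]]
    right_trace_represented[OF coupled_representation(2) n step[OF n, simplified]]
    right_trace_represented[OF coupled_representation(3) n step[OF n, simplified]]
  by (rule converged_sum[OF n c])+

definition p_prev :: "nat \<Rightarrow> real^'d \<Rightarrow> real" where
  "p_prev n = (if n = 1 then (\<lambda>_. 0) else left_trace p (t (n - 1)))"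

definition u_prev :: "nat \<Rightarrow> real^'d \<Rightarrow> real^'d" where
  "u_prev n = (if n = 1 then (\<lambda>_. 0) else left_trace u (t (n - 1)))"

definition pk_prev :: "nat \<Rightarrow> real^'d \<Rightarrow> real" where
  "pk_prev n = (if n = 1 then (\<lambda>_. 0) else lim_in W (L2_norm \<Omega>) (\<lambda>l. left_trace (pk l) (t (n - 1))))"

definition uk_prev :: "nat \<Rightarrow> real^'d \<Rightarrow> real^'d" where
  "uk_prev n = (if n = 1 then (\<lambda>_. 0) else lim_in H (H1_norm \<Omega>) (\<lambda>l. left_trace (uk l) (t (n - 1))))"

lemma coupled_equations:
  assumes n: "n \<in> {1..N}" and i: "i \<le> r"
  shows "w \<in> W \<Longrightarrow> (1 / M) * (\<Sum>j\<le>r. alpha' r t tq n i j * ip (P n j) w)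
      + tau t n * beta r t tq n i * ip (divergence (Q n i)) w
      = tau t n * beta r t tq n i * ip (f (tq n i)) w
        - b * (\<Sum>j\<le>r. alpha' r t tq n i j * ip (divergence (U n j)) w)
        + gam r t tq n i * (1 / M) * ip (p_prev n) w
        + gam r t tq n i * ip (\<lambda>x. b * divergence (u_prev n) x) w"
    and "v \<in> V \<Longrightarrow> darcy (Q n i) v - ip (P n i) (divergence v) = 0"
    and "z \<in> H \<Longrightarrow> elastic (U n i) z - b * ip (P n i) (divergence z) = 0"
  using coupled n i
  unfolding coupled_solution_def Let_def p_prev_def u_prev_def darcy_eq_def mechanics_eq_def elastic_def
  by blast+

lemma iterates_equations:
  assumes n: "n \<in> {1..N}" and i: "i \<le> r"
  shows "w \<in> W \<Longrightarrow> (1 / M) * (\<Sum>j\<le>r. alpha' r t tq n i j * ip (Pk (Suc k) n j) w)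
      + L * (\<Sum>j\<le>r. alpha' r t tq n i j * ip (\<lambda>x. Pk (Suc k) n j x - Pk k n j x) w)
      + tau t n * beta r t tq n i * ip (divergence (Qk (Suc k) n i)) w
      = tau t n * beta r t tq n i * ip (f (tq n i)) w
        - b * (\<Sum>j\<le>r. alpha' r t tq n i j * ip (divergence (Uk k n j)) w)
        + gam r t tq n i * (1 / M) * ip (pk_prev n) w
        + gam r t tq n i * ip (\<lambda>x. b * divergence (uk_prev n) x) w"
    and "v \<in> V \<Longrightarrow> darcy (Qk (Suc k) n i) v - ip (Pk (Suc k) n i) (divergence v) = 0"
    and "z \<in> H \<Longrightarrow> elastic (Uk (Suc k) n i) z - b * ip (Pk (Suc k) n i) (divergence z) = 0"
  using iterates n i
  unfolding fixed_stress_iterates_def Let_def pk_prev_def uk_prev_def darcy_eq_def mechanics_eq_def elastic_def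
  by blast+

text \<open>Convergence on interval \<open>n - 1\<close> guarantees that the limits selected by
  \<open>lim_in\<close> exist. They may differ from the traces of the coupled solution by functions
  of norm zero, which the inner products do not see.\<close>

lemma previous_values_agree:
  assumes n: "n \<in> {1..N}" and prev: "n = 1 \<or> converged (n - 1)" and w: "w \<in> L2 \<Omega>"
  shows "ip (pk_prev n) w = ip (p_prev n) w"
    and "ip (\<lambda>x. b * divergence (uk_prev n) x) w = ip (\<lambda>x. b * divergence (u_prev n) x) w"
proof -
  interpret L: psd_form "L2 \<Omega> :: (real^'d \<Rightarrow> real) set" ip by (rule psd_form_L2)
  have "ip (pk_prev n) w = ip (p_prev n) w \<and>
    ip (\<lambda>x. b * divergence (uk_prev n) x) w = ip (\<lambda>x. b * divergence (u_prev n) x) w"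
  proof (cases "n = 1")
    case True
    then show ?thesis by (simp add: pk_prev_def p_prev_def uk_prev_def u_prev_def)
  next
    case False
    then have n': "n - 1 \<in> {1..N}" using n by auto
    have c: "converged (n - 1)" using prev False by simp
    note tr = converged_left_trace[OF n' c]
    note p = psd_form.lim_in_eq[OF W_form L2_norm_eq tr(1)]
    note u = psd_form.lim_in_eq[OF H1_form H1_norm_form tr(3)]
    have P: "pk_prev n \<in> W" "p_prev n \<in> W"
      using p(1) tr(1) False by (simp_all add: pk_prev_def p_prev_def converges_in_def)
    have U: "uk_prev n \<in> H" "u_prev n \<in> H"
      using u(1) tr(3) False unfolding uk_prev_def u_prev_def converges_in_def by simp_all
    have "ip (\<lambda>x. pk_prev n x - p_prev n x) (\<lambda>x. pk_prev n x - p_prev n x) = 0"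
      using p(2) False by (simp add: pk_prev_def p_prev_def)
    then have "ip (\<lambda>x. pk_prev n x - p_prev n x) w = 0"
      by (rule L.null_left[OF L.diff_mem[OF W_L2[OF P(1)] W_L2[OF P(2)]] w])
    then have 1: "ip (pk_prev n) w = ip (p_prev n) w"
      using L.diff_left[OF W_L2[OF P(1)] W_L2[OF P(2)] w] by simp
    let ?d = "\<lambda>x. uk_prev n x - u_prev n x"
    have d: "?d \<in> H" by (rule psd_form.diff_mem[OF elastic_form U])
    have "1 * ip ?d ?d + 1 * ip (vgrad ?d) (vgrad ?d) = 0"
      using u(2) False unfolding uk_prev_def u_prev_def by simp
    from divergence_null[OF d this w] have "ip (divergence ?d) w = 0" .
    then have "ip (divergence (uk_prev n)) w = ip (divergence (u_prev n)) w"
      using L2_operator.inner_diff[OF L2_operator_divergence_H U w] by simp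
    then have "ip (\<lambda>x. b *\<^sub>R divergence (uk_prev n) x) w = ip (\<lambda>x. b *\<^sub>R divergence (u_prev n) x) w"
      unfolding L.scale_left[OF divergence_H_L2[OF U(1)] w] L.scale_left[OF divergence_H_L2[OF U(2)] w] by simp
    with 1 show ?thesis by simp
  qed
  then show "ip (pk_prev n) w = ip (p_prev n) w"
    "ip (\<lambda>x. b * divergence (uk_prev n) x) w = ip (\<lambda>x. b * divergence (u_prev n) x) w" by auto
qed

lemma error_mem:
  assumes "n \<in> {1..N}" "i \<le> r"
  shows "error_p n k i \<in> W" "error_q n k i \<in> V" "error_u n k i \<in> H"
  unfolding error_p_def error_q_def error_u_def
  by (rule psd_form.diff_mem[OF W_form] psd_form.diff_mem[OF darcy_form] psd_form.diff_mem[OF elastic_form];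
      rule coefficients_mem[OF assms])+

lemma error_flow:
  assumes n: "n \<in> {1..N}" and prev: "n = 1 \<or> converged (n - 1)" and i: "i \<le> r" and w: "w \<in> W"
  shows "(1 / M) * (\<Sum>j\<le>r. alpha' r t tq n i j * ip (error_p n (Suc k) j) w)
      + L * (\<Sum>j\<le>r. alpha' r t tq n i j * ip (\<lambda>x. error_p n (Suc k) j x - error_p n k j x) w)
      + tau t n * beta r t tq n i * ip (divergence (error_q n (Suc k) i)) w
      = - b * (\<Sum>j\<le>r. alpha' r t tq n i j * ip (divergence (error_u n k j)) w)"
proof -
  let ?a = "alpha' r t tq n i"
  have wL: "w \<in> L2 \<Omega>" using w by (rule W_L2)
  note mem = coefficients_mem[OF n]
  have 1: "(\<Sum>j\<le>r. ?a j * ip (error_p n (Suc k) j) w) = (\<Sum>j\<le>r. ?a j * ip (Pk (Suc k) n j) w) - (\<Sum>j\<le>r. ?a j * ip (P n j) w)"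
    unfolding sum_subtractf[symmetric] right_diff_distrib[symmetric] error_p_def
    by (intro sum.cong refl arg_cong2[where f = "(*)"] psd_form.diff_left[OF psd_form_L2] W_L2[OF mem(4)] W_L2[OF mem(1)] wL) auto
  \<comment> \<open>The coupled solution cancels in the increment, so the stabilization term needs
    no counterpart in the coupled equations.\<close>
  have 2: "(\<lambda>x. error_p n (Suc k) j x - error_p n k j x) = (\<lambda>x. Pk (Suc k) n j x - Pk k n j x)" for j
    by (simp add: error_p_def)
  have 3: "ip (divergence (error_q n (Suc k) i)) w = ip (divergence (Qk (Suc k) n i)) w - ip (divergence (Q n i)) w"
    unfolding error_q_def by (rule L2_operator.inner_diff[OF L2_operator_divergence_V mem(5)[OF i] mem(2)[OF i] wL])
  have 4: "(\<Sum>j\<le>r. ?a j * ip (divergence (error_u n k j)) w)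
      = (\<Sum>j\<le>r. ?a j * ip (divergence (Uk k n j)) w) - (\<Sum>j\<le>r. ?a j * ip (divergence (U n j)) w)"
    unfolding sum_subtractf[symmetric] right_diff_distrib[symmetric] error_u_def
    by (intro sum.cong refl arg_cong2[where f = "(*)"] L2_operator.inner_diff[OF L2_operator_divergence_H[where m = "s + 1"]] mem(6) mem(3) wL) auto
  \<comment> \<open>The source is common to both equations and the previous values agree as
    functionals, so only error terms survive the subtraction.\<close>
  show ?thesis
    using iterates_equations(1)[OF n i w, of k] coupled_equations(1)[OF n i w]
    unfolding 1 2 3 4 previous_values_agree[OF n prev wL] right_diff_distrib by linarith
qed

lemma error_darcy:
  assumes n: "n \<in> {1..N}" and i: "i \<le> r" and v: "v \<in> V"
  shows "darcy (error_q n (Suc k) i) v = ip (error_p n (Suc k) i) (divergence v)"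
proof -
  note mem = coefficients_mem[OF n i]
  have "darcy (error_q n (Suc k) i) v = darcy (Qk (Suc k) n i) v - darcy (Q n i) v"
    unfolding error_q_def by (rule psd_form.diff_left[OF darcy_form mem(5) mem(2) v])
  also have "\<dots> = ip (Pk (Suc k) n i) (divergence v) - ip (P n i) (divergence v)"
    using iterates_equations(2)[OF n i v, of k] coupled_equations(2)[OF n i v] by linarith
  also have "\<dots> = ip (error_p n (Suc k) i) (divergence v)"
    unfolding error_p_def
    by (rule psd_form.diff_left[OF psd_form_L2 W_L2[OF mem(4)] W_L2[OF mem(1)] divergence_V_L2[OF v], symmetric])
  finally show ?thesis .
qed

lemma error_mechanics:
  assumes n: "n \<in> {1..N}" and i: "i \<le> r" and z: "z \<in> H"
  shows "elastic (error_u n (Suc k) i) z = b * ip (error_p n (Suc k) i) (divergence z)"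
proof -
  note mem = coefficients_mem[OF n i]
  have "elastic (error_u n (Suc k) i) z = elastic (Uk (Suc k) n i) z - elastic (U n i) z"
    unfolding error_u_def by (rule psd_form.diff_left[OF elastic_form mem(6) mem(3) z])
  also have "\<dots> = b * (ip (Pk (Suc k) n i) (divergence z) - ip (P n i) (divergence z))"
    unfolding right_diff_distrib
    using iterates_equations(3)[OF n i z, of k] coupled_equations(3)[OF n i z] by linarith
  also have "ip (Pk (Suc k) n i) (divergence z) - ip (P n i) (divergence z) = ip (error_p n (Suc k) i) (divergence z)"
    unfolding error_p_def
    by (rule psd_form.diff_left[OF psd_form_L2 W_L2[OF mem(4)] W_L2[OF mem(1)] divergence_H_L2[OF z], symmetric])
  finally show ?thesis .
qed

lemma interval_converges:
  assumes n: "n \<in> {1..N}" and prev: "n = 1 \<or> converged (n - 1)"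
  shows "converged n"
    and "i \<le> r \<Longrightarrow> converges_geometrically_in W (L2_norm \<Omega>)
      (\<lambda>k x. \<Sum>j\<le>r. alpha' r t tq n i j * (Pk k n j x - P n j x)) (\<lambda>_. 0)"
proof -
  obtain A where A: "\<And>l j. l \<le> r \<Longrightarrow> j \<le> r \<Longrightarrow> (\<Sum>i\<le>r. A l i * alpha' r t tq n i j) = (if l = j then 1 else 0)"
    using alpha'_left_inverse[where t = t and tq = tq and n = n, OF step[OF n] nodes[OF n]] by blast
  \<comment> \<open>The symmetric part of the time matrix is built from the values of the basis at
    the two ends of the interval.\<close>
  interpret E: iteration_errors \<Omega> Th TK s M b mu lam L K r "alpha' r t tq n" A
      "\<lambda>i. tau t n * beta r t tq n i" "\<lambda>i. poly (basis_fun r tq n i) (t n)"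
      "\<lambda>i. poly (basis_fun r tq n i) (t (n - 1))" "error_p n" "error_q n" "error_u n"
    by unfold_locales
      (intro error_mem[OF n] A error_flow[OF n prev] error_darcy[OF n] error_mechanics[OF n]
        tau_beta_pos[where t = t and tq = tq and n = n, OF step[OF n] nodes[OF n]]
        alpha'_symmetric_part[where t = t and tq = tq and n = n, OF step[OF n] nodes[OF n]]; assumption)+
  show "converged n"
    unfolding converged_def
    using E.pressure_tendsto E.flux_tendsto E.displacement_tendsto by blast
  show "converges_geometrically_in W (L2_norm \<Omega>)
      (\<lambda>k x. \<Sum>j\<le>r. alpha' r t tq n i j * (Pk k n j x - P n j x)) (\<lambda>_. 0)" if i: "i \<le> r"
  proof -
    have S: "E.S_p k i = (\<lambda>x. \<Sum>j\<le>r. alpha' r t tq n i j * (Pk k n j x - P n j x))" for k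
      by (simp add: E.S_p_def error_p_def)
    show ?thesis
      using E.S_p_geometric[OF i] E.S_p_mem[of _ i] W_zero
      by (simp add: converges_geometrically_in_def S)
  qed
qed

lemma all_converged: "n \<in> {1..N} \<Longrightarrow> converged n"
proof (induction n)
  case (Suc n)
  have "Suc n = 1 \<or> converged (Suc n - 1)" using Suc by (cases n) auto
  with Suc.prems show ?case by (rule interval_converges(1))
qed simp

lemma all_geometric:
  assumes "n \<in> {1..N}" "i \<le> r"
  shows "converges_geometrically_in W (L2_norm \<Omega>)
    (\<lambda>k x. \<Sum>j\<le>r. alpha' r t tq n i j * (Pk k n j x - P n j x)) (\<lambda>_. 0)"
proof (rule interval_converges(2)[OF assms(1) _ assms(2)])
  show "n = 1 \<or> converged (n - 1)"
  proof (cases "n = 1")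
    case False
    then have "n - 1 \<in> {1..N}" using assms(1) by auto
    then show ?thesis using all_converged by blast
  qed simp
qed

end

section \<open>Convergence of the iterates to the coupled solution\<close>

theorem theorem4p5:
  fixes \<Omega> :: "(real^'d::finite) set"
    and Th :: "(real^'d) set set" and TK :: "(real^'d) set \<Rightarrow> real^'d \<Rightarrow> real^'d"
    and M b mu lam L T :: real
    and K :: "real^'d \<Rightarrow> real^'d^'d" and f :: "real \<Rightarrow> real^'d \<Rightarrow> real"
    and r s N :: nat and t :: "nat \<Rightarrow> real" and tq :: "nat \<Rightarrow> nat \<Rightarrow> real"
    and p :: "real \<Rightarrow> real^'d \<Rightarrow> real" and q u :: "real \<Rightarrow> real^'d \<Rightarrow> real^'d"
    and P :: "nat \<Rightarrow> nat \<Rightarrow> real^'d \<Rightarrow> real" and Q U :: "nat \<Rightarrow> nat \<Rightarrow> real^'d \<Rightarrow> real^'d"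
    and pk :: "nat \<Rightarrow> real \<Rightarrow> real^'d \<Rightarrow> real" and qk uk :: "nat \<Rightarrow> real \<Rightarrow> real^'d \<Rightarrow> real^'d"
    and Pk :: "nat \<Rightarrow> nat \<Rightarrow> nat \<Rightarrow> real^'d \<Rightarrow> real"
    and Qk Uk :: "nat \<Rightarrow> nat \<Rightarrow> nat \<Rightarrow> real^'d \<Rightarrow> real^'d"
  defines "W \<equiv> W_space \<Omega> Th TK s" and "V \<equiv> V_space \<Omega> Th TK s" and "H \<equiv> H_space \<Omega> Th TK (s + 1)"
  assumes dim: "CARD('d) = 2 \<or> CARD('d) = 3"
    and domain: "polyhedral_lipschitz_domain \<Omega>"
    and constants: "0 < M" "0 < b" "0 < mu" "0 < lam"
    and K: "permeability \<Omega> K"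
    and mesh: "mesh \<Omega> Th TK"
    and inf_sup: "inf_sup_stable \<Omega> W V"
    and grid: "0 < T" "time_grid N T t"
    and gauss: "\<forall>n\<in>{1..N}. gauss_points r (t (n - 1)) (t n) (tq n)"
    and source: "\<forall>n\<in>{1..N}. \<forall>i\<le>r. f (tq n i) \<in> L2 \<Omega>"
    and coupled: "coupled_solution \<Omega> W V H M b mu lam K f r N t tq p q u P Q U"
    and unique: "\<forall>p' q' u' P' Q' U'. coupled_solution \<Omega> W V H M b mu lam K f r N t tq p' q' u' P' Q' U' \<longrightarrow>
      (\<forall>n\<in>{1..N}. \<forall>i\<le>r. AE x in lebesgue_on \<Omega>. P' n i x = P n i x \<and> Q' n i x = Q n i x \<and> U' n i x = U n i x)"
    and iterates: "fixed_stress_iterates \<Omega> W V H M b mu lam K f r N t tq L pk qk uk Pk Qk Uk"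
    and L: "0 < L" "L \<ge> b\<^sup>2 / (2 * lam)"
  shows "(\<forall>n\<in>{1..N}. \<forall>i\<le>r.
            converges_geometrically_in W (L2_norm \<Omega>)
              (\<lambda>k x. \<Sum>j\<le>r. alpha' r t tq n i j * (Pk k n j x - P n j x)) (\<lambda>_. 0)) \<and>
         (\<forall>n\<in>{1..N}.
            converges_in W (L2_norm \<Omega>) (\<lambda>k. left_trace (pk k) (t n)) (left_trace p (t n)) \<and>
            converges_in V (Hdiv_norm \<Omega>) (\<lambda>k. left_trace (qk k) (t n)) (left_trace q (t n)) \<and>
            converges_in H (H1_norm \<Omega>) (\<lambda>k. left_trace (uk k) (t n)) (left_trace u (t n))) \<and>
         (\<forall>n\<in>{1..<N}.
            converges_in W (L2_norm \<Omega>) (\<lambda>k. right_trace (pk k) (t n)) (right_trace p (t n)) \<and>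
            converges_in V (Hdiv_norm \<Omega>) (\<lambda>k. right_trace (qk k) (t n)) (right_trace q (t n)) \<and>
            converges_in H (H1_norm \<Omega>) (\<lambda>k. right_trace (uk k) (t n)) (right_trace u (t n)))"
proof -
  have mesh': "fe_mesh \<Omega> Th TK"
    using domain mesh by unfold_locales (simp_all add: polyhedral_lipschitz_domain_def)
  interpret fe_mesh \<Omega> Th TK by (rule mesh')
  have step: "t (n - 1) < t n" if "n \<in> {1..N}" for n
    using grid(2) that unfolding time_grid_def by (metis One_nat_def Suc_pred' atLeastAtMost_iff less_eq_Suc_le)
  interpret iterated_biot \<Omega> Th TK s M b mu lam L K f r N t tq p q u P Q U pk qk uk Pk Qk Uk
    using dim constants K L coupled iterates gauss step unfolding W_def V_def H_def
    by unfold_locales (auto simp: gauss_points_def)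
  show ?thesis
    unfolding W_def V_def H_def
    \<comment> \<open>For \<open>n < N\<close> the right traces at \<open>t n\<close> rest on the
      convergence on interval \<open>Suc n\<close>.\<close>
    by (intro conjI ballI allI impI all_geometric converged_left_trace converged_right_trace all_converged) auto
qed

end
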